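(* Let $\{u_m\}$ be the sequence of cut-off minimizers constructed in the context. Then for any integer $k\ge1$, $$\Bigl \| \frac{u_k - u_{k-1}}{h}\Bigr\|_{L^2(\Omega)}^2 + \frac{1}{2} \|\nabla u_k\|_{L^2(\Omega)}^2 \leq \|v_0 \|_{L^2(\Omega)}^2 + \frac{1}{2} \|\nabla u_0\|_{L^2(\Omega)}^2 + \frac{1}{2} \|\nabla u_1\|_{L^2(\Omega)}^2 .$$
   Context: $\Omega\subset\mathbb R^N$ is a bounded Lipschitz domain, $h>0$ is a time step (obtained by dividing a time interval $(0,T)$ into $M$ equal parts), $v_0\in H^1_0(\Omega)$ is the initial velocity, $u_0\in H^1(\Omega)$ is the initial condition, and $\mathcal K:=\{u\in H^1(\Omega)\,:\,u=u_0\text{ on }\partial\Omega\}$. The functions $u_m$ are constructed iteratively: $u_0\in\mathcal K$ is given, $u_1:=u_0+hv_0\in\mathcal K$, and for every integer $m\ge 2$, $\widetilde u_m$ denotes a minimizer over $\mathcal K$ of $$J_m(u)= \int_{\Omega \cap \mathcal{S}_m(u)}\frac{|u -2u_{m-1} +u_{m-2}|^2}{2 h^2} \,dx + \frac{1}{4} \int_{\Omega} |\nabla u + \nabla u_{m-2}|^2 \,dx,$$ where $\mathcal S_m(u):=\{u>0\}\cup\{u_{m-1}>0\}\cup\{u_{m-2}>0\}$ with $\{u>0\}=\{x\in\Omega:u(x)>0\}$, and $u_m:=\max\{\widetilde u_m,0\}$ (the cut-off minimizer).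
   Formalization: The formal statement additionally assumes u_1 ≥ 0 almost everywhere in Ω; without a sign condition the estimate fails, e.g. for u_0 = -1, v_0 = 0, where u_2 = 0 and k = 2 violates it. *)

theory Defs
  imports "HOL-Analysis.Analysis"
begin

section \<open>Bounded Lipschitz domains\<close>

text \<open>Locally, up to a rotation of the coordinate axes, \<open>\<Omega>\<close> is the region above the graph of a
  Lipschitz function. Here the unit vector \<open>e\<close> is the vertical direction, and \<open>\<gamma>\<close> is a function on the
  hyperplane orthogonal to \<open>e\<close>.\<close>

definition lipschitz_boundary :: "'a::euclidean_space set \<Rightarrow> bool" where
  "lipschitz_boundary \<Omega> \<longleftrightarrow>
     (\<forall>p\<in>frontier \<Omega>. \<exists>r>0. \<exists>e \<gamma> L. norm e = 1 \<and> L-lipschitz_on {z. z \<bullet> e = 0} \<gamma> \<and>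
        \<Omega> \<inter> ball p r = {y \<in> ball p r. y \<bullet> e > \<gamma> (y - (y \<bullet> e) *\<^sub>R e)})"

definition bounded_lipschitz_domain :: "'a::euclidean_space set \<Rightarrow> bool" where
  "bounded_lipschitz_domain \<Omega> \<longleftrightarrow>
     open \<Omega> \<and> connected \<Omega> \<and> \<Omega> \<noteq> {} \<and> bounded \<Omega> \<and> lipschitz_boundary \<Omega>"


section \<open>Sobolev spaces\<close>

text \<open>Elements of \<open>L\<^sup>2\<close> and of the Sobolev spaces are represented by functions on the whole space, of
  which only the restriction to \<open>\<Omega>\<close>, up to null sets, matters.\<close>

definition L2_space :: "'a::euclidean_space set \<Rightarrow> ('a \<Rightarrow> 'b::euclidean_space) set" where
  "L2_space \<Omega> = {f \<in> borel_measurable (lebesgue_on \<Omega>). integrable (lebesgue_on \<Omega>) (\<lambda>x. (norm (f x))\<^sup>2)}"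

definition L2_norm :: "'a::euclidean_space set \<Rightarrow> ('a \<Rightarrow> 'b::euclidean_space) \<Rightarrow> real" where
  "L2_norm \<Omega> f = sqrt (LINT x|lebesgue_on \<Omega>. (norm (f x))\<^sup>2)"

abbreviation partial_deriv :: "'a::euclidean_space \<Rightarrow> ('a \<Rightarrow> real) \<Rightarrow> 'a \<Rightarrow> real" where
  "partial_deriv i f \<equiv> (\<lambda>x. frechet_derivative f (at x) i)"

fun C_k :: "nat \<Rightarrow> ('a::euclidean_space \<Rightarrow> real) \<Rightarrow> bool" where
  "C_k 0 f \<longleftrightarrow> continuous_on UNIV f"
| "C_k (Suc n) f \<longleftrightarrow> f differentiable_on UNIV \<and> (\<forall>i\<in>Basis. C_k n (partial_deriv i f))"

definition test_functions :: "'a::euclidean_space set \<Rightarrow> ('a \<Rightarrow> real) set" where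
  "test_functions \<Omega> =
     {\<phi>. (\<forall>n. C_k n \<phi>) \<and> compact (closure {x. \<phi> x \<noteq> 0}) \<and> closure {x. \<phi> x \<noteq> 0} \<subseteq> \<Omega>}"

definition has_weak_gradient ::
    "'a::euclidean_space set \<Rightarrow> ('a \<Rightarrow> real) \<Rightarrow> ('a \<Rightarrow> 'a) \<Rightarrow> bool" where
  "has_weak_gradient \<Omega> u g \<longleftrightarrow>
     (\<forall>\<phi>\<in>test_functions \<Omega>. \<forall>i\<in>Basis.
        (LINT x|lebesgue_on \<Omega>. u x * partial_deriv i \<phi> x) =
        - (LINT x|lebesgue_on \<Omega>. (g x \<bullet> i) * \<phi> x))"

definition H1_space :: "'a::euclidean_space set \<Rightarrow> ('a \<Rightarrow> real) set" where
  "H1_space \<Omega> = {u \<in> L2_space \<Omega>. \<exists>g\<in>L2_space \<Omega>. has_weak_gradient \<Omega> u g}"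

text \<open>For \<open>u \<in> H1_space \<Omega>\<close> with \<open>\<Omega>\<close> open, the weak gradient is unique up to a null set;
  \<open>weak_grad\<close> picks a representative.\<close>

definition weak_grad :: "'a::euclidean_space set \<Rightarrow> ('a \<Rightarrow> real) \<Rightarrow> 'a \<Rightarrow> 'a" where
  "weak_grad \<Omega> u = (SOME g. g \<in> L2_space \<Omega> \<and> has_weak_gradient \<Omega> u g)"

definition H1_norm :: "'a::euclidean_space set \<Rightarrow> ('a \<Rightarrow> real) \<Rightarrow> real" where
  "H1_norm \<Omega> u = sqrt ((L2_norm \<Omega> u)\<^sup>2 + (L2_norm \<Omega> (weak_grad \<Omega> u))\<^sup>2)"

definition H10_space :: "'a::euclidean_space set \<Rightarrow> ('a \<Rightarrow> real) set" where
  "H10_space \<Omega> =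
     {u \<in> H1_space \<Omega>. \<forall>\<epsilon>>0. \<exists>\<phi>\<in>test_functions \<Omega>. H1_norm \<Omega> (\<lambda>x. u x - \<phi> x) < \<epsilon>}"


section \<open>The minimization scheme\<close>

text \<open>The boundary condition \<open>u = u0\<close> on \<open>\<partial>\<Omega>\<close> is understood in the usual Sobolev sense
  \<open>u - u0 \<in> H\<^sup>1\<^sub>0(\<Omega>)\<close>.\<close>

definition admissible :: "'a::euclidean_space set \<Rightarrow> ('a \<Rightarrow> real) \<Rightarrow> ('a \<Rightarrow> real) set" where
  "admissible \<Omega> u0 = {u \<in> H1_space \<Omega>. (\<lambda>x. u x - u0 x) \<in> H10_space \<Omega>}"

text \<open>In \<open>positivity_set\<close> and \<open>functional_J\<close>, the arguments \<open>v\<close> and \<open>w\<close> are the two previous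
  iterates \<open>u\<^sub>m\<^sub>-\<^sub>1\<close> and \<open>u\<^sub>m\<^sub>-\<^sub>2\<close>.\<close>

definition positivity_set ::
    "'a::euclidean_space set \<Rightarrow> ('a \<Rightarrow> real) \<Rightarrow> ('a \<Rightarrow> real) \<Rightarrow> ('a \<Rightarrow> real) \<Rightarrow> 'a set" where
  "positivity_set \<Omega> v w u = {x\<in>\<Omega>. u x > 0} \<union> {x\<in>\<Omega>. v x > 0} \<union> {x\<in>\<Omega>. w x > 0}"

definition functional_J ::
    "'a::euclidean_space set \<Rightarrow> real \<Rightarrow> ('a \<Rightarrow> real) \<Rightarrow> ('a \<Rightarrow> real) \<Rightarrow> ('a \<Rightarrow> real) \<Rightarrow> real" where
  "functional_J \<Omega> h v w u =
     (LINT x|lebesgue_on (\<Omega> \<inter> positivity_set \<Omega> v w u). \<bar>u x - 2 * v x + w x\<bar>\<^sup>2 / (2 * h\<^sup>2))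
     + 1 / 4 * (LINT x|lebesgue_on \<Omega>. (norm (weak_grad \<Omega> u x + weak_grad \<Omega> w x))\<^sup>2)"

text \<open>\<open>u\<close> is a sequence of cut-off minimizers with initial data \<open>u 0\<close> and \<open>v0\<close>. Its members are
  elements of \<open>L\<^sup>2(\<Omega>)\<close>, so they are specified almost everywhere in \<open>\<Omega>\<close>.\<close>

definition cutoff_minimizers ::
    "'a::euclidean_space set \<Rightarrow> real \<Rightarrow> ('a \<Rightarrow> real) \<Rightarrow> (nat \<Rightarrow> 'a \<Rightarrow> real) \<Rightarrow> bool" where
  "cutoff_minimizers \<Omega> h v0 u \<longleftrightarrow>
     (AE x in lebesgue_on \<Omega>. u 1 x = u 0 x + h * v0 x) \<and>
     (\<forall>m\<ge>2. \<exists>u'. is_arg_min (functional_J \<Omega> h (u (m - 1)) (u (m - 2)))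
                    (\<lambda>w. w \<in> admissible \<Omega> (u 0)) u' \<and>
                  (AE x in lebesgue_on \<Omega>. u m x = max (u' x) 0))"

end

theory Submission
  imports Defs
begin

text \<open>Comparing the minimizer \<open>u'\<close> of \<open>J\<^sub>m\<close> with \<open>(1 - t) u' + t u\<^sub>m\<^sub>-\<^sub>2\<close> for small \<open>t > 0\<close> gives, with
  \<open>S = S\<^sub>m(u')\<close>,
  \<open>\<integral>\<^bsub>S\<^esub> (u' - u\<^sub>m\<^sub>-\<^sub>1)\<^sup>2 / h\<^sup>2 + 1/2 \<integral> |\<nabla>u'|\<^sup>2 \<le> \<integral>\<^bsub>S\<^esub> (u\<^sub>m\<^sub>-\<^sub>1 - u\<^sub>m\<^sub>-\<^sub>2)\<^sup>2 / h\<^sup>2 + 1/2 \<integral> |\<nabla>u\<^sub>m\<^sub>-\<^sub>2|\<^sup>2\<close>,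
  because \<open>S\<close> does not grow along the segment and both quadratic forms factor as differences of
  squares. Cutting off \<open>u'\<close> at \<open>0\<close> only decreases the left-hand side, and \<open>u\<^sub>m - u\<^sub>m\<^sub>-\<^sub>1\<close> vanishes outside
  \<open>S\<close> since \<open>u\<^sub>m\<^sub>-\<^sub>1 \<ge> 0\<close>; adding \<open>1/2 \<integral> |\<nabla>u\<^sub>m\<^sub>-\<^sub>1|\<^sup>2\<close> to both sides makes the estimate telescope. The cut-off
  stays admissible because \<open>u\<^sub>1 \<ge> 0\<close> has the prescribed boundary values. The facts needed about \<open>H\<^sup>1\<close>
  (uniqueness of the weak gradient, the gradient of the positive part, and that \<open>H\<^sup>1\<^sub>0\<close> contains the
  compactly supported functions of \<open>H\<^sup>1\<close>) are proved by mollification.\<close>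

section \<open>Smooth functions and mollifiers\<close>

text \<open>Testing minimality against \<open>w\<close> = \<open>u (m - 2)\<close> itself would only
  bound the sums \<open>u' - 2 * v + w\<close> and grad u' + grad w, where \<open>v\<close> =
  \<open>u (m - 1)\<close>. The first variation in the direction \<open>w - u'\<close> pairs each
  sum with the matching difference, and this pairing is what telescopes. As the positivity set
  depends discontinuously on its argument, the functional need not be differentiable, so only the
  one-sided inequality for small t > 0 is taken. The harder half is that the cut-off is again
  admissible. Boundary values are encoded by membership in the closure of the test functions, so the
  approximants have to be cut off as well. This destroys their smoothness but, relative to a
  nonnegative reference function, keeps compact support. Convergence of the gradients is in doubt
  only where the limit vanishes, and there its gradient is 0 almost everywhere. Because
  \<open>weak_grad\<close> is an arbitrary choice, the calculus is done with explicit
  representatives and transferred by uniqueness.\<close>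

definition smooth :: "('a::euclidean_space \<Rightarrow> real) \<Rightarrow> bool" where
  "smooth f \<longleftrightarrow> (\<forall>n. C_k n f)"

text \<open>The recursion of \<open>C_k\<close> peels off one partial derivative at a time, so
  induction on the order works once the function may vary over all of \<open>S\<close>. The basic
  smoothness proofs below consist in finding a set of differentiable functions that is closed under
  partial derivatives.\<close>

lemma smooth_coinduct:
  assumes "f \<in> S"
    and S: "\<And>g x. g \<in> S \<Longrightarrow> g differentiable (at x)"
      "\<And>g i. g \<in> S \<Longrightarrow> i \<in> Basis \<Longrightarrow> partial_deriv i g \<in> S"
  shows "smooth f"
proof -
  have "g \<in> S \<Longrightarrow> C_k n g" for n g
  proof (induction n arbitrary: g)
    case 0
    then show ?case
      using S(1) by (auto simp: continuous_on_eq_continuous_at differentiable_imp_continuous_within)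
  next
    case (Suc n)
    then show ?case
      using S by (auto simp: differentiable_on_def)
  qed
  with assms(1) show ?thesis by (auto simp: smooth_def)
qed

lemma smooth_differentiable: "smooth f \<Longrightarrow> f differentiable (at x)"
  unfolding smooth_def by (metis C_k.simps(2) UNIV_I differentiable_on_def)

lemma smooth_has_derivative: "smooth f \<Longrightarrow> (f has_derivative frechet_derivative f (at x)) (at x)"
  using smooth_differentiable frechet_derivative_works by blast

lemma smooth_partial_deriv: "smooth f \<Longrightarrow> i \<in> Basis \<Longrightarrow> smooth (partial_deriv i f)"
  unfolding smooth_def by (metis C_k.simps(2))

lemma smooth_continuous_on: "smooth f \<Longrightarrow> continuous_on S f"
  unfolding smooth_def by (metis C_k.simps(1) continuous_on_subset subset_UNIV)

lemma smooth_borel_measurable: "smooth f \<Longrightarrow> f \<in> borel_measurable borel"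
  by (simp add: smooth_continuous_on borel_measurable_continuous_onI)

lemma frechet_derivative_sum_Basis:
  assumes "f differentiable (at x)"
  shows "frechet_derivative f (at x) v = (\<Sum>i\<in>Basis. (v \<bullet> i) * partial_deriv i f x)"
proof -
  have "linear (frechet_derivative f (at x))"
    using assms by (rule linear_frechet_derivative)
  then have "frechet_derivative f (at x) (\<Sum>i\<in>Basis. (v \<bullet> i) *\<^sub>R i)
      = (\<Sum>i\<in>Basis. (v \<bullet> i) * partial_deriv i f x)"
    by (simp add: linear_sum linear_scale)
  then show ?thesis by (simp add: euclidean_representation)
qed

lemma smooth_lincomb:
  fixes f g :: "'a::euclidean_space \<Rightarrow> real"
  assumes "smooth f" "smooth g"
  shows "smooth (\<lambda>x. a * f x + b * g x)"
    and "partial_deriv i (\<lambda>x. a * f x + b * g x)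
      = (\<lambda>x. a * partial_deriv i f x + b * partial_deriv i g x)"
proof -
  have *: "((\<lambda>x. a * f x + b * g x) has_derivative
      (\<lambda>v. a * frechet_derivative f (at x) v + b * frechet_derivative g (at x) v)) (at x)"
    if "smooth f" "smooth g" for f g :: "'a \<Rightarrow> real" and x
    using that by (auto intro!: derivative_eq_intros smooth_has_derivative)
  then have pd: "partial_deriv i (\<lambda>x. a * f x + b * g x)
      = (\<lambda>x. a * partial_deriv i f x + b * partial_deriv i g x)"
    if "smooth f" "smooth g" for f g :: "'a \<Rightarrow> real" and i
    using that by (auto simp: frechet_derivative_at[OF *[OF that], symmetric])
  show "partial_deriv i (\<lambda>x. a * f x + b * g x)
      = (\<lambda>x. a * partial_deriv i f x + b * partial_deriv i g x)"
    using assms by (rule pd)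
  let ?S = "{\<lambda>x. a * f x + b * g x |f g :: 'a \<Rightarrow> real. smooth f \<and> smooth g}"
  show "smooth (\<lambda>x. a * f x + b * g x)"
  proof (rule smooth_coinduct[of _ ?S])
    show "(\<lambda>x. a * f x + b * g x) \<in> ?S"
      by (rule CollectI, rule exI[of _ f], rule exI[of _ g]) (simp add: assms)
  next
    fix h x assume "h \<in> ?S"
    then show "h differentiable at x"
      by (elim CollectE exE conjE) (auto intro!: differentiableI *)
  next
    fix h and i :: 'a assume "h \<in> ?S" and i: "i \<in> Basis"
    then obtain f g where h: "h = (\<lambda>x. a * f x + b * g x)" and fg: "smooth f" "smooth g"
      by (elim CollectE exE conjE) (rule that)
    show "partial_deriv i h \<in> ?S"
      unfolding h pd[OF fg]
      by (rule CollectI, rule exI[of _ "partial_deriv i f"], rule exI[of _ "partial_deriv i g"])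
        (simp add: fg i smooth_partial_deriv)
  qed
qed

lemma smooth_scale:
  assumes "smooth f"
  shows "smooth (\<lambda>x. a * f x)"
    and "partial_deriv i (\<lambda>x. a * f x) = (\<lambda>x. a * partial_deriv i f x)"
  using smooth_lincomb[OF assms assms, of a 0] by simp_all

lemma smooth_reflect:
  fixes f :: "'a::euclidean_space \<Rightarrow> real"
  assumes "smooth f"
  shows "smooth (\<lambda>y. f (a - y))"
    and "partial_deriv i (\<lambda>y. f (a - y)) = (\<lambda>y. - partial_deriv i f (a - y))"
proof -
  have *: "((\<lambda>y. c * f (a - y)) has_derivative
      (\<lambda>v. c * frechet_derivative f (at (a - y)) (- v))) (at y)"
    if "smooth f" for f :: "'a \<Rightarrow> real" and y c
  proof -
    have "((\<lambda>y. f (a - y)) has_derivative (\<lambda>v. frechet_derivative f (at (a - y)) (- v))) (at y)"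
      by (rule has_derivative_compose[where f="\<lambda>y. a - y", OF _ smooth_has_derivative[OF that]])
        (auto intro!: derivative_eq_intros)
    then show ?thesis by (rule has_derivative_mult_right)
  qed
  have pd: "partial_deriv i (\<lambda>y. c * f (a - y)) = (\<lambda>y. (- c) * partial_deriv i f (a - y))"
    if "smooth f" for f :: "'a \<Rightarrow> real" and i :: 'a and c :: real
    using linear_neg[OF linear_frechet_derivative[OF smooth_differentiable[OF that]]]
    by (auto simp: frechet_derivative_at[OF *[OF that], symmetric])
  show "partial_deriv i (\<lambda>y. f (a - y)) = (\<lambda>y. - partial_deriv i f (a - y))"
    using pd[OF assms, where i = i and c = 1] by simp
  \<comment> \<open>Each derivative of a reflected function brings a factor -1; the free constant
    \<open>c\<close> absorbs it and so makes the set closed under partial derivatives.\<close>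
  let ?S = "{\<lambda>y. c * f (a - y) |c f. smooth f}"
  show "smooth (\<lambda>y. f (a - y))"
  proof (rule smooth_coinduct[of _ ?S])
    have "(\<lambda>y. f (a - y)) = (\<lambda>y. 1 * f (a - y)) \<and> smooth f" using assms by simp
    then show "(\<lambda>y. f (a - y)) \<in> ?S" by (intro CollectI exI[of _ 1] exI[of _ f])
  next
    fix h x assume "h \<in> ?S"
    then obtain c f where h: "h = (\<lambda>y. c * f (a - y))" and f: "smooth f"
      by (elim CollectE exE conjE) (rule that)
    show "h differentiable at x"
      unfolding h using *[OF f] by (rule differentiableI)
  next
    fix h and i :: 'a assume "h \<in> ?S" and i: "i \<in> Basis"
    then obtain c f where h: "h = (\<lambda>y. c * f (a - y))" and f: "smooth f"
      by (elim CollectE exE conjE) (rule that)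
    show "partial_deriv i h \<in> ?S"
      unfolding h pd[OF f]
      by (rule CollectI, rule exI[of _ "- c"], rule exI[of _ "partial_deriv i f"])
        (simp add: f i smooth_partial_deriv)
  qed
qed

text \<open>The classical flat function exp (-1/t), extended by 0 and multiplied by a power of 1/t.
  The power is carried along because differentiation produces such powers: the family is closed
  under derivatives up to linear combinations.\<close>

definition exp_recip :: "nat \<Rightarrow> real \<Rightarrow> real" where
  "exp_recip k t = (if t > 0 then exp (- inverse t) * inverse t ^ k else 0)"

text \<open>With s = 1/t, decay at 0 from the right becomes the fact that exp s outgrows every power
  of s.\<close>

lemma exp_recip_tendsto_0: "(exp_recip k \<longlongrightarrow> 0) (at 0)"
proof -
  have "((\<lambda>t::real. t ^ k / exp t) \<longlongrightarrow> 0) at_top"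
    by (rule tendsto_power_div_exp_0)
  then have "((\<lambda>t::real. inverse t ^ k / exp (inverse t)) \<longlongrightarrow> 0) (at_right 0)"
    by (rule filterlim_compose[OF _ filterlim_inverse_at_top_right])
  moreover have "\<forall>\<^sub>F t in at_right 0. inverse t ^ k / exp (inverse t) = exp_recip k t"
    unfolding eventually_at_right_field
    by (rule exI[of _ 1]) (auto simp: exp_recip_def exp_minus field_simps)
  ultimately have r: "(exp_recip k \<longlongrightarrow> 0) (at_right 0)"
    by (rule Lim_transform_eventually)
  have "\<forall>\<^sub>F t in at_left 0. exp_recip k t = 0"
    unfolding eventually_at_left_field by (rule exI[of _ "-1"]) (auto simp: exp_recip_def)
  then have "(exp_recip k \<longlongrightarrow> 0) (at_left 0)"
    by (rule tendsto_eventually)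
  with r show ?thesis by (simp add: filterlim_split_at)
qed

lemma exp_recip_has_derivative:
  "(exp_recip k has_real_derivative exp_recip (k + 2) t - real k * exp_recip (k + 1) t) (at t)"
proof -
  consider "t > 0" | "t < 0" | "t = 0" by linarith
  then show ?thesis
  proof cases
    case 1
    have "((\<lambda>t. exp (- inverse t) * inverse t ^ k) has_real_derivative
        exp_recip (k + 2) t - real k * exp_recip (k + 1) t) (at t)"
    proof -
      let ?a = "inverse t"
      have inv: "(inverse has_real_derivative - (?a * ?a)) (at t)"
        using DERIV_inverse[of t UNIV] 1 by (simp add: power2_eq_square)
      have "((\<lambda>t. exp (- inverse t)) has_real_derivative exp (- ?a) * (?a * ?a)) (at t)"
        using DERIV_chain2[OF DERIV_exp DERIV_minus[OF inv]] by simp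
      moreover have "((\<lambda>t. inverse t ^ k) has_real_derivative real k * ?a ^ (k - 1) * - (?a * ?a)) (at t)"
        using DERIV_power[OF inv, of k] by (simp add: mult_ac)
      ultimately have "((\<lambda>t. exp (- inverse t) * inverse t ^ k) has_real_derivative
          exp (- ?a) * (?a * ?a) * ?a ^ k + real k * ?a ^ (k - 1) * - (?a * ?a) * exp (- ?a)) (at t)"
        by (rule DERIV_mult)
      moreover have "exp (- ?a) * (?a * ?a) * ?a ^ k + real k * ?a ^ (k - 1) * - (?a * ?a) * exp (- ?a)
          = exp_recip (k + 2) t - real k * exp_recip (k + 1) t"
        using 1 by (cases k) (simp_all add: exp_recip_def algebra_simps)
      ultimately show ?thesis by simp
    qed
    moreover have "\<forall>\<^sub>F s in nhds t. exp (- inverse s) * inverse s ^ k = exp_recip k s"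
      using eventually_nhds_in_open[of "{0<..}" t] 1
      by (auto elim!: eventually_mono simp: exp_recip_def)
    ultimately show ?thesis by (rule DERIV_cong_ev[OF refl _ refl, THEN iffD1, rotated])
  next
    case 2
    have "((\<lambda>t. 0) has_real_derivative exp_recip (k + 2) t - real k * exp_recip (k + 1) t) (at t)"
      using 2 by (simp add: exp_recip_def)
    moreover have "\<forall>\<^sub>F s in nhds t. 0 = exp_recip k s"
      using eventually_nhds_in_open[of "{..<0}" t] 2
      by (auto elim!: eventually_mono simp: exp_recip_def)
    ultimately show ?thesis by (rule DERIV_cong_ev[OF refl _ refl, THEN iffD1, rotated])
  next
    case 3
    \<comment> \<open>At 0 the difference quotient is exactly the next function of the family, so
      differentiability there is the limit already proved.\<close>
    have q: "(\<lambda>h. (exp_recip k (t + h) - exp_recip k t) / h) = exp_recip (k + 1)"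
      using 3 by (auto simp: exp_recip_def fun_eq_iff field_simps)
    have d: "exp_recip (k + 2) t - real k * exp_recip (k + 1) t = 0"
      using 3 by (simp add: exp_recip_def)
    show ?thesis unfolding DERIV_def d q by (rule exp_recip_tendsto_0)
  qed
qed

text \<open>The algebra generated by the functions \<open>exp_recip k (r\<^sup>2 - \<bar>x\<bar>\<^sup>2)\<close> and the coordinates is
  closed under partial derivatives.\<close>

inductive_set bump_algebra :: "real \<Rightarrow> ('a::euclidean_space \<Rightarrow> real) set" for r :: real where
  const: "(\<lambda>x. c) \<in> bump_algebra r"
| coord: "(\<lambda>x. x \<bullet> i) \<in> bump_algebra r"
| bump: "(\<lambda>x. exp_recip k (r\<^sup>2 - x \<bullet> x)) \<in> bump_algebra r"
| add: "f \<in> bump_algebra r \<Longrightarrow> g \<in> bump_algebra r \<Longrightarrow> (\<lambda>x. f x + g x) \<in> bump_algebra r"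
| mult: "f \<in> bump_algebra r \<Longrightarrow> g \<in> bump_algebra r \<Longrightarrow> (\<lambda>x. f x * g x) \<in> bump_algebra r"

lemma bump_algebra_derivative:
  assumes "f \<in> bump_algebra r"
  shows "\<exists>f'. (\<forall>x. (f has_derivative f' x) (at x)) \<and> (\<forall>i. (\<lambda>x. f' x i) \<in> bump_algebra r)"
  using assms
proof induction
  case (const c)
  show ?case
    by (rule exI[of _ "\<lambda>x v. 0"]) (auto intro: bump_algebra.const)
next
  case (coord i)
  show ?case
    by (rule exI[of _ "\<lambda>x v. v \<bullet> i"])
      (auto intro!: bump_algebra.const derivative_eq_intros)
next
  case (bump k)
  let ?f' = "\<lambda>x v. (exp_recip (k + 2) (r\<^sup>2 - x \<bullet> x) + (- real k) * exp_recip (k + 1) (r\<^sup>2 - x \<bullet> x)) * ((- 2) * (x \<bullet> v))"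
  have "((\<lambda>x. exp_recip k (r\<^sup>2 - x \<bullet> x)) has_derivative ?f' x) (at x)" for x :: 'a
  proof -
    have "((\<lambda>x. r\<^sup>2 - x \<bullet> x) has_derivative (\<lambda>v. (- 2) * (x \<bullet> v))) (at x)"
      by (auto intro!: derivative_eq_intros simp: inner_commute)
    from has_derivative_compose[OF this exp_recip_has_derivative[unfolded has_field_derivative_def]]
    show ?thesis by (simp add: o_def)
  qed
  moreover have "(\<lambda>x. ?f' x i) \<in> bump_algebra r" for i :: 'a
    by (intro bump_algebra.intros)
  ultimately show ?case by (intro exI[of _ ?f']) simp
next
  case (add f g)
  then obtain f' g' where *: "\<And>x. (f has_derivative f' x) (at x)" "\<And>x. (g has_derivative g' x) (at x)"
    "\<And>i. (\<lambda>x. f' x i) \<in> bump_algebra r" "\<And>i. (\<lambda>x. g' x i) \<in> bump_algebra r"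
    by blast
  show ?case
    by (rule exI[of _ "\<lambda>x v. f' x v + g' x v"], intro conjI allI)
      (rule has_derivative_add[OF *(1,2)] bump_algebra.add[OF *(3,4)])+
next
  case (mult f g)
  then obtain f' g' where *: "\<And>x. (f has_derivative f' x) (at x)" "\<And>x. (g has_derivative g' x) (at x)"
    "\<And>i. (\<lambda>x. f' x i) \<in> bump_algebra r" "\<And>i. (\<lambda>x. g' x i) \<in> bump_algebra r"
    by blast
  show ?case
    by (rule exI[of _ "\<lambda>x v. f x * g' x v + f' x v * g x"], intro conjI allI)
      (rule has_derivative_mult[OF *(1,2)]
        bump_algebra.add[OF bump_algebra.mult[OF mult.hyps(1) *(4)]
          bump_algebra.mult[OF *(3) mult.hyps(2)]])+
qed

lemma smooth_bump: "smooth (\<lambda>x::'a::euclidean_space. exp_recip 0 (r\<^sup>2 - x \<bullet> x))"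
proof (rule smooth_coinduct[OF bump_algebra.bump[of 0 r]])
  show "g differentiable at x" if "g \<in> bump_algebra r" for g :: "'a \<Rightarrow> real" and x
    using bump_algebra_derivative[OF that] unfolding differentiable_def by blast
  show "partial_deriv i g \<in> bump_algebra r" if "g \<in> bump_algebra r" for g :: "'a \<Rightarrow> real" and i
  proof -
    obtain g' where g': "\<And>x. (g has_derivative g' x) (at x)" "\<And>i. (\<lambda>x. g' x i) \<in> bump_algebra r"
      using bump_algebra_derivative[OF \<open>g \<in> bump_algebra r\<close>] by blast
    have "partial_deriv i g = (\<lambda>x. g' x i)"
      by (simp add: frechet_derivative_at[OF g'(1), symmetric])
    with g'(2) show ?thesis by simp
  qed
qed

section \<open>Test functions and functions of compact support\<close>

lemma test_functions_iff:
  "\<phi> \<in> test_functions \<Omega> \<longleftrightarrow> smooth \<phi> \<and> (\<exists>K. compact K \<and> K \<subseteq> \<Omega> \<and> (\<forall>x. x \<notin> K \<longrightarrow> \<phi> x = 0))"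
proof
  assume "\<phi> \<in> test_functions \<Omega>"
  then show "smooth \<phi> \<and> (\<exists>K. compact K \<and> K \<subseteq> \<Omega> \<and> (\<forall>x. x \<notin> K \<longrightarrow> \<phi> x = 0))"
    unfolding test_functions_def smooth_def
    using closure_subset[of "{x. \<phi> x \<noteq> 0}"] by (intro conjI exI[of _ "closure {x. \<phi> x \<noteq> 0}"]) auto
next
  assume *: "smooth \<phi> \<and> (\<exists>K. compact K \<and> K \<subseteq> \<Omega> \<and> (\<forall>x. x \<notin> K \<longrightarrow> \<phi> x = 0))"
  then obtain K where K: "compact K" "K \<subseteq> \<Omega>" "\<forall>x. x \<notin> K \<longrightarrow> \<phi> x = 0" by blast
  then have "closure {x. \<phi> x \<noteq> 0} \<subseteq> K"
    by (intro closure_minimal compact_imp_closed) auto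
  then show "\<phi> \<in> test_functions \<Omega>"
    using * K compact_Int_closed[OF K(1) closed_closure, of "{x. \<phi> x \<noteq> 0}"]
    unfolding test_functions_def smooth_def by (simp add: Int_absorb1)
qed

lemma test_functions_mono: "\<Omega> \<subseteq> \<Omega>' \<Longrightarrow> test_functions \<Omega> \<subseteq> test_functions \<Omega>'"
  unfolding test_functions_def by blast

lemma partial_deriv_eq_0:
  assumes "compact K" "\<And>x. x \<notin> K \<Longrightarrow> \<phi> x = 0" "x \<notin> K"
  shows "partial_deriv i \<phi> x = 0"
proof -
  have "(\<phi> has_derivative (\<lambda>v. 0)) (at x)"
  proof (rule has_derivative_transform_within_open[of "\<lambda>x. 0" _ _ _ "- K"])
    show "open (- K)" using assms(1) by (simp add: compact_imp_closed open_Compl)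
  qed (use assms in auto)
  then show ?thesis by (metis frechet_derivative_at)
qed

lemma test_functions_partial_deriv:
  assumes "\<phi> \<in> test_functions \<Omega>" "i \<in> Basis"
  shows "partial_deriv i \<phi> \<in> test_functions \<Omega>"
proof -
  obtain K where K: "smooth \<phi>" "compact K" "K \<subseteq> \<Omega>" "\<And>x. x \<notin> K \<Longrightarrow> \<phi> x = 0"
    using assms(1) unfolding test_functions_iff by blast
  then have "partial_deriv i \<phi> x = 0" if "x \<notin> K" for x
    using partial_deriv_eq_0 that by blast
  with K assms(2) smooth_partial_deriv show ?thesis
    unfolding test_functions_iff by blast
qed

lemma test_functions_lincomb:
  assumes "\<phi> \<in> test_functions \<Omega>" "\<psi> \<in> test_functions \<Omega>"
  shows "(\<lambda>x. a * \<phi> x + b * \<psi> x) \<in> test_functions \<Omega>"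
proof -
  obtain K L where "compact K" "K \<subseteq> \<Omega>" "\<forall>x. x \<notin> K \<longrightarrow> \<phi> x = 0"
    "compact L" "L \<subseteq> \<Omega>" "\<forall>x. x \<notin> L \<longrightarrow> \<psi> x = 0"
    using assms unfolding test_functions_iff by blast
  then have "compact (K \<union> L)" "K \<union> L \<subseteq> \<Omega>" "\<forall>x. x \<notin> K \<union> L \<longrightarrow> a * \<phi> x + b * \<psi> x = 0"
    by auto
  then show ?thesis
    using assms smooth_lincomb(1) unfolding test_functions_iff by blast
qed

lemma integrable_continuous_compact_support:
  fixes f :: "'a::euclidean_space \<Rightarrow> real"
  assumes "continuous_on UNIV f" "compact K" "\<And>x. x \<notin> K \<Longrightarrow> f x = 0"
  shows "integrable lborel f"
proof -
  have "f = (\<lambda>x. indicator K x *\<^sub>R f x)"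
    using assms(3) by (auto simp: fun_eq_iff indicator_def)
  then show ?thesis
    using borel_integrable_compact[OF assms(2) continuous_on_subset[OF assms(1) subset_UNIV]]
    by (simp add: indicator_def if_distrib cong: if_cong)
qed

lemma bounded_continuous_compact_support:
  fixes f :: "'a::euclidean_space \<Rightarrow> real"
  assumes "continuous_on UNIV f" "compact K" "\<And>x. x \<notin> K \<Longrightarrow> f x = 0"
  obtains B where "B > 0" "\<And>x. \<bar>f x\<bar> \<le> B"
proof -
  have "bounded (f ` K)"
    by (intro compact_imp_bounded compact_continuous_image continuous_on_subset[OF assms(1)] assms) auto
  then obtain B where "B > 0" "\<And>x. x \<in> K \<Longrightarrow> \<bar>f x\<bar> \<le> B"
    unfolding bounded_pos by auto
  with assms(3) that[of B] show ?thesis by (metis abs_zero less_eq_real_def)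
qed

lemma uniformly_continuous_compact_support:
  fixes f :: "'a::euclidean_space \<Rightarrow> 'b::real_normed_vector"
  assumes "continuous_on UNIV f" "compact K" "\<And>x. x \<notin> K \<Longrightarrow> f x = 0"
  shows "uniformly_continuous_on UNIV f"
proof -
  obtain R where R: "K \<subseteq> cball 0 R"
    using bounded_subset_ballD[OF compact_imp_bounded[OF assms(2)], of 0] ball_subset_cball by blast
  \<comment> \<open>With one unit of room, two points closer than 1 either both lie in the larger
    ball, which is compact, or both lie outside the smaller one, where \<open>f\<close> is
    0.\<close>
  have uc: "uniformly_continuous_on (cball 0 (R + 1)) f"
    by (intro compact_uniformly_continuous continuous_on_subset[OF assms(1)]) auto
  show ?thesis
    unfolding uniformly_continuous_on_def
  proof (intro allI impI)
    fix e :: real assume "e > 0"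
    with uc obtain d where d: "d > 0"
      "\<And>x y. x \<in> cball 0 (R + 1) \<Longrightarrow> y \<in> cball 0 (R + 1) \<Longrightarrow> dist y x < d \<Longrightarrow> dist (f y) (f x) < e"
      unfolding uniformly_continuous_on_def by metis
    have "dist (f y) (f x) < e" if "dist y x < min d 1" for x y
    proof (cases "x \<in> cball 0 (R + 1) \<and> y \<in> cball 0 (R + 1)")
      case True
      with d(2) that show ?thesis by auto
    next
      case False
      have "norm x \<le> norm y + dist y x" "norm y \<le> norm x + dist y x"
        using norm_triangle_ineq2[of x y] norm_triangle_ineq2[of y x] by (auto simp: dist_norm norm_minus_commute)
      with False that have "x \<notin> cball 0 R" "y \<notin> cball 0 R" by auto
      with R assms(3) \<open>e > 0\<close> show ?thesis by (metis dist_self subsetD)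
    qed
    with d(1) show "\<exists>d>0. \<forall>x\<in>UNIV. \<forall>x'\<in>UNIV. dist x' x < d \<longrightarrow> dist (f x') (f x) < e"
      by (intro exI[of _ "min d 1"]) auto
  qed
qed

lemma test_functions_integrable: "\<phi> \<in> test_functions \<Omega> \<Longrightarrow> integrable lborel \<phi>"
  unfolding test_functions_iff
  using integrable_continuous_compact_support smooth_continuous_on by blast

lemma test_functions_bounded:
  assumes "\<phi> \<in> test_functions \<Omega>" obtains B where "B > 0" "\<And>x. \<bar>\<phi> x\<bar> \<le> B"
  using assms bounded_continuous_compact_support smooth_continuous_on
  unfolding test_functions_iff by metis

section \<open>Mollifiers: normalised bumps supported in balls of radius 1 / (n + 1)\<close>

definition mollifier :: "nat \<Rightarrow> 'a::euclidean_space \<Rightarrow> real" where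
  "mollifier n x = exp_recip 0 ((inverse (real (Suc n)))\<^sup>2 - x \<bullet> x)
     / (LINT y::'a|lborel. exp_recip 0 ((inverse (real (Suc n)))\<^sup>2 - y \<bullet> y))"

text \<open>A zero integral would make the nonnegative bump vanish almost everywhere, yet it is
  positive on an open ball, which is not negligible. This justifies the division in
  \<open>mollifier\<close>.\<close>

lemma bump_integral_pos:
  assumes "r > 0"
  shows "(LINT y::'a::euclidean_space|lborel. exp_recip 0 (r\<^sup>2 - y \<bullet> y)) > 0" (is "?I > 0")
proof -
  let ?f = "\<lambda>y::'a. exp_recip 0 (r\<^sup>2 - y \<bullet> y)"
  have sm: "smooth ?f" by (rule smooth_bump)
  have zero: "?f x = 0" if "x \<notin> cball 0 r" for x
    using that assms by (auto simp: exp_recip_def dot_square_norm abs_le_square_iff[symmetric] not_less)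
  have int: "integrable lborel ?f"
    by (rule integrable_continuous_compact_support[OF smooth_continuous_on[OF sm] compact_cball zero])
  have "?I \<ge> 0" by (intro integral_nonneg_AE) (auto simp: exp_recip_def)
  moreover have "?I \<noteq> 0"
  proof
    assume "?I = 0"
    then have "AE x in lborel. ?f x = 0"
      using integral_nonneg_eq_0_iff_AE[OF int] by (auto simp: exp_recip_def)
    moreover have "?f x \<noteq> 0" if "x \<in> ball 0 r" for x
      using that assms by (auto simp: exp_recip_def dot_square_norm power_strict_mono)
    ultimately have "AE x in lborel. x \<notin> ball (0::'a) r"
      by (auto elim!: eventually_mono)
    then have "negligible (ball (0::'a) r)"
      using AE_iff_null_sets[of "ball (0::'a) r" lborel]
      by (simp add: negligible_iff_null_sets null_sets_completionI del: mem_ball mem_ball_0)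
    with assms show False
      by (metis centre_in_ball empty_iff open_ball open_not_negligible)
  qed
  ultimately show ?thesis by simp
qed

lemma
  shows smooth_mollifier: "smooth (mollifier n :: 'a::euclidean_space \<Rightarrow> real)"
    and mollifier_eq_0: "\<And>x::'a. norm x \<ge> inverse (real (Suc n)) \<Longrightarrow> mollifier n x = 0"
    and mollifier_nonneg: "\<And>x::'a. mollifier n x \<ge> 0"
    and mollifier_minus: "\<And>x::'a. mollifier n (- x) = mollifier n x"
    and mollifier_test: "(mollifier n :: 'a \<Rightarrow> real) \<in> test_functions UNIV"
    and mollifier_integral: "(LINT x|lborel. mollifier n (x::'a)) = 1"
proof -
  let ?r = "inverse (real (Suc n))"
  let ?f = "\<lambda>y::'a. exp_recip 0 (?r\<^sup>2 - y \<bullet> y)"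
  note pos = bump_integral_pos[where r="?r", where 'a='a, simplified]
  have eq: "(mollifier n :: 'a \<Rightarrow> real) = (\<lambda>x. inverse (LINT y|lborel. ?f y) * ?f x)"
    by (auto simp: mollifier_def fun_eq_iff field_simps)
  show sm: "smooth (mollifier n :: 'a \<Rightarrow> real)"
    unfolding eq by (intro smooth_scale smooth_bump)
  show z: "mollifier n x = 0" if "norm x \<ge> ?r" for x :: 'a
  proof -
    have "?r\<^sup>2 \<le> (norm x)\<^sup>2" using that by (intro power_mono) auto
    then have "\<not> 0 < ?r\<^sup>2 - x \<bullet> x" unfolding dot_square_norm by linarith
    then have "exp_recip 0 (?r\<^sup>2 - x \<bullet> x) = 0" unfolding exp_recip_def by (rule if_not_P)
    then show ?thesis by (simp add: mollifier_def)
  qed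
  show "mollifier n x \<ge> 0" for x :: 'a
    using pos by (auto simp: mollifier_def exp_recip_def less_imp_le)
  show "mollifier n (- x) = mollifier n x" for x :: 'a
    by (simp add: mollifier_def)
  show "(mollifier n :: 'a \<Rightarrow> real) \<in> test_functions UNIV"
    unfolding test_functions_iff using sm z
    by (auto intro!: exI[of _ "cball 0 ?r"])
  show "(LINT x|lborel. mollifier n (x::'a)) = 1"
    unfolding eq using pos by simp
qed

section \<open>Convolution\<close>

lemma lborel_translate:
  fixes F :: "'a::euclidean_space \<Rightarrow> real"
  assumes [measurable]: "F \<in> borel_measurable borel"
  shows integral_lborel_translate: "(LINT y|lborel. F (y + c)) = (LINT y|lborel. F y)"
    and integrable_lborel_translate: "integrable lborel (\<lambda>y. F (y + c)) \<longleftrightarrow> integrable lborel F"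
proof -
  have "(LINT y|lborel. F y) = (LINT y|distr lborel borel ((+) c). F y)"
    by (simp add: lborel_distr_plus)
  also have "\<dots> = (LINT y|lborel. F (y + c))"
    by (subst integral_distr) (auto simp: add.commute)
  finally show "(LINT y|lborel. F (y + c)) = (LINT y|lborel. F y)" ..
  have "integrable lborel F \<longleftrightarrow> integrable (distr lborel borel ((+) c)) F"
    by (simp add: lborel_distr_plus)
  also have "\<dots> \<longleftrightarrow> integrable lborel (\<lambda>y. F (y + c))"
    by (subst integrable_distr_eq) (auto simp: add.commute)
  finally show "integrable lborel (\<lambda>y. F (y + c)) \<longleftrightarrow> integrable lborel F" ..
qed

lemma mollifier_integral_translate:
  fixes x :: "'a::euclidean_space"
  shows "(LINT y|lborel. mollifier n (x - y)) = 1" "integrable lborel (\<lambda>y. mollifier n (x - y))"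
    "(LINT y|lborel. mollifier n (y - x)) = 1" "integrable lborel (\<lambda>y. mollifier n (y - x))"
proof -
  have *: "mollifier n (x - y) = mollifier n (y + (- x))" "mollifier n (y - x) = mollifier n (y + (- x))" for y :: 'a
    using mollifier_minus[of n "y - x"] by simp_all
  have m: "(mollifier n :: 'a \<Rightarrow> real) \<in> borel_measurable borel"
    by (intro smooth_borel_measurable smooth_mollifier)
  show "(LINT y|lborel. mollifier n (x - y)) = 1" "(LINT y|lborel. mollifier n (y - x)) = 1"
    unfolding * integral_lborel_translate[OF m] by (rule mollifier_integral)+
  show "integrable lborel (\<lambda>y. mollifier n (x - y))" "integrable lborel (\<lambda>y. mollifier n (y - x))"
    unfolding * integrable_lborel_translate[OF m]
    by (rule test_functions_integrable[OF mollifier_test])+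
qed

lemma integrable_mult_bounded:
  fixes f g :: "'a \<Rightarrow> real"
  assumes "integrable M f" "g \<in> borel_measurable M" "\<And>x. \<bar>g x\<bar> \<le> B"
  shows "integrable M (\<lambda>x. f x * g x)"
proof (rule Bochner_Integration.integrable_bound)
  show "integrable M (\<lambda>x. B * f x)" using assms(1) by simp
  show "(\<lambda>x. f x * g x) \<in> borel_measurable M"
    using assms(1,2) by measurable
  have "\<bar>f x\<bar> * \<bar>g x\<bar> \<le> \<bar>f x\<bar> * \<bar>B\<bar>" for x
    using assms(3)[of x] by (intro mult_left_mono) auto
  then show "AE x in M. norm (f x * g x) \<le> norm (B * f x)"
    by (simp add: abs_mult mult.commute)
qed

lemma norm_lebesgue_integral_le:
  fixes f g :: "'a \<Rightarrow> real"
  assumes "integrable M f" "integrable M g" "\<And>x. norm (f x) \<le> g x"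
  shows "norm (LINT x|M. f x) \<le> (LINT x|M. g x)"
proof -
  have "(LINT x|M. norm (f x)) \<le> (LINT x|M. g x)"
    using assms by (intro integral_mono) auto
  then show ?thesis using integral_norm_bound[of M f] by linarith
qed

definition conv :: "('a::euclidean_space \<Rightarrow> real) \<Rightarrow> ('a \<Rightarrow> real) \<Rightarrow> 'a \<Rightarrow> real" where
  "conv f \<eta> x = (LINT y|lborel. f y * \<eta> (x - y))"

lemma conv_integrable:
  fixes f :: "'a::euclidean_space \<Rightarrow> real"
  assumes "integrable lborel f" "\<eta> \<in> test_functions UNIV"
  shows "integrable lborel (\<lambda>y. f y * \<eta> (x - y))"
proof -
  obtain B where "\<And>x. \<bar>\<eta> x\<bar> \<le> B" using test_functions_bounded[OF assms(2)] by blast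
  moreover have "\<eta> \<in> borel_measurable borel"
    using assms(2) by (auto simp: test_functions_iff smooth_borel_measurable)
  then have "(\<lambda>y. \<eta> (x - y)) \<in> borel_measurable lborel" by measurable
  ultimately show ?thesis by (intro integrable_mult_bounded[OF assms(1)])
qed

text \<open>The gradient \<open>G\<close> is continuous with compact support, hence uniformly
  continuous, and the mean value theorem along a segment makes the remainder small uniformly in
  \<open>z\<close>. The uniformity is what allows the remainder to be integrated against an
  arbitrary integrable function.\<close>

lemma test_functions_uniformly_differentiable:
  assumes "\<eta> \<in> test_functions UNIV" "e > 0"
  shows "\<exists>d>0. \<forall>z v. norm v < d \<longrightarrow>
    \<bar>\<eta> (z + v) - \<eta> z - (\<Sum>i\<in>Basis. (v \<bullet> i) * partial_deriv i \<eta> z)\<bar> \<le> e * norm v"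
proof -
  obtain K where sm: "smooth \<eta>" and K: "compact K" "\<And>x. x \<notin> K \<Longrightarrow> \<eta> x = 0"
    using assms(1) unfolding test_functions_iff by blast
  define G where "G z = (\<Sum>i\<in>Basis. partial_deriv i \<eta> z *\<^sub>R i)" for z
  have D: "frechet_derivative \<eta> (at z) v = G z \<bullet> v" for z v
    by (subst frechet_derivative_sum_Basis[OF smooth_differentiable[OF sm]])
      (simp add: G_def inner_sum_right inner_commute[of _ v] mult.commute)
  have "continuous_on UNIV G"
    unfolding G_def by (intro continuous_intros smooth_continuous_on smooth_partial_deriv sm)
  moreover have "G x = 0" if "x \<notin> K" for x
    unfolding G_def using partial_deriv_eq_0[OF K that] by simp
  ultimately have "uniformly_continuous_on UNIV G"
    using K(1) by (intro uniformly_continuous_compact_support) auto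
  then obtain d where d: "d > 0" "\<And>x y. dist y x < d \<Longrightarrow> dist (G y) (G x) < e"
    using \<open>e > 0\<close> unfolding uniformly_continuous_on_def by (metis UNIV_I)
  have "\<bar>\<eta> (z + v) - \<eta> z - G z \<bullet> v\<bar> \<le> e * norm v" if "norm v < d" for z v
  proof -
    have "((\<lambda>t. \<eta> (z + t *\<^sub>R v)) has_real_derivative G (z + t *\<^sub>R v) \<bullet> v) (at t)" for t
    proof -
      have "((\<lambda>t. z + t *\<^sub>R v) has_derivative (\<lambda>s. s *\<^sub>R v)) (at t)"
        by (auto intro!: derivative_eq_intros)
      from has_derivative_compose[OF this smooth_has_derivative[OF sm]]
      show ?thesis
        by (simp add: D has_field_derivative_def mult_commute_abs)
    qed
    then obtain \<xi> where \<xi>: "0 < \<xi>" "\<xi> < 1" "\<eta> (z + v) - \<eta> z = G (z + \<xi> *\<^sub>R v) \<bullet> v"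
      using MVT2[of 0 1 "\<lambda>t. \<eta> (z + t *\<^sub>R v)" "\<lambda>t. G (z + t *\<^sub>R v) \<bullet> v"] by auto
    have "dist (z + \<xi> *\<^sub>R v) z < d"
      using \<xi>(1,2) that mult_left_le_one_le[of "norm v" \<xi>] by (simp add: dist_norm)
    then have "norm (G (z + \<xi> *\<^sub>R v) - G z) \<le> e"
      using d(2) by (metis dist_norm less_imp_le)
    moreover have "\<eta> (z + v) - \<eta> z - G z \<bullet> v = (G (z + \<xi> *\<^sub>R v) - G z) \<bullet> v"
      using \<xi>(3) by (simp add: inner_diff_left)
    ultimately show ?thesis
      using Cauchy_Schwarz_ineq2[of "G (z + \<xi> *\<^sub>R v) - G z" v] mult_right_mono[of _ e "norm v"]
      by (metis norm_ge_zero order_trans)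
  qed
  moreover have "(\<Sum>i\<in>Basis. (v \<bullet> i) * partial_deriv i \<eta> z) = G z \<bullet> v" for z v
    using D[of z v] frechet_derivative_sum_Basis[OF smooth_differentiable[OF sm], of z v] by metis
  ultimately show ?thesis using d(1) by auto
qed

text \<open>As \<open>f\<close> has no regularity, all derivatives fall on the kernel: the remainder
  of the convolution is the integral of \<open>f\<close> against the remainder of
  \<open>\<eta>\<close>, which is uniformly small.\<close>

lemma conv_has_derivative:
  fixes f :: "'a::euclidean_space \<Rightarrow> real"
  assumes f: "integrable lborel f" and \<eta>: "\<eta> \<in> test_functions UNIV"
  shows "(conv f \<eta> has_derivative (\<lambda>v. \<Sum>i\<in>Basis. (v \<bullet> i) * conv f (partial_deriv i \<eta>) x)) (at x)"
  unfolding has_derivative_at_alt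
proof (intro conjI allI impI)
  show "bounded_linear (\<lambda>v. \<Sum>i\<in>Basis. (v \<bullet> i) * conv f (partial_deriv i \<eta>) x)"
    by (intro bounded_linear_sum bounded_linear_mult_const bounded_linear_inner_left)
  fix e :: real assume "e > 0"
  define B where "B = (LINT y|lborel. \<bar>f y\<bar>)"
  have "B \<ge> 0" unfolding B_def by simp
  \<comment> \<open>The final bound is B * e / (B + 1), which is at most e; \<open>B + 1\<close>
    instead of \<open>B\<close> also covers an \<open>f\<close> that vanishes almost
    everywhere.\<close>
  then have "e / (B + 1) > 0" using \<open>e > 0\<close> by simp
  from test_functions_uniformly_differentiable[OF \<eta> this] obtain d where d: "d > 0"
    "\<And>z v. norm v < d \<Longrightarrow> \<bar>\<eta> (z + v) - \<eta> z - (\<Sum>i\<in>Basis. (v \<bullet> i) * partial_deriv i \<eta> z)\<bar> \<le> e / (B + 1) * norm v"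
    by blast
  have "norm (conv f \<eta> x' - conv f \<eta> x - (\<Sum>i\<in>Basis. ((x' - x) \<bullet> i) * conv f (partial_deriv i \<eta>) x))
      \<le> e * norm (x' - x)" if "norm (x' - x) < d" for x'
  proof -
    let ?v = "x' - x"
    let ?R = "\<lambda>y. \<eta> (x' - y) - \<eta> (x - y) - (\<Sum>i\<in>Basis. (?v \<bullet> i) * partial_deriv i \<eta> (x - y))"
    have int: "integrable lborel (\<lambda>y. f y * \<eta> (z - y))"
      "i \<in> Basis \<Longrightarrow> integrable lborel (\<lambda>y. f y * partial_deriv i \<eta> (z - y))" for z i
      using conv_integrable[OF f] \<eta> test_functions_partial_deriv by blast+
    have sum: "(LINT y|lborel. (\<Sum>i\<in>Basis. (?v \<bullet> i) * (f y * partial_deriv i \<eta> (x - y))))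
        = (\<Sum>i\<in>Basis. (?v \<bullet> i) * conv f (partial_deriv i \<eta>) x)"
      unfolding conv_def by (subst Bochner_Integration.integral_sum) (auto simp: int)
    have eq: "f y * ?R y = f y * \<eta> (x' - y) - f y * \<eta> (x - y) - (\<Sum>i\<in>Basis. (?v \<bullet> i) * (f y * partial_deriv i \<eta> (x - y)))" for y
      by (simp add: algebra_simps sum_distrib_left)
    have intR: "integrable lborel (\<lambda>y. f y * ?R y)"
      unfolding eq by (intro Bochner_Integration.integrable_diff Bochner_Integration.integrable_sum integrable_mult_right int)
    have "conv f \<eta> x' - conv f \<eta> x - (\<Sum>i\<in>Basis. (?v \<bullet> i) * conv f (partial_deriv i \<eta>) x)
        = (LINT y|lborel. f y * ?R y)"
      unfolding eq sum[symmetric] conv_def by (simp add: int)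
    also have "norm \<dots> \<le> (LINT y|lborel. \<bar>f y\<bar> * (e / (B + 1) * norm ?v))"
    proof (rule norm_lebesgue_integral_le[OF intR])
      show "integrable lborel (\<lambda>y. \<bar>f y\<bar> * (e / (B + 1) * norm ?v))" using f by simp
      fix y
      have "\<bar>?R y\<bar> \<le> e / (B + 1) * norm ?v"
        using d(2)[OF that, of "x - y"] by simp
      then show "norm (f y * ?R y) \<le> \<bar>f y\<bar> * (e / (B + 1) * norm ?v)"
        unfolding real_norm_def abs_mult by (rule mult_left_mono) simp
    qed
    also have "\<dots> = B * (e / (B + 1) * norm ?v)"
      using f unfolding B_def by simp
    also have "\<dots> \<le> e * norm ?v"
      using \<open>B \<ge> 0\<close> \<open>e > 0\<close> by (simp add: field_simps mult_left_mono)
    finally show ?thesis .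
  qed
  with d(1) show "\<exists>d>0. \<forall>y. norm (y - x) < d \<longrightarrow> norm (conv f \<eta> y - conv f \<eta> x -
      (\<Sum>i\<in>Basis. ((y - x) \<bullet> i) * conv f (partial_deriv i \<eta>) x)) \<le> e * norm (y - x)"
    by blast
qed

lemma conv_partial_deriv:
  fixes f :: "'a::euclidean_space \<Rightarrow> real"
  assumes "integrable lborel f" "\<eta> \<in> test_functions UNIV" "i \<in> Basis"
  shows "partial_deriv i (conv f \<eta>) = conv f (partial_deriv i \<eta>)"
proof
  fix x
  have "partial_deriv i (conv f \<eta>) x = (\<Sum>j\<in>Basis. (i \<bullet> j) * conv f (partial_deriv j \<eta>) x)"
    by (simp only: frechet_derivative_at[OF conv_has_derivative[OF assms(1,2)], symmetric])
  also have "\<dots> = (\<Sum>j\<in>Basis. if j = i then conv f (partial_deriv j \<eta>) x else 0)"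
    using assms(3) by (intro sum.cong) (auto simp: inner_Basis)
  finally show "partial_deriv i (conv f \<eta>) x = conv f (partial_deriv i \<eta>) x"
    using assms(3) by simp
qed

lemma smooth_conv:
  fixes f :: "'a::euclidean_space \<Rightarrow> real"
  assumes f: "integrable lborel f" and \<eta>: "\<eta> \<in> test_functions UNIV"
  shows "smooth (conv f \<eta>)"
proof (rule smooth_coinduct[of _ "conv f ` test_functions UNIV"])
  show "g differentiable at x" if "g \<in> conv f ` test_functions UNIV" for g x
    using that by (elim imageE) (auto intro!: differentiableI conv_has_derivative[OF f])
  show "partial_deriv i g \<in> conv f ` test_functions UNIV"
    if "g \<in> conv f ` test_functions UNIV" "i \<in> Basis" for g i
  proof -
    from that(1) obtain \<eta>' where "g = conv f \<eta>'" "\<eta>' \<in> test_functions UNIV" by (rule imageE)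
    with conv_partial_deriv[OF f _ that(2)] test_functions_partial_deriv[OF _ that(2)] show ?thesis
      by simp
  qed
qed (rule imageI[OF \<eta>])

lemma conv_borel_measurable:
  "integrable lborel f \<Longrightarrow> \<eta> \<in> test_functions UNIV \<Longrightarrow> conv f \<eta> \<in> borel_measurable borel"
  by (intro smooth_borel_measurable smooth_conv)

section \<open>Convergence of mollifications in the square mean\<close>

lemma conv_eq_0:
  assumes "\<And>y. dist x y < inverse (real (Suc n)) \<Longrightarrow> f y = 0"
  shows "conv f (mollifier n) x = 0"
proof -
  have "f y * mollifier n (x - y) = 0" for y
    using assms[of y] mollifier_eq_0[of n "x - y"] unfolding dist_norm mult_eq_0_iff by linarith
  then show ?thesis unfolding conv_def by (simp only: Bochner_Integration.integral_zero)
qed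

text \<open>Jensen's inequality for the probability density \<open>mollifier n (x - y)\<close> in
  \<open>y\<close>, obtained from nonnegativity of the variance of \<open>f\<close> around its mean
  \<open>c\<close>.\<close>

lemma conv_square_le:
  fixes f :: "'a::euclidean_space \<Rightarrow> real"
  assumes f: "integrable lborel f" and f2: "integrable lborel (\<lambda>x. (f x)\<^sup>2)"
  shows "(conv f (mollifier n) x)\<^sup>2 \<le> conv (\<lambda>x. (f x)\<^sup>2) (mollifier n) x"
proof -
  let ?\<eta> = "mollifier n :: 'a \<Rightarrow> real"
  define c where "c = conv f ?\<eta> x"
  have int: "integrable lborel (\<lambda>y. f y * ?\<eta> (x - y))" "integrable lborel (\<lambda>y. (f y)\<^sup>2 * ?\<eta> (x - y))"
    by (intro conv_integrable mollifier_test f f2)+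
  have "0 \<le> (LINT y|lborel. (f y - c)\<^sup>2 * ?\<eta> (x - y))"
    by (simp add: mollifier_nonneg)
  also have "(\<lambda>y. (f y - c)\<^sup>2 * ?\<eta> (x - y))
      = (\<lambda>y. (f y)\<^sup>2 * ?\<eta> (x - y) - 2 * c * (f y * ?\<eta> (x - y)) + c\<^sup>2 * ?\<eta> (x - y))"
    by (auto simp: power2_eq_square algebra_simps)
  also have "(LINT y|lborel. \<dots> y) = conv (\<lambda>x. (f x)\<^sup>2) ?\<eta> x - 2 * c * c + c\<^sup>2"
    using int mollifier_integral_translate(1,2)[of n x] unfolding c_def conv_def by simp
  finally show ?thesis unfolding c_def by (simp add: power2_eq_square)
qed

text \<open>Jensen's inequality is integrated over \<open>x\<close>, the integrals are exchanged,
  and the kernel integrates to 1 in \<open>x\<close> for each fixed \<open>y\<close>. Working with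
  nonnegative integrals yields the integrability together with the bound.\<close>

lemma conv_L2_bound:
  fixes f :: "'a::euclidean_space \<Rightarrow> real"
  assumes f: "integrable lborel f" and f2: "integrable lborel (\<lambda>x. (f x)\<^sup>2)"
  shows "integrable lborel (\<lambda>x. (conv f (mollifier n) x)\<^sup>2)"
    and "(LINT x|lborel. (conv f (mollifier n) x)\<^sup>2) \<le> (LINT x|lborel. (f x)\<^sup>2)"
proof -
  let ?\<eta> = "mollifier n :: 'a \<Rightarrow> real"
  have [measurable]: "f \<in> borel_measurable borel" "?\<eta> \<in> borel_measurable borel"
    "conv f ?\<eta> \<in> borel_measurable borel"
    using f conv_borel_measurable[OF f mollifier_test] smooth_borel_measurable[OF smooth_mollifier]
    by (auto dest: borel_measurable_integrable)
  have nn: "(\<integral>\<^sup>+x. ennreal (?\<eta> (x - y)) \<partial>lborel) = 1" for y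
    using mollifier_integral_translate(3,4)[of n y]
    by (subst nn_integral_eq_integral) (auto simp: mollifier_nonneg)
  have "(\<integral>\<^sup>+x. ennreal ((conv f ?\<eta> x)\<^sup>2) \<partial>lborel)
      \<le> (\<integral>\<^sup>+x. (\<integral>\<^sup>+y. ennreal ((f y)\<^sup>2 * ?\<eta> (x - y)) \<partial>lborel) \<partial>lborel)"
  proof (rule nn_integral_mono)
    fix x
    have "(\<integral>\<^sup>+y. ennreal ((f y)\<^sup>2 * ?\<eta> (x - y)) \<partial>lborel) = ennreal (conv (\<lambda>x. (f x)\<^sup>2) ?\<eta> x)"
      unfolding conv_def
      by (rule nn_integral_eq_integral[OF conv_integrable[OF f2 mollifier_test]]) (simp add: mollifier_nonneg)
    then show "ennreal ((conv f ?\<eta> x)\<^sup>2) \<le> (\<integral>\<^sup>+y. ennreal ((f y)\<^sup>2 * ?\<eta> (x - y)) \<partial>lborel)"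
      using conv_square_le[OF f f2, of n x] by (simp add: ennreal_leI)
  qed
  also have "\<dots> = (\<integral>\<^sup>+y. (\<integral>\<^sup>+x. ennreal ((f y)\<^sup>2 * ?\<eta> (x - y)) \<partial>lborel) \<partial>lborel)"
    by (rule lborel_pair.Fubini'[symmetric]) measurable
  also have "\<dots> = (\<integral>\<^sup>+y. ennreal ((f y)\<^sup>2) \<partial>lborel)"
    by (simp add: ennreal_mult mollifier_nonneg nn_integral_cmult nn)
  also have "\<dots> = ennreal (LINT x|lborel. (f x)\<^sup>2)"
    by (rule nn_integral_eq_integral[OF f2]) simp
  finally have le: "(\<integral>\<^sup>+x. ennreal ((conv f ?\<eta> x)\<^sup>2) \<partial>lborel) \<le> ennreal (LINT x|lborel. (f x)\<^sup>2)" .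
  then show int: "integrable lborel (\<lambda>x. (conv f ?\<eta> x)\<^sup>2)"
    by (intro integrableI_nonneg) (auto simp: le_less_trans ennreal_less_top)
  show "(LINT x|lborel. (conv f ?\<eta> x)\<^sup>2) \<le> (LINT x|lborel. (f x)\<^sup>2)"
    using le nn_integral_eq_integral[OF int] by (simp add: ennreal_le_iff integral_nonneg_AE)
qed

lemma integrable_indicator_cball:
  "integrable lborel (indicator (cball (a::'a::euclidean_space) r) :: 'a \<Rightarrow> real)"
  using emeasure_bounded_finite[OF bounded_cball[of a r]]
  by (intro integrable_real_indicator) (auto simp: less_top)

text \<open>Two dominated limits. Truncating \<open>f\<close> in value and in space gives bounded
  functions \<open>F k\<close> supported in a ball. The continuous functions that converge to
  \<open>f\<close> almost everywhere are then truncated in the same way, so that a constant on that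
  ball dominates the differences.\<close>

lemma L2_approx_continuous:
  fixes f :: "'a::euclidean_space \<Rightarrow> real"
  assumes [measurable]: "f \<in> borel_measurable borel"
    and f2: "integrable lborel (\<lambda>x. (f x)\<^sup>2)" and "e > 0"
  obtains g R where "continuous_on UNIV g" "\<And>x. x \<notin> cball 0 R \<Longrightarrow> g x = 0"
    "(LINT x|lborel. (f x - g x)\<^sup>2) < e"
proof -
  define cl where "cl k t = max (- real k) (min (real k) t)" for k t
  define cut where "cut k x = max 0 (min 1 (real k + 1 - norm x))" for k and x :: 'a
  define F where "F k x = cl k (f x) * cut k x" for k x
  have cut: "0 \<le> cut k x" "cut k x \<le> 1" "continuous_on UNIV (cut k)" "x \<notin> cball 0 (real k + 1) \<Longrightarrow> cut k x = 0" for k x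
    unfolding cut_def by (auto intro!: continuous_intros)
  have cl: "\<bar>cl k t\<bar> \<le> \<bar>t\<bar>" "\<bar>cl k t\<bar> \<le> real k" for k t
    unfolding cl_def by auto
  have [measurable]: "cut k \<in> borel_measurable borel" "cl k \<in> borel_measurable borel" for k
    unfolding cut_def cl_def by measurable
  have [measurable]: "F k \<in> borel_measurable borel" for k
    unfolding F_def by measurable
  have "(\<lambda>k. LINT x|lborel. (f x - F k x)\<^sup>2) \<longlonglongrightarrow> (LINT x|(lborel::'a measure). 0)"
  proof (rule integral_dominated_convergence[where w="\<lambda>x. 4 * (f x)\<^sup>2"])
    show "AE x in lborel. (\<lambda>k. (f x - F k x)\<^sup>2) \<longlonglongrightarrow> 0"
    proof (rule AE_I2)
      fix x
      have "\<forall>\<^sub>F k in sequentially. (f x - F k x)\<^sup>2 = 0"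
      proof (rule eventually_sequentiallyI)
        fix k assume "k \<ge> nat \<lceil>max (norm x) \<bar>f x\<bar>\<rceil>"
        then have "real k \<ge> norm x" "real k \<ge> \<bar>f x\<bar>" by linarith+
        then have "cl k (f x) = f x" "cut k x = 1" unfolding cl_def cut_def by auto
        then show "(f x - F k x)\<^sup>2 = 0" by (simp add: F_def)
      qed
      then show "(\<lambda>k. (f x - F k x)\<^sup>2) \<longlonglongrightarrow> 0" by (rule tendsto_eventually)
    qed
    show "AE x in lborel. norm ((f x - F k x)\<^sup>2) \<le> 4 * (f x)\<^sup>2" for k
    proof (rule AE_I2)
      fix x
      have "\<bar>F k x\<bar> \<le> \<bar>f x\<bar> * 1"
        unfolding F_def abs_mult using cut(1,2)[of k x] cl(1)[of k "f x"] by (intro mult_mono) auto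
      then have "\<bar>f x - F k x\<bar> \<le> \<bar>2 * f x\<bar>" by auto
      then have "(f x - F k x)\<^sup>2 \<le> (2 * f x)\<^sup>2" by (simp only: abs_le_square_iff)
      then show "norm ((f x - F k x)\<^sup>2) \<le> 4 * (f x)\<^sup>2" by (simp add: power_mult_distrib)
    qed
  qed (use f2 in \<open>measurable, simp\<close>)
  \<comment> \<open>Two errors below e/4 suffice, given the factor 2 in (a + b)^2 <= 2 a^2 + 2
    b^2.\<close>
  then have "\<forall>\<^sub>F k in sequentially. (LINT x|lborel. (f x - F k x)\<^sup>2) < e / 4"
    using \<open>e > 0\<close> by (intro order_tendstoD(2)) auto
  then obtain k where k: "(LINT x|lborel. (f x - F k x)\<^sup>2) < e / 4"
    by (meson eventually_sequentially order_refl)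

  have "f measurable_on UNIV"
    by (subst measurable_on_iff_borel_measurable)
      (auto simp: lebesgue_on_UNIV_eq intro!: measurable_completion)
  then obtain N g where N: "negligible N" and g: "\<And>n. continuous_on UNIV (g n)"
    "\<And>x. x \<notin> N \<Longrightarrow> (\<lambda>n. g n x) \<longlonglongrightarrow> f x"
    unfolding measurable_on_def by auto
  define G where "G n x = cl k (g n x) * cut k x" for n x
  have Gc: "continuous_on UNIV (G n)" for n
    unfolding G_def cl_def by (intro continuous_intros g cut)
  then have [measurable]: "G n \<in> borel_measurable borel" for n
    by (intro borel_measurable_continuous_onI)
  have G0: "G n x = 0" if "x \<notin> cball 0 (real k + 1)" for n x
    using cut(4)[OF that] by (simp add: G_def)
  have bnd: "(F k x - G n x)\<^sup>2 \<le> (2 * real k)\<^sup>2 * indicator (cball 0 (real k + 1)) x" for n x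
  proof (cases "x \<in> cball 0 (real k + 1)")
    case True
    have "\<bar>F k x\<bar> \<le> real k * 1" "\<bar>G n x\<bar> \<le> real k * 1"
      unfolding F_def G_def abs_mult using cut(1,2)[of k x] cl(2)[of k] by (intro mult_mono; auto)+
    then have "\<bar>F k x - G n x\<bar> \<le> \<bar>2 * real k\<bar>" by auto
    then have "(F k x - G n x)\<^sup>2 \<le> (2 * real k)\<^sup>2" by (simp only: abs_le_square_iff)
    with True show ?thesis by simp
  next
    case False
    with G0[of x n] cut(4)[of x k] show ?thesis by (simp add: F_def)
  qed
  have ind: "integrable lborel (\<lambda>x::'a. (2 * real k)\<^sup>2 * indicator (cball 0 (real k + 1)) x)"
    by (intro integrable_mult_right integrable_indicator_cball)
  have "(\<lambda>n. LINT x|lborel. (F k x - G n x)\<^sup>2) \<longlonglongrightarrow> (LINT x|(lborel::'a measure). 0)"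
  proof (rule integral_dominated_convergence[OF _ _ ind])
    have "AE x in lborel. x \<notin> N"
      using N AE_not_in[of N lebesgue] by (simp add: negligible_iff_null_sets AE_completion_iff)
    then show "AE x in lborel. (\<lambda>n. (F k x - G n x)\<^sup>2) \<longlonglongrightarrow> 0"
    proof eventually_elim
      case (elim x)
      have "(\<lambda>n. cl k (g n x)) \<longlonglongrightarrow> cl k (f x)"
        unfolding cl_def by (intro tendsto_intros g(2) elim)
      then have "(\<lambda>n. (F k x - G n x)\<^sup>2) \<longlonglongrightarrow> (F k x - cl k (f x) * cut k x)\<^sup>2"
        unfolding G_def by (intro tendsto_intros)
      then show ?case by (simp add: F_def)
    qed
    show "AE x in lborel. norm ((F k x - G n x)\<^sup>2) \<le> (2 * real k)\<^sup>2 * indicator (cball 0 (real k + 1)) x" for n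
      using bnd by (intro AE_I2) simp
  qed measurable
  then have "\<forall>\<^sub>F n in sequentially. (LINT x|lborel. (F k x - G n x)\<^sup>2) < e / 4"
    using \<open>e > 0\<close> by (intro order_tendstoD(2)) auto
  then obtain n where n: "(LINT x|lborel. (F k x - G n x)\<^sup>2) < e / 4"
    by (meson eventually_sequentially order_refl)
  have i1: "integrable lborel (\<lambda>x. (f x - F k x)\<^sup>2)"
  proof (rule Bochner_Integration.integrable_bound[where f="\<lambda>x. 4 * (f x)\<^sup>2"])
    show "AE x in lborel. norm ((f x - F k x)\<^sup>2) \<le> norm (4 * (f x)\<^sup>2)"
    proof (rule AE_I2)
      fix x
      have "\<bar>F k x\<bar> \<le> \<bar>f x\<bar> * 1"
        unfolding F_def abs_mult using cut(1,2)[of k x] cl(1)[of k "f x"] by (intro mult_mono) auto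
      then have "\<bar>f x - F k x\<bar> \<le> \<bar>2 * f x\<bar>" by auto
      then have "(f x - F k x)\<^sup>2 \<le> (2 * f x)\<^sup>2" by (simp only: abs_le_square_iff)
      then show "norm ((f x - F k x)\<^sup>2) \<le> norm (4 * (f x)\<^sup>2)" by (simp add: power_mult_distrib)
    qed
      show "(\<lambda>x. (f x - F k x)\<^sup>2) \<in> borel_measurable lborel" by measurable
  qed (use f2 in simp)
  have i2: "integrable lborel (\<lambda>x. (F k x - G n x)\<^sup>2)"
    by (rule Bochner_Integration.integrable_bound[OF ind]) (use bnd in auto)
  have "(LINT x|lborel. (f x - G n x)\<^sup>2) \<le> (LINT x|lborel. 2 * (f x - F k x)\<^sup>2 + 2 * (F k x - G n x)\<^sup>2)"
  proof (rule integral_mono')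
    show "integrable lborel (\<lambda>x. 2 * (f x - F k x)\<^sup>2 + 2 * (F k x - G n x)\<^sup>2)"
      using i1 i2 by simp
    show "(f x - G n x)\<^sup>2 \<le> 2 * (f x - F k x)\<^sup>2 + 2 * (F k x - G n x)\<^sup>2" for x
      using sum_squares_bound[of "f x - F k x" "F k x - G n x"]
      by (simp add: power2_eq_square algebra_simps)
  qed simp
  also have "\<dots> < e" using i1 i2 k n by simp
  finally show thesis using that[OF Gc G0] by blast
qed

text \<open>The kernel has mass 1, so the difference is an average of \<open>g y - g x\<close> over
  the points \<open>y\<close> in its support.\<close>

lemma conv_uniform:
  fixes g :: "'a::euclidean_space \<Rightarrow> real"
  assumes g: "integrable lborel g"
    and *: "\<And>y. dist y x < inverse (real (Suc n)) \<Longrightarrow> \<bar>g y - g x\<bar> \<le> e"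
  shows "\<bar>conv g (mollifier n) x - g x\<bar> \<le> e"
proof -
  let ?\<eta> = "mollifier n :: 'a \<Rightarrow> real"
  note \<eta> = mollifier_integral_translate(1,2)[of n x]
  have int: "integrable lborel (\<lambda>y. g y * ?\<eta> (x - y))" by (rule conv_integrable[OF g mollifier_test])
  have "conv g ?\<eta> x - g x = (LINT y|lborel. (g y - g x) * ?\<eta> (x - y))"
    using int \<eta> unfolding conv_def by (simp add: left_diff_distrib)
  also have "norm \<dots> \<le> (LINT y|lborel. e * ?\<eta> (x - y))"
  proof (rule norm_lebesgue_integral_le)
    show "integrable lborel (\<lambda>y. (g y - g x) * ?\<eta> (x - y))"
      using int \<eta> by (simp add: left_diff_distrib)
    show "integrable lborel (\<lambda>y. e * ?\<eta> (x - y))" using \<eta> by simp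
    show "norm ((g y - g x) * ?\<eta> (x - y)) \<le> e * ?\<eta> (x - y)" for y
    proof (cases "dist y x < inverse (real (Suc n))")
      case True
      from *[OF this] show ?thesis by (simp add: abs_mult mollifier_nonneg mult_right_mono)
    next
      case False
      then have "?\<eta> (x - y) = 0" by (intro mollifier_eq_0) (simp add: dist_norm norm_minus_commute)
      then show ?thesis by simp
    qed
  qed
  finally show ?thesis using \<eta> by simp
qed

lemma conv_diff:
  assumes "integrable lborel f" "integrable lborel g" "\<eta> \<in> test_functions UNIV"
  shows "conv (\<lambda>x. f x - g x) \<eta> x = conv f \<eta> x - conv g \<eta> x"
  using conv_integrable[OF assms(1,3), of x] conv_integrable[OF assms(2,3), of x]
  unfolding conv_def by (simp add: left_diff_distrib)

text \<open>A density argument: for a continuous \<open>g\<close> of compact support close to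
  \<open>f\<close>, the error splits into the mollification of \<open>f - g\<close>, plus the error
  of mollifying \<open>g\<close>, minus \<open>f - g\<close>. The first term is controlled by the
  last through the L2 contraction, the middle one by uniform continuity of \<open>g\<close>.\<close>

lemma conv_mollifier_L2:
  fixes f :: "'a::euclidean_space \<Rightarrow> real"
  assumes f: "integrable lborel f" and f2: "integrable lborel (\<lambda>x. (f x)\<^sup>2)"
  shows "integrable lborel (\<lambda>x. (conv f (mollifier n) x - f x)\<^sup>2)"
    and "(\<lambda>n. LINT x|lborel. (conv f (mollifier n) x - f x)\<^sup>2) \<longlonglongrightarrow> 0"
proof -
  let ?\<eta> = "\<lambda>n. mollifier n :: 'a \<Rightarrow> real"
  have [measurable]: "f \<in> borel_measurable borel" "conv f (?\<eta> n) \<in> borel_measurable borel" for n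
    using f conv_borel_measurable[OF f mollifier_test] by (auto dest: borel_measurable_integrable)
  have bound: "integrable lborel h \<and> (LINT x|lborel. h x) \<le> B"
    if "h \<in> borel_measurable borel" "\<And>x. 0 \<le> h x" "\<And>x. h x \<le> k x" "integrable lborel k" "(LINT x|lborel. k x) \<le> B" for h k :: "'a \<Rightarrow> real" and B
  proof -
    have "\<bar>h x\<bar> \<le> \<bar>k x\<bar>" for x using that(2,3)[of x] by linarith
    then have "integrable lborel h"
      using that(1) by (intro Bochner_Integration.integrable_bound[OF that(4)]) auto
    moreover from this have "(LINT x|lborel. h x) \<le> (LINT x|lborel. k x)"
      using that by (intro integral_mono) auto
    ultimately show ?thesis using that(5) by simp
  qed
  show int: "integrable lborel (\<lambda>x. (conv f (?\<eta> n) x - f x)\<^sup>2)" for n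
  proof (rule bound[THEN conjunct1, OF _ _ _ _ order_refl])
    show "integrable lborel (\<lambda>x. 2 * (conv f (?\<eta> n) x)\<^sup>2 + 2 * (f x)\<^sup>2)"
      using conv_L2_bound(1)[OF f f2] f2 by simp
    show "(conv f (?\<eta> n) x - f x)\<^sup>2 \<le> 2 * (conv f (?\<eta> n) x)\<^sup>2 + 2 * (f x)\<^sup>2" for x
      using zero_le_power2[of "conv f (?\<eta> n) x + f x"] by (simp add: power2_eq_square algebra_simps)
  qed auto
  show "(\<lambda>n. LINT x|lborel. (conv f (?\<eta> n) x - f x)\<^sup>2) \<longlonglongrightarrow> 0"
  proof (rule LIMSEQ_I)
    fix e :: real assume "e > 0"
    \<comment> \<open>Squaring a sum of three terms costs a factor 3, and each of the three
      integrals is at most e/10: in total 9/10 of \<open>e\<close>.\<close>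
    then have "e / 10 > 0" by simp
    from L2_approx_continuous[OF _ f2 this] obtain g R where g: "continuous_on UNIV g"
      "\<And>x. x \<notin> cball 0 R \<Longrightarrow> g x = 0" "(LINT x|lborel. (f x - g x)\<^sup>2) < e / 10"
      by auto
    have gi: "integrable lborel g" "integrable lborel (\<lambda>x. (g x)\<^sup>2)"
      by (rule integrable_continuous_compact_support[OF _ compact_cball[of 0 R]];
          (intro continuous_intros g(1))?; simp add: g(2) del: mem_cball)+
    have [measurable]: "g \<in> borel_measurable borel" using gi by (auto dest: borel_measurable_integrable)
    have fg: "integrable lborel (\<lambda>x. f x - g x)" using f gi by simp
    have fg2: "integrable lborel (\<lambda>x. (f x - g x)\<^sup>2)"
    proof (rule bound[THEN conjunct1, OF _ _ _ _ order_refl])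
      show "integrable lborel (\<lambda>x. 2 * (f x)\<^sup>2 + 2 * (g x)\<^sup>2)" using f2 gi by simp
      show "(f x - g x)\<^sup>2 \<le> 2 * (f x)\<^sup>2 + 2 * (g x)\<^sup>2" for x
        using zero_le_power2[of "f x + g x"] by (simp add: power2_eq_square algebra_simps)
    qed auto
    \<comment> \<open>\<open>m\<close> is the measure of a ball outside which both \<open>g\<close>
      and its mollifications vanish, the kernels having radius at most 1. The next definition makes
      the square of \<open>\<delta>\<close> times \<open>m\<close> at most e/10; its
      \<open>m + 1\<close> keeps the denominator positive.\<close>
    define m where "m = measure lborel (cball (0::'a) (R + 1))"
    define \<delta> where "\<delta> = sqrt (e / (10 * (m + 1)))"
    have "m \<ge> 0" unfolding m_def by simp
    then have \<delta>: "\<delta> > 0" "\<delta>\<^sup>2 * m \<le> e / 10"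
      using \<open>e > 0\<close> unfolding \<delta>_def by (auto simp: field_simps)
    have "uniformly_continuous_on UNIV g"
      by (rule uniformly_continuous_compact_support[OF g(1) compact_cball g(2)])
    then obtain d where d: "d > 0" "\<And>x y. dist y x < d \<Longrightarrow> dist (g y) (g x) < \<delta>"
      using \<delta>(1) unfolding uniformly_continuous_on_def by (metis UNIV_I)
    from reals_Archimedean[OF d(1)] obtain n0 where n0: "inverse (real (Suc n0)) < d" by blast
    have "norm ((LINT x|lborel. (conv f (?\<eta> n) x - f x)\<^sup>2) - 0) < e" if "n \<ge> n0" for n
    proof -
      have "inverse (real (Suc n)) \<le> inverse (real (Suc n0))" using that by (simp add: field_simps)
      with n0 have nd: "inverse (real (Suc n)) < d" by (rule order_le_less_trans[rotated])
      have un: "\<bar>conv g (?\<eta> n) x - g x\<bar> \<le> \<delta>" for x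
        using d(2) nd by (intro conv_uniform[OF gi(1)]) (auto simp: dist_real_def intro: less_imp_le)
      have z: "conv g (?\<eta> n) x - g x = 0" if "x \<notin> cball 0 (R + 1)" for x
      proof -
        have "conv g (?\<eta> n) x = 0"
        proof (rule conv_eq_0)
          fix y assume "dist x y < inverse (real (Suc n))"
          also have "\<dots> \<le> 1" by (simp add: field_simps)
          finally have "norm x < norm y + 1"
            using norm_triangle_ineq2[of x y] by (simp add: dist_norm)
          with that show "g y = 0" by (intro g(2)) simp
        qed
        with g(2)[of x] that show ?thesis by simp
      qed
      have "integrable lborel (\<lambda>x. (conv g (?\<eta> n) x - g x)\<^sup>2) \<and> (LINT x|lborel. (conv g (?\<eta> n) x - g x)\<^sup>2) \<le> e / 10"
      proof (rule bound)
        show "(\<lambda>x. (conv g (?\<eta> n) x - g x)\<^sup>2) \<in> borel_measurable borel"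
          using conv_borel_measurable[OF gi(1) mollifier_test] by measurable
        show "(conv g (?\<eta> n) x - g x)\<^sup>2 \<le> \<delta>\<^sup>2 * indicator (cball 0 (R + 1)) x" for x
          using un[of x] z[of x] \<delta>(1) power_mono[OF un[of x], of 2] by (auto simp: indicator_def)
        show "integrable lborel (\<lambda>x::'a. \<delta>\<^sup>2 * indicator (cball 0 (R + 1)) x)"
          by (intro integrable_mult_right integrable_indicator_cball)
        show "(LINT x|lborel. \<delta>\<^sup>2 * indicator (cball (0::'a) (R + 1)) x) \<le> e / 10"
          using \<delta>(2) by (simp add: m_def)
      qed simp
      note cg = this
      have "(LINT x|lborel. (conv f (?\<eta> n) x - f x)\<^sup>2) \<le> (LINT x|lborel. 3 * (conv (\<lambda>x. f x - g x) (?\<eta> n) x)\<^sup>2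
          + 3 * (conv g (?\<eta> n) x - g x)\<^sup>2 + 3 * (f x - g x)\<^sup>2)"
      proof (rule integral_mono[OF int])
        show "integrable lborel (\<lambda>x. 3 * (conv (\<lambda>x. f x - g x) (?\<eta> n) x)\<^sup>2
          + 3 * (conv g (?\<eta> n) x - g x)\<^sup>2 + 3 * (f x - g x)\<^sup>2)"
          using conv_L2_bound(1)[OF fg fg2] cg fg2 by simp
        fix x
        have sq: "(a + b - c)\<^sup>2 \<le> 3 * a\<^sup>2 + 3 * b\<^sup>2 + 3 * c\<^sup>2" for a b c :: real
          using zero_le_power2[of "a - b"] zero_le_power2[of "a + c"] zero_le_power2[of "b + c"]
          by (simp add: power2_eq_square algebra_simps)
        show "(conv f (?\<eta> n) x - f x)\<^sup>2 \<le> 3 * (conv (\<lambda>x. f x - g x) (?\<eta> n) x)\<^sup>2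
          + 3 * (conv g (?\<eta> n) x - g x)\<^sup>2 + 3 * (f x - g x)\<^sup>2"
          using sq[of "conv (\<lambda>x. f x - g x) (?\<eta> n) x" "conv g (?\<eta> n) x - g x" "f x - g x"]
          by (simp add: conv_diff[OF f gi(1) mollifier_test])
      qed
      also have "\<dots> = 3 * (LINT x|lborel. (conv (\<lambda>x. f x - g x) (?\<eta> n) x)\<^sup>2)
          + 3 * (LINT x|lborel. (conv g (?\<eta> n) x - g x)\<^sup>2) + 3 * (LINT x|lborel. (f x - g x)\<^sup>2)"
        using conv_L2_bound(1)[OF fg fg2] cg fg2 by simp
      also have "\<dots> < e"
        using conv_L2_bound(2)[OF fg fg2, of n] cg g(3) \<open>e > 0\<close> by simp
      finally show ?thesis by (simp add: integral_nonneg_AE)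
    qed
    then show "\<exists>n0. \<forall>n\<ge>n0. norm ((LINT x|lborel. (conv f (?\<eta> n) x - f x)\<^sup>2) - 0) < e" by blast
  qed
qed

section \<open>Square-integrable functions and weak gradients\<close>

lemma L2_spaceD:
  assumes "f \<in> L2_space \<Omega>"
  shows "f \<in> borel_measurable (lebesgue_on \<Omega>)" "integrable (lebesgue_on \<Omega>) (\<lambda>x. (norm (f x))\<^sup>2)"
  using assms by (auto simp: L2_space_def)

lemma L2_space_real_integrable:
  fixes f :: "'a::euclidean_space \<Rightarrow> real"
  shows "f \<in> L2_space \<Omega> \<Longrightarrow> integrable (lebesgue_on \<Omega>) (\<lambda>x. (f x)\<^sup>2)"
  by (auto simp: L2_space_def)

lemma L2_space_bound:
  fixes f :: "'a::euclidean_space \<Rightarrow> 'b::euclidean_space"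
  assumes "f \<in> borel_measurable (lebesgue_on \<Omega>)" "integrable (lebesgue_on \<Omega>) k"
    "\<And>x. (norm (f x))\<^sup>2 \<le> k x"
  shows "f \<in> L2_space \<Omega>"
proof -
  have "integrable (lebesgue_on \<Omega>) (\<lambda>x. (norm (f x))\<^sup>2)"
  proof (rule Bochner_Integration.integrable_bound[OF assms(2)])
    show "(\<lambda>x. (norm (f x))\<^sup>2) \<in> borel_measurable (lebesgue_on \<Omega>)"
      using assms(1) by measurable
    have "norm ((norm (f x))\<^sup>2) \<le> norm (k x)" for x
      using assms(3)[of x] by simp
    then show "AE x in lebesgue_on \<Omega>. norm ((norm (f x))\<^sup>2) \<le> norm (k x)" by simp
  qed
  with assms(1) show ?thesis by (simp add: L2_space_def)
qed

lemma norm_add_square_le: "(norm (a + b))\<^sup>2 \<le> 2 * (norm a)\<^sup>2 + 2 * (norm (b::'b::real_inner))\<^sup>2"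
proof -
  have "0 \<le> (norm (a - b))\<^sup>2" by simp
  then show ?thesis
    by (simp add: power2_norm_eq_inner inner_add_left inner_add_right inner_diff_left inner_diff_right inner_commute)
qed

lemma L2_space_lincomb:
  fixes f g :: "'a::euclidean_space \<Rightarrow> 'b::euclidean_space"
  assumes "f \<in> L2_space \<Omega>" "g \<in> L2_space \<Omega>"
  shows "(\<lambda>x. a *\<^sub>R f x + b *\<^sub>R g x) \<in> L2_space \<Omega>"
proof (rule L2_space_bound)
  show "(\<lambda>x. a *\<^sub>R f x + b *\<^sub>R g x) \<in> borel_measurable (lebesgue_on \<Omega>)"
    using L2_spaceD(1)[OF assms(1)] L2_spaceD(1)[OF assms(2)] by measurable
  show "integrable (lebesgue_on \<Omega>) (\<lambda>x. 2 * (a\<^sup>2 * (norm (f x))\<^sup>2) + 2 * (b\<^sup>2 * (norm (g x))\<^sup>2))"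
    using L2_spaceD(2)[OF assms(1)] L2_spaceD(2)[OF assms(2)] by simp
  show "(norm (a *\<^sub>R f x + b *\<^sub>R g x))\<^sup>2 \<le> 2 * (a\<^sup>2 * (norm (f x))\<^sup>2) + 2 * (b\<^sup>2 * (norm (g x))\<^sup>2)" for x
    using norm_add_square_le[of "a *\<^sub>R f x" "b *\<^sub>R g x"] by (simp add: power_mult_distrib)
qed

lemma L2_space_diff:
  fixes f g :: "'a::euclidean_space \<Rightarrow> 'b::euclidean_space"
  assumes "f \<in> L2_space \<Omega>" "g \<in> L2_space \<Omega>"
  shows "(\<lambda>x. f x - g x) \<in> L2_space \<Omega>"
  using L2_space_lincomb[OF assms, of 1 "-1"] by simp

lemma L2_space_add:
  fixes f g :: "'a::euclidean_space \<Rightarrow> 'b::euclidean_space"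
  assumes "f \<in> L2_space \<Omega>" "g \<in> L2_space \<Omega>"
  shows "(\<lambda>x. f x + g x) \<in> L2_space \<Omega>"
  using L2_space_lincomb[OF assms, of 1 1] by simp

lemma L2_space_scale_bounded:
  fixes g :: "'a::euclidean_space \<Rightarrow> 'b::euclidean_space"
  assumes "g \<in> L2_space \<Omega>" "h \<in> borel_measurable (lebesgue_on \<Omega>)" "\<And>x. \<bar>h x\<bar> \<le> B"
  shows "(\<lambda>x. h x *\<^sub>R g x) \<in> L2_space \<Omega>"
proof (rule L2_space_bound)
  show "(\<lambda>x. h x *\<^sub>R g x) \<in> borel_measurable (lebesgue_on \<Omega>)"
    using L2_spaceD(1)[OF assms(1)] assms(2) by measurable
  show "integrable (lebesgue_on \<Omega>) (\<lambda>x. B\<^sup>2 * (norm (g x))\<^sup>2)"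
    using L2_spaceD(2)[OF assms(1)] by simp
  have "(h x)\<^sup>2 \<le> B\<^sup>2" for x using power_mono[OF assms(3)[of x], of 2] by simp
  then show "(norm (h x *\<^sub>R g x))\<^sup>2 \<le> B\<^sup>2 * (norm (g x))\<^sup>2" for x
    by (simp add: power_mult_distrib mult_right_mono)
qed

lemma L2_space_inner_const:
  fixes g :: "'a::euclidean_space \<Rightarrow> 'b::euclidean_space"
  assumes "g \<in> L2_space \<Omega>"
  shows "(\<lambda>x. g x \<bullet> i) \<in> L2_space \<Omega>"
proof (rule L2_space_bound)
  show "(\<lambda>x. g x \<bullet> i) \<in> borel_measurable (lebesgue_on \<Omega>)"
    using L2_spaceD(1)[OF assms(1)] by measurable
  show "integrable (lebesgue_on \<Omega>) (\<lambda>x. (norm (g x))\<^sup>2 * (norm i)\<^sup>2)"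
    using L2_spaceD(2)[OF assms(1)] by simp
  show "(norm (g x \<bullet> i))\<^sup>2 \<le> (norm (g x))\<^sup>2 * (norm i)\<^sup>2" for x
    using power_mono[OF Cauchy_Schwarz_ineq2[of "g x" i], of 2] by (simp add: power_mult_distrib)
qed

lemma L2_inner_integrable:
  fixes f g :: "'a::euclidean_space \<Rightarrow> 'b::euclidean_space"
  assumes "f \<in> L2_space \<Omega>" "g \<in> L2_space \<Omega>"
  shows "integrable (lebesgue_on \<Omega>) (\<lambda>x. f x \<bullet> g x)"
proof (rule Bochner_Integration.integrable_bound)
  show "integrable (lebesgue_on \<Omega>) (\<lambda>x. (norm (f x))\<^sup>2 + (norm (g x))\<^sup>2)"
    using L2_spaceD(2)[OF assms(1)] L2_spaceD(2)[OF assms(2)] by simp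
  show "(\<lambda>x. f x \<bullet> g x) \<in> borel_measurable (lebesgue_on \<Omega>)"
    using L2_spaceD(1)[OF assms(1)] L2_spaceD(1)[OF assms(2)] by measurable
  have "norm (f x \<bullet> g x) \<le> norm ((norm (f x))\<^sup>2 + (norm (g x))\<^sup>2)" for x
  proof -
    have "2 * (norm (f x) * norm (g x)) \<le> (norm (f x))\<^sup>2 + (norm (g x))\<^sup>2"
      using sum_squares_bound[of "norm (f x)" "norm (g x)"] by (simp add: mult.assoc)
    moreover have "0 \<le> norm (f x) * norm (g x)" by simp
    moreover have "\<bar>f x \<bullet> g x\<bar> \<le> norm (f x) * norm (g x)" by (rule Cauchy_Schwarz_ineq2)
    ultimately have "\<bar>f x \<bullet> g x\<bar> \<le> (norm (f x))\<^sup>2 + (norm (g x))\<^sup>2" by linarith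
    then show ?thesis by simp
  qed
  then show "AE x in lebesgue_on \<Omega>. norm (f x \<bullet> g x) \<le> norm ((norm (f x))\<^sup>2 + (norm (g x))\<^sup>2)" by simp
qed

lemma L2_mult_integrable:
  fixes f g :: "'a::euclidean_space \<Rightarrow> real"
  shows "f \<in> L2_space \<Omega> \<Longrightarrow> g \<in> L2_space \<Omega> \<Longrightarrow> integrable (lebesgue_on \<Omega>) (\<lambda>x. f x * g x)"
  using L2_inner_integrable[of f \<Omega> g] by simp

text \<open>A weighted Young inequality replaces Cauchy-Schwarz: the product is at most half of s
  h^2 + psi^2 / s, with \<open>s\<close> fixed first and \<open>n\<close> chosen afterwards. Asking
  only that \<open>f n\<close> be dominated by the product admits Lipschitz differences and extra
  bounded factors.\<close>

lemma L2_pairing_tendsto_0: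
  fixes h :: "nat \<Rightarrow> 'a::euclidean_space \<Rightarrow> real"
  assumes h: "\<And>n. h n \<in> L2_space \<Omega>" and \<psi>: "\<psi> \<in> L2_space \<Omega>"
    and lim: "(\<lambda>n. LINT x|lebesgue_on \<Omega>. (h n x)\<^sup>2) \<longlonglongrightarrow> 0"
    and f: "\<And>n. f n \<in> borel_measurable (lebesgue_on \<Omega>)" "\<And>n x. \<bar>f n x\<bar> \<le> \<bar>h n x * \<psi> x\<bar>"
  shows "(\<lambda>n. LINT x|lebesgue_on \<Omega>. f n x) \<longlonglongrightarrow> 0"
proof (rule LIMSEQ_I)
  fix e :: real assume "e > 0"
  define C where "C = (LINT x|lebesgue_on \<Omega>. (\<psi> x)\<^sup>2)"
  \<comment> \<open>Chosen to give C / s < e, the summand 1 keeping \<open>s\<close> positive when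
    \<open>C\<close> is 0. The threshold e / s for the square integral of \<open>h n\<close> then
    makes the other term smaller than \<open>e\<close> too.\<close>
  define s where "s = (C + 1) / e"
  have "C \<ge> 0" unfolding C_def by simp
  then have s: "s > 0" "C / s < e" using \<open>e > 0\<close> by (auto simp: s_def field_simps)
  have "\<forall>\<^sub>F n in sequentially. (LINT x|lebesgue_on \<Omega>. (h n x)\<^sup>2) < e / s"
    using \<open>e > 0\<close> s by (intro order_tendstoD(2)[OF lim]) simp
  then obtain n0 where n0: "\<And>n. n \<ge> n0 \<Longrightarrow> (LINT x|lebesgue_on \<Omega>. (h n x)\<^sup>2) < e / s"
    unfolding eventually_sequentially by blast
  have "norm ((LINT x|lebesgue_on \<Omega>. f n x) - 0) < e" if "n \<ge> n0" for n
  proof -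
    let ?k = "\<lambda>x. (s * (h n x)\<^sup>2 + (\<psi> x)\<^sup>2 / s) / 2"
    have i: "integrable (lebesgue_on \<Omega>) (\<lambda>x. (h n x)\<^sup>2)" "integrable (lebesgue_on \<Omega>) (\<lambda>x. (\<psi> x)\<^sup>2)"
      using L2_space_real_integrable h \<psi> by blast+
    have le: "norm (f n x) \<le> ?k x" for x
    proof -
      have "0 \<le> (s * \<bar>h n x\<bar> - \<bar>\<psi> x\<bar>)\<^sup>2 / s" using s by simp
      also have "\<dots> = s * (h n x)\<^sup>2 + (\<psi> x)\<^sup>2 / s - 2 * (\<bar>h n x\<bar> * \<bar>\<psi> x\<bar>)"
        using s by (simp add: power2_diff field_simps power2_eq_square)
      finally show ?thesis using f(2)[of n x] unfolding abs_mult by simp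
    qed
    have ik: "integrable (lebesgue_on \<Omega>) ?k" using i by simp
    have "integrable (lebesgue_on \<Omega>) (f n)"
    proof (rule Bochner_Integration.integrable_bound[OF ik f(1)])
      have "norm (f n x) \<le> norm (?k x)" for x using le[of x] by simp
      then show "AE x in lebesgue_on \<Omega>. norm (f n x) \<le> norm (?k x)" by simp
    qed
    then have "norm (LINT x|lebesgue_on \<Omega>. f n x) \<le> (LINT x|lebesgue_on \<Omega>. ?k x)"
      using ik le by (rule norm_lebesgue_integral_le)
    also have "\<dots> = (s * (LINT x|lebesgue_on \<Omega>. (h n x)\<^sup>2) + C / s) / 2"
      using i by (simp add: C_def)
    also have "\<dots> < e"
    proof -
      have "s * (LINT x|lebesgue_on \<Omega>. (h n x)\<^sup>2) < e"
        using n0[OF that] s(1) by (simp add: field_simps)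
      moreover have "(a + b) / 2 < e" if "a < e" "b < e" for a b :: real using that by simp
      ultimately show ?thesis using s(2) by blast
    qed
    finally show ?thesis by simp
  qed
  then show "\<exists>n0. \<forall>n\<ge>n0. norm ((LINT x|lebesgue_on \<Omega>. f n x) - 0) < e" by blast
qed

lemma borel_measurable_lebesgue_on:
  "f \<in> borel_measurable borel \<Longrightarrow> f \<in> borel_measurable (lebesgue_on \<Omega>)"
  by (intro measurable_restrict_space1 measurable_completion) simp

text \<open>Difference quotients of a compactly supported function integrate to 0 by translation
  invariance, and they converge dominatedly to the directional derivative. Applied to a product,
  this is integration by parts.\<close>

lemma integral_by_parts_compact_support:
  fixes \<psi> :: "'a::euclidean_space \<Rightarrow> real"
  assumes \<psi>: "\<And>x. (\<psi> has_derivative \<psi>' x) (at x)" and c: "continuous_on UNIV (\<lambda>x. \<psi>' x i)"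
    and K: "compact K" "\<And>x. x \<notin> K \<Longrightarrow> \<psi> x = 0"
  shows "(LINT x|lborel. \<psi>' x i) = 0"
proof -
  have D0: "\<psi>' x i = 0" if "x \<notin> K" for x
    using partial_deriv_eq_0[OF K that, where i=i] frechet_derivative_at[OF \<psi>, of x] by simp
  obtain B where B: "B > 0" "\<And>x. \<bar>\<psi>' x i\<bar> \<le> B"
    using bounded_continuous_compact_support[OF c K(1) D0] by blast
  obtain R where R: "K \<subseteq> cball 0 R"
    using bounded_subset_ballD[OF compact_imp_bounded[OF K(1)], of 0] ball_subset_cball by blast
  have \<psi>c: "continuous_on UNIV \<psi>"
    using \<psi> by (auto simp: continuous_on_eq_continuous_at intro: has_derivative_continuous)
  have [measurable]: "\<psi> \<in> borel_measurable borel" "(\<lambda>x. \<psi>' x i) \<in> borel_measurable borel"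
    using \<psi>c c by (auto intro: borel_measurable_continuous_onI)
  have line: "((\<lambda>t. \<psi> (x + t *\<^sub>R i)) has_real_derivative \<psi>' (x + t *\<^sub>R i) i) (at t)" for x t
  proof -
    have "((\<lambda>t. x + t *\<^sub>R i) has_derivative (\<lambda>s. s *\<^sub>R i)) (at t)"
      by (auto intro!: derivative_eq_intros)
    from has_derivative_compose[OF this \<psi>]
    show ?thesis
      by (simp add: has_field_derivative_def linear_scale[OF has_derivative_linear[OF \<psi>]] mult_commute_abs)
  qed
  define r where "r n = inverse (real (Suc n))" for n
  have r: "r n > 0" "r n \<le> 1" "r n \<noteq> 0" for n by (auto simp: r_def field_simps)
  have r0: "r \<longlonglongrightarrow> 0" unfolding r_def by (rule LIMSEQ_inverse_real_of_nat)
  define f where "f n x = (\<psi> (x + r n *\<^sub>R i) - \<psi> x) / r n" for n x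
  have f_int: "(LINT x|lborel. f n x) = 0" for n
  proof -
    have "integrable lborel \<psi>" by (rule integrable_continuous_compact_support[OF \<psi>c K])
    then show ?thesis
      unfolding f_def using integrable_lborel_translate[of \<psi> "r n *\<^sub>R i"] integral_lborel_translate[of \<psi> "r n *\<^sub>R i"]
      by simp
  qed
  \<comment> \<open>Since \<open>r n\<close> is at most 1, a shift moves a point by at most
    \<open>norm i\<close>. Hence the quotients vanish outside the ball of radius
    \<open>R + norm i\<close>, and the mean value theorem bounds them by \<open>B\<close> inside
    it.\<close>
  have "(\<lambda>n. LINT x|lborel. f n x) \<longlonglongrightarrow> (LINT x|lborel. \<psi>' x i)"
  proof (rule integral_dominated_convergence[where w="\<lambda>x. B * indicator (cball 0 (R + norm i)) x"])
    show "integrable lborel (\<lambda>x. B * indicator (cball 0 (R + norm i)) x)"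
      by (intro integrable_mult_right integrable_indicator_cball)
    show "f n \<in> borel_measurable lborel" for n unfolding f_def by measurable
    show "AE x in lborel. (\<lambda>n. f n x) \<longlonglongrightarrow> \<psi>' x i"
    proof (rule AE_I2)
      fix x
      have "((\<lambda>h. (\<psi> (x + h *\<^sub>R i) - \<psi> x) / h) \<longlongrightarrow> \<psi>' x i) (at 0)"
        using line[of x 0] by (simp add: DERIV_def)
      then show "(\<lambda>n. f n x) \<longlonglongrightarrow> \<psi>' x i"
        unfolding f_def by (rule filterlim_compose) (auto simp: filterlim_at r0 r(3))
    qed
    show "AE x in lborel. norm (f n x) \<le> B * indicator (cball 0 (R + norm i)) x" for n
    proof (rule AE_I2)
      fix x
      show "norm (f n x) \<le> B * indicator (cball 0 (R + norm i)) x"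
      proof (cases "x \<in> cball 0 (R + norm i)")
        case True
        obtain t where "\<psi> (x + r n *\<^sub>R i) - \<psi> x = r n * \<psi>' (x + t *\<^sub>R i) i"
          using MVT2[OF r(1)[of n], of "\<lambda>t. \<psi> (x + t *\<^sub>R i)" "\<lambda>t. \<psi>' (x + t *\<^sub>R i) i"] line by auto
        then have "f n x = \<psi>' (x + t *\<^sub>R i) i" using r(3)[of n] by (simp add: f_def)
        with B True show ?thesis by simp
      next
        case False
        have "norm (r n *\<^sub>R i) \<le> norm i" using r[of n] by (simp add: mult_left_le_one_le)
        then have "norm x \<le> norm (x + r n *\<^sub>R i) + norm i"
          using norm_triangle_ineq4[of "x + r n *\<^sub>R i" "r n *\<^sub>R i"] by simp
        with False have "x + r n *\<^sub>R i \<notin> cball 0 R" "x \<notin> cball 0 R"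
          using norm_ge_zero[of i] unfolding mem_cball_0 by linarith+
        with R have "x + r n *\<^sub>R i \<notin> K" "x \<notin> K" by blast+
        then have "f n x = 0" by (simp add: f_def K(2))
        with B show ?thesis by simp
      qed
    qed
  qed simp
  then show ?thesis
    unfolding f_int using LIMSEQ_unique tendsto_const by blast
qed

text \<open>Members of \<open>L2_space\<close> are only Lebesgue measurable and have arbitrary
  values outside \<open>\<Omega>\<close>, whereas \<open>conv\<close> integrates over the whole
  space with respect to \<open>lborel\<close>. This picks a Borel representative extended by 0; the
  lemma of the same name shows that one exists.\<close>

definition borel_ext :: "'a::euclidean_space set \<Rightarrow> ('a \<Rightarrow> real) \<Rightarrow> 'a \<Rightarrow> real" where
  "borel_ext \<Omega> f = (SOME f'. f' \<in> borel_measurable borel \<and> (\<forall>x. x \<notin> \<Omega> \<longrightarrow> f' x = 0) \<and>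
     (AE x in lebesgue_on \<Omega>. f' x = f x))"

definition mollify :: "'a::euclidean_space set \<Rightarrow> ('a \<Rightarrow> real) \<Rightarrow> nat \<Rightarrow> 'a \<Rightarrow> real" where
  "mollify \<Omega> f n = conv (borel_ext \<Omega> f) (mollifier n)"

text \<open>A relation to any representative of the gradient, in contrast to the choice made by
  \<open>weak_grad\<close>. Calculus rules can thus name explicit gradients.\<close>

definition has_H1_gradient :: "'a::euclidean_space set \<Rightarrow> ('a \<Rightarrow> real) \<Rightarrow> ('a \<Rightarrow> 'a) \<Rightarrow> bool" where
  "has_H1_gradient \<Omega> u g \<longleftrightarrow> u \<in> L2_space \<Omega> \<and> g \<in> L2_space \<Omega> \<and> has_weak_gradient \<Omega> u g"

section \<open>Mollification on a bounded open set\<close>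

locale bounded_open_set =
  fixes \<Omega> :: "'a::euclidean_space set"
  assumes open_\<Omega>: "open \<Omega>" and bounded_\<Omega>: "bounded \<Omega>"
begin

lemma \<Omega>_sets: "\<Omega> \<in> sets borel" "\<Omega> \<in> sets lebesgue" "\<Omega> \<inter> space lebesgue \<in> sets lebesgue"
  using open_\<Omega> by auto

lemma \<Omega>_lmeasurable: "\<Omega> \<in> lmeasurable"
  using bounded_set_imp_lmeasurable[OF bounded_\<Omega>] \<Omega>_sets by blast

lemma integrable_const_\<Omega>: "integrable (lebesgue_on \<Omega>) (\<lambda>x. c :: real)"
  using finite_measure_lebesgue_on[OF \<Omega>_lmeasurable] by (simp add: finite_measure.integrable_const)

lemma AE_lebesgue_on_iff: "(AE x in lebesgue_on \<Omega>. P x) \<longleftrightarrow> (AE x in lborel. x \<in> \<Omega> \<longrightarrow> P x)"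
  by (simp add: AE_restrict_space_iff \<Omega>_sets AE_completion_iff)

lemma lebesgue_on_eq_lborel:
  fixes F :: "'a \<Rightarrow> real"
  assumes F: "F \<in> borel_measurable borel" "\<And>x. x \<notin> \<Omega> \<Longrightarrow> F x = 0"
  shows "(LINT x|lebesgue_on \<Omega>. F x) = (LINT x|lborel. F x)"
    and "integrable (lebesgue_on \<Omega>) F \<longleftrightarrow> integrable lborel F"
proof -
  have eq: "(\<lambda>x. indicator \<Omega> x *\<^sub>R F x) = F" using F(2) by (auto simp: indicator_def fun_eq_iff)
  show "(LINT x|lebesgue_on \<Omega>. F x) = (LINT x|lborel. F x)"
    using F(1) by (simp add: integral_restrict_space \<Omega>_sets eq[simplified] integral_completion)
  show "integrable (lebesgue_on \<Omega>) F \<longleftrightarrow> integrable lborel F"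
    using F(1) by (simp add: integrable_restrict_space \<Omega>_sets eq[simplified] integrable_completion)
qed

lemma integral_lebesgue_on_le:
  fixes F :: "'a \<Rightarrow> real"
  assumes F: "integrable lborel F" "\<And>x. F x \<ge> 0"
  shows "integrable (lebesgue_on \<Omega>) F" "(LINT x|lebesgue_on \<Omega>. F x) \<le> (LINT x|lborel. F x)"
proof -
  have [measurable]: "F \<in> borel_measurable borel" using F(1) by auto
  have int: "integrable lborel (\<lambda>x. indicator \<Omega> x *\<^sub>R F x)"
    using \<Omega>_sets F(1) by (intro integrable_mult_indicator) auto
  then show "integrable (lebesgue_on \<Omega>) F"
    using \<Omega>_sets by (simp add: integrable_restrict_space integrable_completion)
  have "(LINT x|lebesgue_on \<Omega>. F x) = (LINT x|lborel. indicator \<Omega> x *\<^sub>R F x)"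
    using \<Omega>_sets by (simp add: integral_restrict_space integral_completion)
  also have "\<dots> \<le> (LINT x|lborel. F x)"
    using F by (intro integral_mono[OF int]) (auto simp: indicator_def)
  finally show "(LINT x|lebesgue_on \<Omega>. F x) \<le> (LINT x|lborel. F x)" .
qed

lemma borel_ext:
  assumes "f \<in> borel_measurable (lebesgue_on \<Omega>)"
  shows "borel_ext \<Omega> f \<in> borel_measurable borel" "x \<notin> \<Omega> \<Longrightarrow> borel_ext \<Omega> f x = 0"
    "AE x in lebesgue_on \<Omega>. borel_ext \<Omega> f x = f x"
proof -
  have "(\<lambda>x. indicator \<Omega> x *\<^sub>R f x) \<in> borel_measurable lebesgue"
    using assms by (simp add: borel_measurable_restrict_space_iff \<Omega>_sets)
  from completion_ex_borel_measurable_real[OF this] obtain g where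
    g: "g \<in> borel_measurable borel" "AE x in lborel. indicator \<Omega> x *\<^sub>R f x = g x" by auto
  let ?g = "\<lambda>x. indicator \<Omega> x * g x"
  have "?g \<in> borel_measurable borel" using g(1) \<Omega>_sets by measurable
  moreover have "AE x in lborel. x \<in> \<Omega> \<longrightarrow> ?g x = f x"
    using g(2) by eventually_elim (auto simp: indicator_def)
  ultimately have "\<exists>f'. f' \<in> borel_measurable borel \<and> (\<forall>x. x \<notin> \<Omega> \<longrightarrow> f' x = 0) \<and>
     (AE x in lebesgue_on \<Omega>. f' x = f x)"
    unfolding AE_lebesgue_on_iff by (intro exI[of _ ?g]) simp
  from someI_ex[OF this]
  show "borel_ext \<Omega> f \<in> borel_measurable borel" "x \<notin> \<Omega> \<Longrightarrow> borel_ext \<Omega> f x = 0"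
    "AE x in lebesgue_on \<Omega>. borel_ext \<Omega> f x = f x"
    unfolding borel_ext_def by blast+
qed

lemma bounded_L2_space:
  fixes f :: "'a \<Rightarrow> 'b::euclidean_space"
  assumes "f \<in> borel_measurable (lebesgue_on \<Omega>)" "\<And>x. norm (f x) \<le> B"
  shows "f \<in> L2_space \<Omega>"
  using assms by (intro L2_space_bound[where k="\<lambda>x. B\<^sup>2"] integrable_const_\<Omega> power_mono) auto

lemma test_functions_L2: "\<phi> \<in> test_functions \<Omega>' \<Longrightarrow> \<phi> \<in> L2_space \<Omega>"
proof -
  assume "\<phi> \<in> test_functions \<Omega>'"
  then show ?thesis
    using test_functions_bounded[of \<phi>] smooth_borel_measurable[of \<phi>]
    by (metis bounded_L2_space borel_measurable_lebesgue_on real_norm_def test_functions_iff)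
qed

text \<open>\<open>\<Omega>\<close> has finite measure, so the constant 1 is square integrable and
  can be the second factor of an integrable product. This admits square-integrable functions to
  \<open>conv\<close>, which is developed for integrable ones.\<close>

lemma L2_integrable:
  fixes f :: "'a \<Rightarrow> real"
  assumes "f \<in> L2_space \<Omega>"
  shows "integrable (lebesgue_on \<Omega>) f"
proof -
  have "(\<lambda>x. 1 :: real) \<in> L2_space \<Omega>" by (rule bounded_L2_space[of _ 1]) auto
  from L2_mult_integrable[OF assms this] show ?thesis by simp
qed

lemma borel_ext_integrable:
  assumes f: "f \<in> L2_space \<Omega>"
  shows "integrable lborel (borel_ext \<Omega> f)" "integrable lborel (\<lambda>x. (borel_ext \<Omega> f x)\<^sup>2)"
proof -
  note e = borel_ext[OF L2_spaceD(1)[OF f]]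
  have [measurable]: "borel_ext \<Omega> f \<in> borel_measurable (lebesgue_on \<Omega>)" "f \<in> borel_measurable (lebesgue_on \<Omega>)"
    using borel_measurable_lebesgue_on[OF e(1)] L2_spaceD(1)[OF f] .
  have "integrable (lebesgue_on \<Omega>) (borel_ext \<Omega> f)"
    using L2_integrable[OF f] e(3) by (subst integrable_cong_AE[of _ _ f]) auto
  then show "integrable lborel (borel_ext \<Omega> f)"
    using lebesgue_on_eq_lborel(2)[OF e(1,2)] by simp
  have "AE x in lebesgue_on \<Omega>. (borel_ext \<Omega> f x)\<^sup>2 = (f x)\<^sup>2"
    using e(3) by eventually_elim simp
  then have "integrable (lebesgue_on \<Omega>) (\<lambda>x. (borel_ext \<Omega> f x)\<^sup>2)"
    using L2_space_real_integrable[OF f] by (subst integrable_cong_AE[of _ _ "\<lambda>x. (f x)\<^sup>2"]) auto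
  moreover have "(\<lambda>x. (borel_ext \<Omega> f x)\<^sup>2) \<in> borel_measurable borel" using e(1) by measurable
  ultimately show "integrable lborel (\<lambda>x. (borel_ext \<Omega> f x)\<^sup>2)"
    using lebesgue_on_eq_lborel(2) e(2) by simp
qed

lemma smooth_mollify: "f \<in> L2_space \<Omega> \<Longrightarrow> smooth (mollify \<Omega> f n)"
  unfolding mollify_def by (intro smooth_conv borel_ext_integrable mollifier_test)

text \<open>Returns from the Borel representative to \<open>f\<close> itself, so that the defining
  identity of a weak gradient can be applied with the reflected kernel as test function.\<close>

lemma conv_borel_ext:
  assumes f: "f \<in> L2_space \<Omega>" and \<eta>: "\<eta> \<in> test_functions UNIV"
  shows "conv (borel_ext \<Omega> f) \<eta> x = (LINT y|lebesgue_on \<Omega>. f y * \<eta> (x - y))"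
proof -
  note e = borel_ext[OF L2_spaceD(1)[OF f]]
  have [measurable]: "\<eta> \<in> borel_measurable borel"
    using \<eta> smooth_borel_measurable test_functions_iff by blast
  have *: "(\<lambda>y. \<eta> (x - y)) \<in> borel_measurable borel" by measurable
  have "(\<lambda>y. borel_ext \<Omega> f y * \<eta> (x - y)) \<in> borel_measurable borel"
    using e(1) by measurable
  then have "conv (borel_ext \<Omega> f) \<eta> x = (LINT y|lebesgue_on \<Omega>. borel_ext \<Omega> f y * \<eta> (x - y))"
    unfolding conv_def using e(2) by (intro lebesgue_on_eq_lborel(1)[symmetric]) auto
  also have "\<dots> = (LINT y|lebesgue_on \<Omega>. f y * \<eta> (x - y))"
  proof (rule integral_cong_AE)
    show "AE y in lebesgue_on \<Omega>. borel_ext \<Omega> f y * \<eta> (x - y) = f y * \<eta> (x - y)"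
      using e(3) by eventually_elim simp
  qed (use borel_measurable_lebesgue_on[OF *] borel_measurable_lebesgue_on[OF e(1)] L2_spaceD(1)[OF f] in measurable)
  finally show ?thesis .
qed

lemma mollify_L2:
  assumes f: "f \<in> L2_space \<Omega>"
  shows "mollify \<Omega> f n \<in> L2_space \<Omega>"
    and "(\<lambda>n. LINT x|lebesgue_on \<Omega>. (mollify \<Omega> f n x - f x)\<^sup>2) \<longlonglongrightarrow> 0"
proof -
  note e = borel_ext[OF L2_spaceD(1)[OF f]]
  note i = borel_ext_integrable[OF f]
  have m: "mollify \<Omega> f n \<in> borel_measurable (lebesgue_on \<Omega>)" for n
    by (intro borel_measurable_lebesgue_on smooth_borel_measurable smooth_mollify f)
  show "mollify \<Omega> f n \<in> L2_space \<Omega>"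
    using m integral_lebesgue_on_le(1)[OF conv_L2_bound(1)[OF i]]
    by (simp add: L2_space_def mollify_def)
  have eq: "(LINT x|lebesgue_on \<Omega>. (mollify \<Omega> f n x - borel_ext \<Omega> f x)\<^sup>2)
      = (LINT x|lebesgue_on \<Omega>. (mollify \<Omega> f n x - f x)\<^sup>2)" for n
  proof (rule integral_cong_AE)
    show "AE x in lebesgue_on \<Omega>. (mollify \<Omega> f n x - borel_ext \<Omega> f x)\<^sup>2 = (mollify \<Omega> f n x - f x)\<^sup>2"
      using e(3) by eventually_elim simp
  qed (use m borel_measurable_lebesgue_on[OF e(1)] L2_spaceD(1)[OF f] in measurable)
  show "(\<lambda>n. LINT x|lebesgue_on \<Omega>. (mollify \<Omega> f n x - f x)\<^sup>2) \<longlonglongrightarrow> 0"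
    unfolding eq[symmetric]
  proof (rule tendsto_sandwich[OF _ _ tendsto_const])
    show "(\<lambda>n. LINT x|lborel. (mollify \<Omega> f n x - borel_ext \<Omega> f x)\<^sup>2) \<longlonglongrightarrow> 0"
      unfolding mollify_def by (rule conv_mollifier_L2(2)[OF i])
    show "\<forall>\<^sub>F n in sequentially. (LINT x|lebesgue_on \<Omega>. (mollify \<Omega> f n x - borel_ext \<Omega> f x)\<^sup>2)
      \<le> (LINT x|lborel. (mollify \<Omega> f n x - borel_ext \<Omega> f x)\<^sup>2)"
      unfolding mollify_def
      by (intro always_eventually allI integral_lebesgue_on_le(2)[OF conv_mollifier_L2(1)[OF i]]) simp
  qed simp
qed

lemma L2_AE_subseq:
  fixes h :: "nat \<Rightarrow> 'a \<Rightarrow> real"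
  assumes "\<And>n. h n \<in> L2_space \<Omega>" "(\<lambda>n. LINT x|lebesgue_on \<Omega>. (h n x)\<^sup>2) \<longlonglongrightarrow> 0"
  obtains r :: "nat \<Rightarrow> nat" where "strict_mono r" "AE x in lebesgue_on \<Omega>. (\<lambda>n. h (r n) x) \<longlonglongrightarrow> 0"
proof -
  have "\<exists>r::nat \<Rightarrow> nat. strict_mono r \<and> (AE x in lebesgue_on \<Omega>. (\<lambda>n. (h (r n) x)\<^sup>2) \<longlonglongrightarrow> 0)"
    using assms by (intro tendsto_L1_AE_subseq L2_space_real_integrable) simp_all
  then obtain r :: "nat \<Rightarrow> nat" where r: "strict_mono r" "AE x in lebesgue_on \<Omega>. (\<lambda>n. (h (r n) x)\<^sup>2) \<longlonglongrightarrow> 0" by blast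
  from r(2) have "AE x in lebesgue_on \<Omega>. (\<lambda>n. h (r n) x) \<longlonglongrightarrow> 0"
  proof eventually_elim
    case (elim x)
    from tendsto_real_sqrt[OF elim] have "(\<lambda>n. \<bar>h (r n) x\<bar>) \<longlonglongrightarrow> 0" by simp
    then show ?case by (rule tendsto_rabs_zero_cancel)
  qed
  with r(1) that show thesis by blast
qed

lemma mollify_eq_0:
  assumes f: "f \<in> L2_space \<Omega>" and "AE y in lebesgue_on \<Omega>. dist x y < inverse (real (Suc n)) \<longrightarrow> f y = 0"
  shows "mollify \<Omega> f n x = 0"
proof -
  have "mollify \<Omega> f n x = (LINT y|lebesgue_on \<Omega>. f y * mollifier n (x - y))"
    unfolding mollify_def by (rule conv_borel_ext[OF f mollifier_test])
  also have "\<dots> = 0"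
  proof (rule integral_eq_zero_AE)
    show "AE y in lebesgue_on \<Omega>. f y * mollifier n (x - y) = 0"
      using assms(2)
    proof eventually_elim
      case (elim y)
      then show ?case
        using mollifier_eq_0[of n "x - y"] unfolding dist_norm mult_eq_0_iff by linarith
    qed
  qed
  finally show ?thesis .
qed

lemma test_functions_mollifier:
  assumes "cball x (inverse (real (Suc n))) \<subseteq> \<Omega>"
  shows "(\<lambda>y. mollifier n (x - y)) \<in> test_functions \<Omega>"
  unfolding test_functions_iff
proof (intro conjI exI[of _ "cball x (inverse (real (Suc n)))"] allI impI assms)
  show "smooth (\<lambda>y. mollifier n (x - y))" by (intro smooth_reflect smooth_mollifier)
  show "mollifier n (x - y) = 0" if "y \<notin> cball x (inverse (real (Suc n)))" for y
    using that mollifier_eq_0[of n "x - y"] unfolding mem_cball dist_norm by linarith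
qed simp

text \<open>When the closed ball fits into \<open>\<Omega>\<close>, the reflected kernel
  \<open>\<lambda>y. mollifier n (x - y)\<close> is a test function; the minus sign of the
  reflection cancels that of the weak gradient. Near the boundary the identity may fail, because the
  extension by 0 may jump there.\<close>

lemma partial_deriv_mollify:
  assumes ug: "has_H1_gradient \<Omega> u g" and i: "i \<in> Basis"
    and x: "cball x (inverse (real (Suc n))) \<subseteq> \<Omega>"
  shows "partial_deriv i (mollify \<Omega> u n) x = mollify \<Omega> (\<lambda>x. g x \<bullet> i) n x"
proof -
  let ?\<eta> = "mollifier n :: 'a \<Rightarrow> real"
  have u: "u \<in> L2_space \<Omega>" and g: "(\<lambda>x. g x \<bullet> i) \<in> L2_space \<Omega>"
    using ug L2_space_inner_const by (auto simp: has_H1_gradient_def)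
  have "partial_deriv i (mollify \<Omega> u n) x = conv (borel_ext \<Omega> u) (partial_deriv i ?\<eta>) x"
    using fun_cong[OF conv_partial_deriv[OF borel_ext_integrable(1)[OF u] mollifier_test[of n] i], where x=x]
    by (simp add: mollify_def)
  also have "\<dots> = (LINT y|lebesgue_on \<Omega>. u y * partial_deriv i ?\<eta> (x - y))"
    by (rule conv_borel_ext[OF u test_functions_partial_deriv[OF mollifier_test i]])
  also have "\<dots> = - (LINT y|lebesgue_on \<Omega>. u y * partial_deriv i (\<lambda>y. ?\<eta> (x - y)) y)"
    using smooth_reflect(2)[OF smooth_mollifier[of n], where a=x and i=i] by (simp add: fun_eq_iff)
  also have "\<dots> = (LINT y|lebesgue_on \<Omega>. (g y \<bullet> i) * ?\<eta> (x - y))"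
    using ug i test_functions_mollifier[OF x]
    unfolding has_H1_gradient_def has_weak_gradient_def by simp
  also have "\<dots> = mollify \<Omega> (\<lambda>x. g x \<bullet> i) n x"
    unfolding mollify_def by (rule conv_borel_ext[OF g mollifier_test, symmetric])
  finally show ?thesis .
qed

lemma eventually_cball_subset:
  assumes "compact K" "K \<subseteq> \<Omega>"
  shows "\<forall>\<^sub>F n in sequentially. \<forall>x\<in>K. cball x (inverse (real (Suc n))) \<subseteq> \<Omega>"
proof -
  obtain \<epsilon> where \<epsilon>: "\<epsilon> > 0" "(\<Union>x\<in>K. ball x \<epsilon>) \<subseteq> \<Omega>"
    using compact_subset_open_imp_ball_epsilon_subset[OF assms(1) open_\<Omega> assms(2)] by blast
  have "\<forall>\<^sub>F n in sequentially. inverse (real (Suc n)) < \<epsilon>"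
    by (rule order_tendstoD(2)[OF LIMSEQ_inverse_real_of_nat \<epsilon>(1)])
  then show ?thesis
  proof eventually_elim
    case (elim n)
    show ?case
    proof
      fix x assume "x \<in> K"
      have "cball x (inverse (real (Suc n))) \<subseteq> ball x \<epsilon>"
        using elim unfolding subset_iff mem_cball mem_ball by (metis order_le_less_trans)
      with \<epsilon>(2) \<open>x \<in> K\<close> show "cball x (inverse (real (Suc n))) \<subseteq> \<Omega>" by blast
    qed
  qed
qed

text \<open>Reflected mollifiers are test functions, so at each point of \<open>\<Omega>\<close> the
  mollifications of \<open>f\<close> are eventually 0; along a subsequence they also converge to
  \<open>f\<close> almost everywhere.\<close>

lemma fundamental_lemma:
  assumes f: "f \<in> L2_space \<Omega>" and *: "\<And>\<phi>. \<phi> \<in> test_functions \<Omega> \<Longrightarrow> (LINT x|lebesgue_on \<Omega>. f x * \<phi> x) = 0"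
  shows "AE x in lebesgue_on \<Omega>. f x = 0"
proof -
  have "\<And>n. (\<lambda>x. mollify \<Omega> f n x - f x) \<in> L2_space \<Omega>"
    by (intro L2_space_diff mollify_L2 f)
  from L2_AE_subseq[OF this mollify_L2(2)[OF f]] obtain r where r: "strict_mono r"
    "AE x in lebesgue_on \<Omega>. (\<lambda>n. mollify \<Omega> f (r n) x - f x) \<longlonglongrightarrow> 0" by blast
  have "AE x in lebesgue_on \<Omega>. x \<in> \<Omega>" by (simp add: AE_lebesgue_on_iff)
  with r(2) show ?thesis
  proof eventually_elim
    case (elim x)
    have "\<forall>\<^sub>F n in sequentially. cball x (inverse (real (Suc n))) \<subseteq> \<Omega>"
      using eventually_cball_subset[of "{x}"] elim(2) by simp
    then have "\<forall>\<^sub>F n in sequentially. mollify \<Omega> f n x = 0"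
    proof eventually_elim
      case (elim n)
      show ?case
        using *[OF test_functions_mollifier[OF elim]] conv_borel_ext[OF f mollifier_test, of n x]
        by (simp add: mollify_def)
    qed
    then have "(\<lambda>n. mollify \<Omega> f n x) \<longlonglongrightarrow> 0" by (rule tendsto_eventually)
    from LIMSEQ_subseq_LIMSEQ[OF this r(1)] have "(\<lambda>n. mollify \<Omega> f (r n) x) \<longlonglongrightarrow> 0"
      by (simp add: o_def)
    from tendsto_diff[OF this elim(1)] have "(\<lambda>n. f x) \<longlonglongrightarrow> 0" by simp
    then show ?case using LIMSEQ_unique tendsto_const by blast
  qed
qed

section \<open>Linearity, locality and uniqueness of weak gradients\<close>

lemma has_H1_gradientD:
  assumes "has_H1_gradient \<Omega> u g"
  shows "u \<in> L2_space \<Omega>" "g \<in> L2_space \<Omega>"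
    "\<And>\<phi> i. \<phi> \<in> test_functions \<Omega> \<Longrightarrow> i \<in> Basis \<Longrightarrow>
      (LINT x|lebesgue_on \<Omega>. u x * partial_deriv i \<phi> x) = - (LINT x|lebesgue_on \<Omega>. (g x \<bullet> i) * \<phi> x)"
  using assms by (auto simp: has_H1_gradient_def has_weak_gradient_def)

lemma has_H1_gradient_lincomb:
  assumes "has_H1_gradient \<Omega> u g" "has_H1_gradient \<Omega> v h"
  shows "has_H1_gradient \<Omega> (\<lambda>x. a * u x + b * v x) (\<lambda>x. a *\<^sub>R g x + b *\<^sub>R h x)"
  unfolding has_H1_gradient_def has_weak_gradient_def
proof (intro conjI ballI)
  note u = has_H1_gradientD[OF assms(1)] and v = has_H1_gradientD[OF assms(2)]
  show "(\<lambda>x. a * u x + b * v x) \<in> L2_space \<Omega>" using L2_space_lincomb[OF u(1) v(1)] by simp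
  show "(\<lambda>x. a *\<^sub>R g x + b *\<^sub>R h x) \<in> L2_space \<Omega>" by (rule L2_space_lincomb[OF u(2) v(2)])
  fix \<phi> and i :: 'a assume \<phi>: "\<phi> \<in> test_functions \<Omega>" and i: "i \<in> Basis"
  have \<phi>2: "\<phi> \<in> L2_space \<Omega>" "partial_deriv i \<phi> \<in> L2_space \<Omega>"
    by (rule test_functions_L2 test_functions_partial_deriv \<phi> i)+
  have int: "integrable (lebesgue_on \<Omega>) (\<lambda>x. u x * partial_deriv i \<phi> x)"
    "integrable (lebesgue_on \<Omega>) (\<lambda>x. v x * partial_deriv i \<phi> x)"
    "integrable (lebesgue_on \<Omega>) (\<lambda>x. (g x \<bullet> i) * \<phi> x)"
    "integrable (lebesgue_on \<Omega>) (\<lambda>x. (h x \<bullet> i) * \<phi> x)"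
    using L2_mult_integrable u(1,2) v(1,2) \<phi>2 L2_space_inner_const by blast+
  have "(LINT x|lebesgue_on \<Omega>. (a * u x + b * v x) * partial_deriv i \<phi> x)
      = a * (LINT x|lebesgue_on \<Omega>. u x * partial_deriv i \<phi> x) + b * (LINT x|lebesgue_on \<Omega>. v x * partial_deriv i \<phi> x)"
    using int by (simp add: distrib_right mult.assoc)
  also have "\<dots> = - (a * (LINT x|lebesgue_on \<Omega>. (g x \<bullet> i) * \<phi> x) + b * (LINT x|lebesgue_on \<Omega>. (h x \<bullet> i) * \<phi> x))"
    by (simp add: u(3)[OF \<phi> i] v(3)[OF \<phi> i])
  also have "\<dots> = - (LINT x|lebesgue_on \<Omega>. (a *\<^sub>R g x + b *\<^sub>R h x) \<bullet> i * \<phi> x)"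
    using int by (simp add: distrib_right inner_add_left mult.assoc)
  finally show "(LINT x|lebesgue_on \<Omega>. (a * u x + b * v x) * partial_deriv i \<phi> x) =
      - (LINT x|lebesgue_on \<Omega>. (a *\<^sub>R g x + b *\<^sub>R h x) \<bullet> i * \<phi> x)" .
qed

lemma has_H1_gradient_diff:
  assumes "has_H1_gradient \<Omega> u g" "has_H1_gradient \<Omega> v h"
  shows "has_H1_gradient \<Omega> (\<lambda>x. u x - v x) (\<lambda>x. g x - h x)"
  using has_H1_gradient_lincomb[OF assms, of 1 "-1"] by simp

end

text \<open>A test function of \<open>V\<close> is one of \<open>\<Omega>\<close> whose derivatives
  live where \<open>u\<close> is 0, so the fundamental lemma on \<open>V\<close> applies to each
  component of \<open>g\<close>. Two open sets are in play, hence two interpretations of the locale.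
  With \<open>V\<close> = \<open>\<Omega>\<close> the lemma yields uniqueness; with a compact set
  removed from \<open>\<Omega>\<close> it shows that the gradient is 0 off the support.\<close>

lemma has_H1_gradient_local_eq_0:
  assumes "bounded_open_set \<Omega>" and ug: "has_H1_gradient \<Omega> u g"
    and V: "open V" "V \<subseteq> \<Omega>" "AE x in lebesgue_on \<Omega>. x \<in> V \<longrightarrow> u x = 0"
  shows "AE x in lebesgue_on \<Omega>. x \<in> V \<longrightarrow> g x = 0"
proof -
  interpret bounded_open_set \<Omega> by fact
  interpret V: bounded_open_set V
    using V(1) bounded_subset[OF bounded_\<Omega> V(2)] by unfold_locales
  note u = has_H1_gradientD[OF ug]
  have "AE x in lebesgue_on V. g x \<bullet> i = 0" if i: "i \<in> Basis" for i
  proof (rule V.fundamental_lemma)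
    have gi: "(\<lambda>x. g x \<bullet> i) \<in> L2_space \<Omega>" by (rule L2_space_inner_const[OF u(2)])
    have VM: "V \<in> sets (lebesgue_on \<Omega>)"
      using V(2) V.\<Omega>_sets by (simp add: sets_restrict_space_iff \<Omega>_sets)
    have rr: "lebesgue_on V = restrict_space (lebesgue_on \<Omega>) V"
      using V(2) by (simp add: restrict_restrict_space \<Omega>_sets V.\<Omega>_sets Int_absorb1)
    have VM': "V \<inter> space (lebesgue_on \<Omega>) \<in> sets (lebesgue_on \<Omega>)" using VM V(2) by (simp add: Int_absorb2)
    show "(\<lambda>x. g x \<bullet> i) \<in> L2_space V"
      using integrable_mult_indicator[OF VM L2_space_real_integrable[OF gi]]
        measurable_restrict_space1[OF L2_spaceD(1)[OF gi], of V]
      unfolding L2_space_def rr by (simp add: integrable_restrict_space VM Int_absorb2[OF V(2)])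
    fix \<phi> assume \<phi>V: "\<phi> \<in> test_functions V"
    then have \<phi>: "\<phi> \<in> test_functions \<Omega>" using test_functions_mono[OF V(2)] by blast
    obtain K where K: "compact K" "K \<subseteq> V" "\<And>x. x \<notin> K \<Longrightarrow> \<phi> x = 0"
      using \<phi>V unfolding test_functions_iff by blast
    have "(LINT x|lebesgue_on V. (g x \<bullet> i) * \<phi> x) = (LINT x|lebesgue_on \<Omega>. indicator V x *\<^sub>R ((g x \<bullet> i) * \<phi> x))"
      unfolding rr by (rule integral_restrict_space[OF VM'])
    also have "(\<lambda>x. indicator V x *\<^sub>R ((g x \<bullet> i) * \<phi> x)) = (\<lambda>x. (g x \<bullet> i) * \<phi> x)"
      using K(2,3) by (auto simp: fun_eq_iff indicator_def)
    also have "(LINT x|lebesgue_on \<Omega>. (g x \<bullet> i) * \<phi> x) = - (LINT x|lebesgue_on \<Omega>. u x * partial_deriv i \<phi> x)"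
      using u(3)[OF \<phi> i] by simp
    also have "(LINT x|lebesgue_on \<Omega>. u x * partial_deriv i \<phi> x) = 0"
    proof (rule integral_eq_zero_AE)
      show "AE x in lebesgue_on \<Omega>. u x * partial_deriv i \<phi> x = 0"
        using V(3)
      proof eventually_elim
        case (elim x)
        then show ?case
          using partial_deriv_eq_0[where x=x and i=i, OF K(1,3)] K(2) by (cases "x \<in> K") auto
      qed
    qed
    finally show "(LINT x|lebesgue_on V. (g x \<bullet> i) * \<phi> x) = 0" by simp
  qed
  then have "AE x in lebesgue_on V. \<forall>i\<in>Basis. g x \<bullet> i = 0"
    by (intro AE_finite_allI) auto
  then have "AE x in lebesgue_on V. g x = 0"
    by eventually_elim (simp add: euclidean_all_zero_iff)
  then have "AE x in lborel. x \<in> V \<longrightarrow> g x = 0"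
    by (simp add: V.AE_lebesgue_on_iff)
  then have "AE x in lborel. x \<in> \<Omega> \<longrightarrow> x \<in> V \<longrightarrow> g x = 0" by eventually_elim simp
  then show ?thesis by (simp add: AE_lebesgue_on_iff)
qed

context bounded_open_set
begin

lemma has_H1_gradient_unique:
  assumes "has_H1_gradient \<Omega> u g" "has_H1_gradient \<Omega> v h" "AE x in lebesgue_on \<Omega>. u x = v x"
  shows "AE x in lebesgue_on \<Omega>. g x = h x"
proof -
  have "AE x in lebesgue_on \<Omega>. x \<in> \<Omega> \<longrightarrow> u x - v x = 0"
    using assms(3) by eventually_elim simp
  from has_H1_gradient_local_eq_0[OF bounded_open_set_axioms has_H1_gradient_diff[OF assms(1,2)] open_\<Omega> order_refl this]
  have "AE x in lebesgue_on \<Omega>. x \<in> \<Omega> \<longrightarrow> g x - h x = 0" .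
  then show ?thesis unfolding AE_lebesgue_on_iff by eventually_elim simp
qed

end

section \<open>Chain rule and positive part\<close>

context bounded_open_set
begin

text \<open>For the mollified functions the identity is the classical product and chain rule,
  integrated by parts; what remains is the limit. On the left the Lipschitz bound of
  \<open>F\<close> suffices. On the right \<open>F'\<close> is merely continuous, so almost
  everywhere convergence along a subsequence is used. \<open>F 0 = 0\<close> turns the Lipschitz
  bound into |F t| <= |t|, hence square integrability.\<close>

lemma has_H1_gradient_chain:
  assumes ug: "has_H1_gradient \<Omega> u g"
    and F: "\<And>t. (F has_real_derivative F' t) (at t)" and F'c: "continuous_on UNIV F'"
    and F'1: "\<And>t. \<bar>F' t\<bar> \<le> 1" and F0: "F 0 = 0"
  shows "has_H1_gradient \<Omega> (\<lambda>x. F (u x)) (\<lambda>x. F' (u x) *\<^sub>R g x)"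
  unfolding has_H1_gradient_def has_weak_gradient_def
proof (intro conjI ballI)
  note u = has_H1_gradientD[OF ug]
  have lip: "\<bar>F s - F t\<bar> \<le> \<bar>s - t\<bar>" for s t
  proof -
    have *: "\<bar>F b - F a\<bar> \<le> \<bar>b - a\<bar>" if "a < b" for a b
    proof -
      obtain z where "F b - F a = (b - a) * F' z" using MVT2[OF \<open>a < b\<close> F] by blast
      then show ?thesis using F'1[of z] by (simp add: abs_mult mult_left_le)
    qed
    show ?thesis
      using *[of s t] *[of t s] by (cases s t rule: linorder_cases) (auto simp: abs_minus_commute)
  qed
  have Fc: "continuous_on UNIV F"
    using F by (auto intro!: continuous_at_imp_continuous_on DERIV_isCont)
  have [measurable]: "F \<in> borel_measurable borel" "F' \<in> borel_measurable borel"
    using Fc F'c by (auto intro: borel_measurable_continuous_onI)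
  have [measurable]: "u \<in> borel_measurable (lebesgue_on \<Omega>)" "g \<in> borel_measurable (lebesgue_on \<Omega>)"
    using L2_spaceD(1) u(1,2) by blast+
  show Fu: "(\<lambda>x. F (u x)) \<in> L2_space \<Omega>"
  proof (rule L2_space_bound)
    show "integrable (lebesgue_on \<Omega>) (\<lambda>x. (u x)\<^sup>2)" by (rule L2_space_real_integrable[OF u(1)])
    show "(norm (F (u x)))\<^sup>2 \<le> (u x)\<^sup>2" for x
      using lip[of "u x" 0] F0 by (simp add: abs_le_square_iff)
  qed measurable
  show "(\<lambda>x. F' (u x) *\<^sub>R g x) \<in> L2_space \<Omega>"
    by (rule L2_space_scale_bounded[OF u(2) _ F'1]) measurable
  fix \<phi> and i :: 'a assume \<phi>: "\<phi> \<in> test_functions \<Omega>" and i: "i \<in> Basis"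
  have \<phi>2: "\<phi> \<in> L2_space \<Omega>" "partial_deriv i \<phi> \<in> L2_space \<Omega>"
    by (rule test_functions_L2 test_functions_partial_deriv \<phi> i)+
  have sm: "smooth \<phi>" using \<phi> test_functions_iff by blast
  obtain K where K: "compact K" "K \<subseteq> \<Omega>" "\<And>x. x \<notin> K \<Longrightarrow> \<phi> x = 0"
    using \<phi> unfolding test_functions_iff by blast
  have K': "partial_deriv i \<phi> x = 0" if "x \<notin> K" for x
    by (rule partial_deriv_eq_0[OF K(1,3) that])
  have nK: "x \<notin> K" if "x \<notin> \<Omega>" for x using that K(2) by blast
  have [measurable]: "\<phi> \<in> borel_measurable (lebesgue_on \<Omega>)" "partial_deriv i \<phi> \<in> borel_measurable (lebesgue_on \<Omega>)"
    using L2_spaceD(1) \<phi>2 by blast+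
  obtain B where B: "B > 0" "\<And>x. \<bar>\<phi> x\<bar> \<le> B" using test_functions_bounded[OF \<phi>] by blast
  have gi: "(\<lambda>x. g x \<bullet> i) \<in> L2_space \<Omega>" by (rule L2_space_inner_const[OF u(2)])
  let ?U = "mollify \<Omega> u" and ?G = "mollify \<Omega> (\<lambda>x. g x \<bullet> i)"
  have smU: "smooth (?U n)" "smooth (?G n)" for n by (rule smooth_mollify[OF u(1)] smooth_mollify[OF gi])+
  note contU = smooth_continuous_on[OF smU(1)] smooth_continuous_on[OF smU(2)] smooth_continuous_on[OF sm]
    smooth_continuous_on[OF smooth_partial_deriv[OF sm i]] smooth_continuous_on[OF smooth_partial_deriv[OF smU(1) i]]
    continuous_on_compose2[OF Fc] continuous_on_compose2[OF F'c]
  have [measurable]: "?U n \<in> borel_measurable (lebesgue_on \<Omega>)" "?G n \<in> borel_measurable (lebesgue_on \<Omega>)" for n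
    by (intro borel_measurable_lebesgue_on smooth_borel_measurable smU)+
  have dU: "(\<lambda>x. ?U n x - u x) \<in> L2_space \<Omega>" and dG: "(\<lambda>x. ?G n x - g x \<bullet> i) \<in> L2_space \<Omega>" for n
    by (intro L2_space_diff mollify_L2 u gi)+
  obtain r where r: "strict_mono r" "AE x in lebesgue_on \<Omega>. (\<lambda>n. ?U (r n) x - u x) \<longlonglongrightarrow> 0"
    using L2_AE_subseq[OF dU mollify_L2(2)[OF u(1)]] by blast

  define A where "A n = (LINT x|lebesgue_on \<Omega>. F (?U n x) * partial_deriv i \<phi> x)" for n
  define C where "C n = (LINT x|lebesgue_on \<Omega>. F' (?U n x) * ?G n x * \<phi> x)" for n
  \<comment> \<open>Only for large \<open>n\<close>: the derivative of the mollification is the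
    mollified gradient where the ball of radius 1 / (n + 1) stays in \<open>\<Omega>\<close>, and
    eventually this is so at all points of the compact set \<open>K\<close> carrying
    \<open>\<phi>\<close>.\<close>
  have "\<forall>\<^sub>F n in sequentially. A n = - C n"
    using eventually_cball_subset[OF K(1,2)]
  proof eventually_elim
    case (elim n)
    have pd: "partial_deriv i (?U n) x * \<phi> x = ?G n x * \<phi> x" for x
      using partial_deriv_mollify[OF ug i, of x n] elim K(3) by (cases "x \<in> K") auto
    let ?D = "\<lambda>x v. F (?U n x) * frechet_derivative \<phi> (at x) v + F' (?U n x) * frechet_derivative (?U n) (at x) v * \<phi> x"
    have D: "((\<lambda>x. F (?U n x) * \<phi> x) has_derivative ?D x) (at x)" for x
      by (rule has_derivative_mult[OF has_derivative_compose[OF smooth_has_derivative[OF smU(1)]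
            F[unfolded has_field_derivative_def]] smooth_has_derivative[OF sm]])
    have eq: "?D x i = F (?U n x) * partial_deriv i \<phi> x + F' (?U n x) * ?G n x * \<phi> x" for x
      using pd[of x] by (simp add: mult.assoc)
    have i1: "integrable lborel (\<lambda>x. F (?U n x) * partial_deriv i \<phi> x)"
      by (rule integrable_continuous_compact_support[OF _ K(1)]) (auto simp: K' intro!: continuous_intros contU)
    have i2: "integrable lborel (\<lambda>x. F' (?U n x) * ?G n x * \<phi> x)"
      by (rule integrable_continuous_compact_support[OF _ K(1)]) (auto simp: K intro!: continuous_intros contU)
    have "(LINT x|lborel. ?D x i) = 0"
      by (rule integral_by_parts_compact_support[OF D _ K(1)])
        (auto simp: K eq intro!: continuous_intros contU)
    then have "(LINT x|lborel. F (?U n x) * partial_deriv i \<phi> x) = - (LINT x|lborel. F' (?U n x) * ?G n x * \<phi> x)"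
      unfolding eq using i1 i2 by simp
    moreover have "A n = (LINT x|lborel. F (?U n x) * partial_deriv i \<phi> x)"
      unfolding A_def using i1 by (intro lebesgue_on_eq_lborel(1)) (auto simp: K' nK)
    moreover have "C n = (LINT x|lborel. F' (?U n x) * ?G n x * \<phi> x)"
      unfolding C_def using i2 by (intro lebesgue_on_eq_lborel(1)) (auto simp: K(3) nK)
    ultimately show ?case by simp
  qed
  then have AC: "\<forall>\<^sub>F n in sequentially. A (r n) = - C (r n)"
    using r(1) by (rule eventually_subseq[rotated])

  define A' where "A' = (LINT x|lebesgue_on \<Omega>. F (u x) * partial_deriv i \<phi> x)"
  define C' where "C' = (LINT x|lebesgue_on \<Omega>. F' (u x) * (g x \<bullet> i) * \<phi> x)"
  have FU: "(\<lambda>x. F (?U n x)) \<in> L2_space \<Omega>" for n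
  proof (rule L2_space_bound)
    show "integrable (lebesgue_on \<Omega>) (\<lambda>x. (?U n x)\<^sup>2)" by (rule L2_space_real_integrable[OF mollify_L2(1)[OF u(1)]])
    show "(norm (F (?U n x)))\<^sup>2 \<le> (?U n x)\<^sup>2" for x
      using lip[of "?U n x" 0] F0 by (simp add: abs_le_square_iff)
  qed measurable
  have "(\<lambda>n. LINT x|lebesgue_on \<Omega>. (F (?U n x) - F (u x)) * partial_deriv i \<phi> x) \<longlonglongrightarrow> 0"
    by (rule L2_pairing_tendsto_0[OF dU \<phi>2(2) mollify_L2(2)[OF u(1)]])
      (measurable, simp add: abs_mult lip mult_right_mono)
  moreover have "(LINT x|lebesgue_on \<Omega>. (F (?U n x) - F (u x)) * partial_deriv i \<phi> x) = A n - A'" for n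
    using L2_mult_integrable[OF FU \<phi>2(2)] L2_mult_integrable[OF Fu \<phi>2(2)]
    by (simp add: A_def A'_def left_diff_distrib)
  ultimately have "A \<longlonglongrightarrow> A'" by (simp add: LIM_zero_iff)
  then have Alim: "(\<lambda>n. A (r n)) \<longlonglongrightarrow> A'"
    using LIMSEQ_subseq_LIMSEQ[OF _ r(1)] by (simp add: o_def)

  \<comment> \<open>Mean and pointwise convergence are separated: first the gradient error with a
    bounded factor, then \<open>F'\<close> of the mollifications against the fixed integrable
    function \<open>(g x \<bullet> i) * \<phi> x\<close>.\<close>
  have C1: "(\<lambda>n. LINT x|lebesgue_on \<Omega>. F' (?U n x) * (?G n x - g x \<bullet> i) * \<phi> x) \<longlonglongrightarrow> 0"
  proof (rule L2_pairing_tendsto_0[OF dG \<phi>2(1) mollify_L2(2)[OF gi]])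
    show "\<bar>F' (?U n x) * (?G n x - g x \<bullet> i) * \<phi> x\<bar> \<le> \<bar>(?G n x - g x \<bullet> i) * \<phi> x\<bar>" for n x
      using mult_right_mono[OF F'1[of "?U n x"], of "\<bar>(?G n x - g x \<bullet> i) * \<phi> x\<bar>"]
      by (simp add: abs_mult mult.assoc)
  qed measurable
  have g\<phi>: "integrable (lebesgue_on \<Omega>) (\<lambda>x. (g x \<bullet> i) * \<phi> x)" by (rule L2_mult_integrable[OF gi \<phi>2(1)])
  have "(\<lambda>n. LINT x|lebesgue_on \<Omega>. F' (?U (r n) x) * ((g x \<bullet> i) * \<phi> x)) \<longlonglongrightarrow> (LINT x|lebesgue_on \<Omega>. F' (u x) * ((g x \<bullet> i) * \<phi> x))"
  proof (rule integral_dominated_convergence[where w="\<lambda>x. \<bar>(g x \<bullet> i) * \<phi> x\<bar>"])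
    show "AE x in lebesgue_on \<Omega>. (\<lambda>n. F' (?U (r n) x) * ((g x \<bullet> i) * \<phi> x)) \<longlonglongrightarrow> F' (u x) * ((g x \<bullet> i) * \<phi> x)"
      using r(2)
    proof eventually_elim
      case (elim x)
      then have "(\<lambda>n. ?U (r n) x) \<longlonglongrightarrow> u x" by (simp add: LIM_zero_iff)
      moreover have "isCont F' (u x)" using F'c by (simp add: continuous_on_eq_continuous_at)
      ultimately have "(\<lambda>n. F' (?U (r n) x)) \<longlonglongrightarrow> F' (u x)"
        by (rule isCont_tendsto_compose[rotated])
      then show ?case by (rule tendsto_mult_right)
    qed
    show "AE x in lebesgue_on \<Omega>. norm (F' (?U (r n) x) * ((g x \<bullet> i) * \<phi> x)) \<le> \<bar>(g x \<bullet> i) * \<phi> x\<bar>" for n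
      using mult_right_mono[OF F'1, of "\<bar>(g _ \<bullet> i) * \<phi> _\<bar>"] by (intro AE_I2) (simp add: abs_mult)
    show "integrable (lebesgue_on \<Omega>) (\<lambda>x. \<bar>(g x \<bullet> i) * \<phi> x\<bar>)" by (rule integrable_abs[OF g\<phi>])
  qed measurable
  moreover have "(LINT x|lebesgue_on \<Omega>. F' (?U (r n) x) * ((g x \<bullet> i) * \<phi> x))
      = C (r n) - (LINT x|lebesgue_on \<Omega>. F' (?U (r n) x) * (?G (r n) x - g x \<bullet> i) * \<phi> x)" for n
  proof -
    have "integrable (lebesgue_on \<Omega>) (\<lambda>x. ((g x \<bullet> i) * \<phi> x) * F' (?U (r n) x))"
      "integrable (lebesgue_on \<Omega>) (\<lambda>x. (?G (r n) x * \<phi> x) * F' (?U (r n) x))"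
      by (rule integrable_mult_bounded[OF _ _ F'1]; (intro L2_mult_integrable mollify_L2 gi \<phi>2)?; measurable)+
    then show ?thesis
      unfolding C_def by (subst Bochner_Integration.integral_diff[symmetric]) (simp_all add: algebra_simps)
  qed
  ultimately have "(\<lambda>n. C (r n) - (LINT x|lebesgue_on \<Omega>. F' (?U (r n) x) * (?G (r n) x - g x \<bullet> i) * \<phi> x)) \<longlonglongrightarrow> C'"
    by (simp add: C'_def mult.assoc)
  from tendsto_add[OF this LIMSEQ_subseq_LIMSEQ[OF C1 r(1)]] have "(\<lambda>n. C (r n)) \<longlonglongrightarrow> C'"
    by (simp add: o_def)
  then have "(\<lambda>n. A (r n)) \<longlonglongrightarrow> - C'"
    using AC by (intro Lim_transform_eventually[OF tendsto_minus]) (auto elim: eventually_mono)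
  from LIMSEQ_unique[OF Alim this]
  show "(LINT x|lebesgue_on \<Omega>. F (u x) * partial_deriv i \<phi> x) = - (LINT x|lebesgue_on \<Omega>. (F' (u x) *\<^sub>R g x) \<bullet> i * \<phi> x)"
    by (simp add: A'_def C'_def)
qed

text \<open>The positive part is the limit of the \<open>C\<^sup>1\<close> functions \<open>\<surd>(max t 0\<^sup>2 + \<delta>\<^sup>2) - \<delta>\<close>.\<close>

lemma has_H1_gradient_pos_part:
  assumes ug: "has_H1_gradient \<Omega> u g"
  shows "has_H1_gradient \<Omega> (\<lambda>x. max (u x) 0) (\<lambda>x. indicator {0<..} (u x) *\<^sub>R g x)"
  unfolding has_H1_gradient_def has_weak_gradient_def
proof (intro conjI ballI)
  note u = has_H1_gradientD[OF ug]
  have [measurable]: "u \<in> borel_measurable (lebesgue_on \<Omega>)" "g \<in> borel_measurable (lebesgue_on \<Omega>)"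
    using L2_spaceD(1) u(1,2) by blast+
  show "(\<lambda>x. max (u x) 0) \<in> L2_space \<Omega>"
  proof (rule L2_space_bound)
    show "integrable (lebesgue_on \<Omega>) (\<lambda>x. (u x)\<^sup>2)" by (rule L2_space_real_integrable[OF u(1)])
    show "(norm (max (u x) 0))\<^sup>2 \<le> (u x)\<^sup>2" for x
      by (auto simp: max_def)
  qed measurable
  show "(\<lambda>x. indicator {0<..} (u x) *\<^sub>R g x) \<in> L2_space \<Omega>"
  proof (rule L2_space_scale_bounded[OF u(2), of _ 1])
    have "(indicator {0<..} :: real \<Rightarrow> real) \<in> borel_measurable borel" by measurable
    then show "(\<lambda>x. indicator {0<..} (u x) :: real) \<in> borel_measurable (lebesgue_on \<Omega>)"
      by (rule measurable_compose[rotated]) measurable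
  qed (simp add: indicator_def)
  define \<delta> where "\<delta> n = inverse (real (Suc n))" for n
  have \<delta>: "\<delta> n > 0" for n by (simp add: \<delta>_def)
  have \<delta>0: "\<delta> \<longlonglongrightarrow> 0" unfolding \<delta>_def by (rule LIMSEQ_inverse_real_of_nat)
  define F where "F n t = sqrt ((max t 0)\<^sup>2 + (\<delta> n)\<^sup>2) - \<delta> n" for n and t :: real
  define F' where "F' n t = max t 0 / sqrt ((max t 0)\<^sup>2 + (\<delta> n)\<^sup>2)" for n and t :: real
  have pos: "(max t 0)\<^sup>2 + (\<delta> n)\<^sup>2 > 0" for t n
    using \<delta>[of n] by (simp add: add_nonneg_pos)
  \<comment> \<open>Squaring removes the kink: at 0 the difference quotient of the squared positive
    part is \<open>max h 0\<close>, which tends to 0. This is why \<open>F n\<close> is built from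
    the square.\<close>
  have max_sq: "((\<lambda>t. (max t 0)\<^sup>2) has_real_derivative 2 * max t 0) (at t)" for t :: real
  proof -
    consider "t > 0" | "t < 0" | "t = 0" by linarith
    then show ?thesis
    proof cases
      case 1
      show ?thesis
      proof (rule has_field_derivative_transform_within_open[of "\<lambda>t. t\<^sup>2" _ _ "{0<..}"])
        show "((\<lambda>t. t\<^sup>2) has_real_derivative 2 * max t 0) (at t)"
          using 1 by (auto intro!: derivative_eq_intros)
      qed (use 1 in auto)
    next
      case 2
      show ?thesis
        by (rule has_field_derivative_transform_within_open[of "\<lambda>t. 0" _ _ "{..<0}"]) (use 2 in auto)
    next
      case 3
      have "(\<lambda>h. ((max (t + h) 0)\<^sup>2 - (max t 0)\<^sup>2) / h) = (\<lambda>h. max h 0)"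
        using 3 by (auto simp: fun_eq_iff max_def power2_eq_square)
      moreover have "((\<lambda>h::real. max h 0) \<longlongrightarrow> max 0 0) (at 0)" by (intro tendsto_intros)
      ultimately show ?thesis using 3 by (simp add: DERIV_def)
    qed
  qed
  have FD: "(F n has_real_derivative F' n t) (at t)" for n t
  proof -
    have "((\<lambda>t. (max t 0)\<^sup>2 + (\<delta> n)\<^sup>2) has_real_derivative 2 * max t 0 + 0) (at t)"
      by (intro DERIV_add max_sq DERIV_const)
    from DERIV_chain2[OF DERIV_real_sqrt[OF pos] this]
    have "((\<lambda>t. sqrt ((max t 0)\<^sup>2 + (\<delta> n)\<^sup>2)) has_real_derivative F' n t) (at t)"
      by (simp add: F'_def field_simps)
    from DERIV_diff[OF this DERIV_const[of "\<delta> n"]] show ?thesis by (simp add: F_def[abs_def])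
  qed
  have F'c: "continuous_on UNIV (F' n)" for n
    unfolding F'_def[abs_def] using pos[of _ n] by (intro continuous_intros) (auto simp: less_imp_neq[symmetric])
  have F'1: "\<bar>F' n t\<bar> \<le> 1" for n t
  proof -
    have "max t 0 \<le> sqrt ((max t 0)\<^sup>2 + (\<delta> n)\<^sup>2)" by (rule real_le_rsqrt) simp
    then show ?thesis using pos[of t n] by (simp add: F'_def)
  qed
  have F0: "F n 0 = 0" for n using \<delta>[of n] by (simp add: F_def)
  have Fle: "\<bar>F n t\<bar> \<le> \<bar>t\<bar>" for n t
  proof -
    have "sqrt ((max t 0)\<^sup>2 + (\<delta> n)\<^sup>2) \<le> max t 0 + \<delta> n"
      using \<delta>[of n] by (intro real_le_lsqrt) (auto simp: power2_sum)
    moreover have "\<delta> n \<le> sqrt ((max t 0)\<^sup>2 + (\<delta> n)\<^sup>2)" by (rule real_le_rsqrt) simp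
    ultimately show ?thesis unfolding F_def by auto
  qed
  have Flim: "(\<lambda>n. F n t) \<longlonglongrightarrow> max t 0" for t
  proof -
    have "(\<lambda>n. F n t) \<longlonglongrightarrow> sqrt ((max t 0)\<^sup>2 + 0\<^sup>2) - 0"
      unfolding F_def by (intro tendsto_intros \<delta>0)
    then show ?thesis by simp
  qed
  \<comment> \<open>The limit is 0 at \<open>t = 0\<close> because every \<open>F' n 0\<close> is 0.
    Hence the gradient of the positive part comes out as 0 on the zero set of \<open>u\<close>,
    which \<open>has_H1_gradient_zero_set\<close> exploits.\<close>
  have F'lim: "(\<lambda>n. F' n t) \<longlonglongrightarrow> indicator {0<..} t" for t
  proof (cases "t > 0")
    case True
    have "(\<lambda>n. F' n t) \<longlonglongrightarrow> max t 0 / sqrt ((max t 0)\<^sup>2 + 0\<^sup>2)"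
      unfolding F'_def using True by (intro tendsto_intros \<delta>0) simp
    with True show ?thesis by simp
  qed (simp add: F'_def)
  have [measurable]: "F n \<in> borel_measurable borel" "F' n \<in> borel_measurable borel" for n
    unfolding F_def[abs_def] F'_def[abs_def] by measurable
  fix \<phi> and i :: 'a assume \<phi>: "\<phi> \<in> test_functions \<Omega>" and i: "i \<in> Basis"
  have \<phi>2: "\<phi> \<in> L2_space \<Omega>" "partial_deriv i \<phi> \<in> L2_space \<Omega>"
    by (rule test_functions_L2 test_functions_partial_deriv \<phi> i)+
  have [measurable]: "\<phi> \<in> borel_measurable (lebesgue_on \<Omega>)" "partial_deriv i \<phi> \<in> borel_measurable (lebesgue_on \<Omega>)"
    using L2_spaceD(1) \<phi>2 by blast+
  have l1: "(\<lambda>n. LINT x|lebesgue_on \<Omega>. F n (u x) * partial_deriv i \<phi> x)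
      \<longlonglongrightarrow> (LINT x|lebesgue_on \<Omega>. max (u x) 0 * partial_deriv i \<phi> x)"
  proof (rule integral_dominated_convergence[where w="\<lambda>x. \<bar>u x * partial_deriv i \<phi> x\<bar>"])
    show "integrable (lebesgue_on \<Omega>) (\<lambda>x. \<bar>u x * partial_deriv i \<phi> x\<bar>)"
      by (intro integrable_abs L2_mult_integrable u \<phi>2)
    show "AE x in lebesgue_on \<Omega>. norm (F n (u x) * partial_deriv i \<phi> x) \<le> \<bar>u x * partial_deriv i \<phi> x\<bar>" for n
      by (intro AE_I2) (simp add: abs_mult Fle mult_right_mono)
    show "AE x in lebesgue_on \<Omega>. (\<lambda>n. F n (u x) * partial_deriv i \<phi> x) \<longlonglongrightarrow> max (u x) 0 * partial_deriv i \<phi> x"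
      by (intro AE_I2 tendsto_mult_right Flim)
  qed measurable
  have l2: "(\<lambda>n. LINT x|lebesgue_on \<Omega>. F' n (u x) * ((g x \<bullet> i) * \<phi> x))
      \<longlonglongrightarrow> (LINT x|lebesgue_on \<Omega>. indicator {0<..} (u x) * ((g x \<bullet> i) * \<phi> x))"
  proof (rule integral_dominated_convergence[where w="\<lambda>x. \<bar>(g x \<bullet> i) * \<phi> x\<bar>"])
    show "integrable (lebesgue_on \<Omega>) (\<lambda>x. \<bar>(g x \<bullet> i) * \<phi> x\<bar>)"
      by (intro integrable_abs L2_mult_integrable L2_space_inner_const u \<phi>2)
    show "AE x in lebesgue_on \<Omega>. norm (F' n (u x) * ((g x \<bullet> i) * \<phi> x)) \<le> \<bar>(g x \<bullet> i) * \<phi> x\<bar>" for n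
      using mult_right_mono[OF F'1, of "\<bar>(g _ \<bullet> i) * \<phi> _\<bar>"] by (intro AE_I2) (simp add: abs_mult)
    show "AE x in lebesgue_on \<Omega>. (\<lambda>n. F' n (u x) * ((g x \<bullet> i) * \<phi> x)) \<longlonglongrightarrow> indicator {0<..} (u x) * ((g x \<bullet> i) * \<phi> x)"
      by (intro AE_I2 tendsto_mult_right F'lim)
  qed measurable
  have eq: "(LINT x|lebesgue_on \<Omega>. F n (u x) * partial_deriv i \<phi> x)
      = - (LINT x|lebesgue_on \<Omega>. F' n (u x) * ((g x \<bullet> i) * \<phi> x))" for n
    using has_H1_gradientD(3)[OF has_H1_gradient_chain[OF ug FD F'c F'1 F0] \<phi> i] by (simp add: mult.assoc)
  from LIMSEQ_unique[OF l1[unfolded eq] tendsto_minus[OF l2]]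
  show "(LINT x|lebesgue_on \<Omega>. max (u x) 0 * partial_deriv i \<phi> x)
      = - (LINT x|lebesgue_on \<Omega>. (indicator {0<..} (u x) *\<^sub>R g x) \<bullet> i * \<phi> x)"
    by (simp add: mult.assoc)
qed

text \<open>Writing \<open>u\<close> as the difference of the positive parts of \<open>u\<close> and
  \<open>- u\<close> produces a second gradient of \<open>u\<close>, whose indicators exclude the
  value 0. By uniqueness it agrees with \<open>g\<close> almost everywhere.\<close>

lemma has_H1_gradient_zero_set:
  assumes ug: "has_H1_gradient \<Omega> u g"
  shows "AE x in lebesgue_on \<Omega>. u x = 0 \<longrightarrow> g x = 0"
proof -
  have "has_H1_gradient \<Omega> (\<lambda>x. - u x) (\<lambda>x. - g x)"
    using has_H1_gradient_lincomb[OF ug ug, of "-1" 0] by simp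
  note gd = has_H1_gradient_diff[OF has_H1_gradient_pos_part[OF ug] has_H1_gradient_pos_part[OF this]]
  have "AE x in lebesgue_on \<Omega>. max (u x) 0 - max (- u x) 0 = u x"
    by (intro AE_I2) (simp add: max_def)
  from has_H1_gradient_unique[OF gd ug this] show ?thesis
  proof eventually_elim
    case (elim x)
    show ?case
    proof
      assume "u x = 0"
      with elim show "g x = 0" by simp
    qed
  qed
qed

end

section \<open>The space \<open>H\<^sup>1\<^sub>0\<close>\<close>

definition classical_grad :: "('a::euclidean_space \<Rightarrow> real) \<Rightarrow> 'a \<Rightarrow> 'a" where
  "classical_grad \<phi> x = (\<Sum>i\<in>Basis. partial_deriv i \<phi> x *\<^sub>R i)"

lemma classical_grad_inner: "i \<in> Basis \<Longrightarrow> classical_grad \<phi> x \<bullet> i = partial_deriv i \<phi> x"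
  unfolding classical_grad_def by (rule inner_sum_left_Basis)

lemma norm_square_Basis: "(norm (x::'a::euclidean_space))\<^sup>2 = (\<Sum>i\<in>Basis. (x \<bullet> i)\<^sup>2)"
  by (subst power2_norm_eq_inner, subst euclidean_inner) (simp add: power2_eq_square)

lemma classical_grad_lincomb:
  assumes "smooth f" "smooth g"
  shows "classical_grad (\<lambda>x. a * f x + b * g x) x = a *\<^sub>R classical_grad f x + b *\<^sub>R classical_grad g x"
  unfolding classical_grad_def
  using fun_cong[OF smooth_lincomb(2)[OF assms], where x=x]
  by (simp add: scaleR_add_left sum.distrib scaleR_sum_right)

text \<open>The squared H1 norm with the gradient as an argument, so that approximation estimates
  refer to explicit representatives and avoid roots.\<close>

definition H1_square :: "'a::euclidean_space set \<Rightarrow> ('a \<Rightarrow> real) \<Rightarrow> ('a \<Rightarrow> 'a) \<Rightarrow> real" where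
  "H1_square \<Omega> u g = (LINT x|lebesgue_on \<Omega>. (u x)\<^sup>2) + (LINT x|lebesgue_on \<Omega>. (norm (g x))\<^sup>2)"

lemma H1_square_nonneg: "H1_square \<Omega> u g \<ge> 0"
  by (simp add: H1_square_def)

lemma L2_norm_square: "(L2_norm \<Omega> f)\<^sup>2 = (LINT x|lebesgue_on \<Omega>. (norm (f x))\<^sup>2)"
  by (simp add: L2_norm_def)

lemma L2_norm_cong_AE:
  assumes "f \<in> L2_space \<Omega>" "g \<in> L2_space \<Omega>" "AE x in lebesgue_on \<Omega>. f x = g x"
  shows "L2_norm \<Omega> f = L2_norm \<Omega> g"
proof -
  have "(LINT x|lebesgue_on \<Omega>. (norm (f x))\<^sup>2) = (LINT x|lebesgue_on \<Omega>. (norm (g x))\<^sup>2)"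
  proof (rule integral_cong_AE)
    show "AE x in lebesgue_on \<Omega>. (norm (f x))\<^sup>2 = (norm (g x))\<^sup>2"
      using assms(3) by eventually_elim simp
  qed (use L2_spaceD(2)[OF assms(1)] L2_spaceD(2)[OF assms(2)] in auto)
  then show ?thesis by (simp add: L2_norm_def)
qed

lemma H1_space_iff: "u \<in> H1_space \<Omega> \<longleftrightarrow> (\<exists>g. has_H1_gradient \<Omega> u g)"
  by (auto simp: H1_space_def has_H1_gradient_def)

lemma weak_grad_works: "u \<in> H1_space \<Omega> \<Longrightarrow> has_H1_gradient \<Omega> u (weak_grad \<Omega> u)"
  using someI_ex[of "\<lambda>g. g \<in> L2_space \<Omega> \<and> has_weak_gradient \<Omega> u g"]
  by (auto simp: H1_space_def has_H1_gradient_def weak_grad_def)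

lemma H1_square_lincomb_le:
  assumes "has_H1_gradient \<Omega> u g" "has_H1_gradient \<Omega> v h"
  shows "H1_square \<Omega> (\<lambda>x. a * u x + b * v x) (\<lambda>x. a *\<^sub>R g x + b *\<^sub>R h x)
    \<le> 2 * a\<^sup>2 * H1_square \<Omega> u g + 2 * b\<^sup>2 * H1_square \<Omega> v h"
proof -
  have *: "(LINT x|lebesgue_on \<Omega>. (norm (a *\<^sub>R f x + b *\<^sub>R k x))\<^sup>2)
      \<le> 2 * a\<^sup>2 * (LINT x|lebesgue_on \<Omega>. (norm (f x))\<^sup>2) + 2 * b\<^sup>2 * (LINT x|lebesgue_on \<Omega>. (norm (k x))\<^sup>2)"
    if "f \<in> L2_space \<Omega>" "k \<in> L2_space \<Omega>" for f k :: "'a \<Rightarrow> 'c::euclidean_space"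
  proof -
    have "(LINT x|lebesgue_on \<Omega>. (norm (a *\<^sub>R f x + b *\<^sub>R k x))\<^sup>2)
        \<le> (LINT x|lebesgue_on \<Omega>. 2 * a\<^sup>2 * (norm (f x))\<^sup>2 + 2 * b\<^sup>2 * (norm (k x))\<^sup>2)"
    proof (rule integral_mono)
      show "integrable (lebesgue_on \<Omega>) (\<lambda>x. (norm (a *\<^sub>R f x + b *\<^sub>R k x))\<^sup>2)"
        by (intro L2_spaceD L2_space_lincomb that)
      show "integrable (lebesgue_on \<Omega>) (\<lambda>x. 2 * a\<^sup>2 * (norm (f x))\<^sup>2 + 2 * b\<^sup>2 * (norm (k x))\<^sup>2)"
        using L2_spaceD(2)[OF that(1)] L2_spaceD(2)[OF that(2)] by simp
      show "(norm (a *\<^sub>R f x + b *\<^sub>R k x))\<^sup>2 \<le> 2 * a\<^sup>2 * (norm (f x))\<^sup>2 + 2 * b\<^sup>2 * (norm (k x))\<^sup>2" for x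
        using norm_add_square_le[of "a *\<^sub>R f x" "b *\<^sub>R k x"] by (simp add: power_mult_distrib)
    qed
    then show ?thesis
      using L2_spaceD(2)[OF that(1)] L2_spaceD(2)[OF that(2)] by simp
  qed
  have L: "u \<in> L2_space \<Omega>" "v \<in> L2_space \<Omega>" "g \<in> L2_space \<Omega>" "h \<in> L2_space \<Omega>"
    using assms by (auto simp: has_H1_gradient_def)
  show ?thesis
    using *[OF L(1,2)] *[OF L(3,4)] by (simp add: H1_square_def algebra_simps)
qed

context bounded_open_set
begin

lemma weak_grad_AE_eq:
  assumes "has_H1_gradient \<Omega> u g"
  shows "AE x in lebesgue_on \<Omega>. weak_grad \<Omega> u x = g x"
  using assms H1_space_iff by (intro has_H1_gradient_unique[OF weak_grad_works assms]) auto

lemma L2_norm_weak_grad: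
  assumes "has_H1_gradient \<Omega> u g"
  shows "L2_norm \<Omega> (weak_grad \<Omega> u) = L2_norm \<Omega> g"
  using assms weak_grad_works H1_space_iff has_H1_gradientD(2)
  by (intro L2_norm_cong_AE weak_grad_AE_eq) blast+

lemma H1_norm_eq:
  assumes "has_H1_gradient \<Omega> u g"
  shows "H1_norm \<Omega> u = sqrt (H1_square \<Omega> u g)"
  unfolding H1_norm_def L2_norm_weak_grad[OF assms] by (simp add: L2_norm_square H1_square_def)

lemma test_has_H1_gradient:
  assumes \<phi>: "\<phi> \<in> test_functions \<Omega>"
  shows "has_H1_gradient \<Omega> \<phi> (classical_grad \<phi>)"
  unfolding has_H1_gradient_def has_weak_gradient_def
proof (intro conjI ballI)
  show "\<phi> \<in> L2_space \<Omega>" by (rule test_functions_L2[OF \<phi>])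
  have sm: "smooth \<phi>" using \<phi> test_functions_iff by blast
  have pd: "partial_deriv i \<phi> \<in> L2_space \<Omega>" if "i \<in> Basis" for i
    by (rule test_functions_L2 test_functions_partial_deriv \<phi> that)+
  have "continuous_on UNIV (classical_grad \<phi>)"
    unfolding classical_grad_def[abs_def]
    by (intro continuous_intros smooth_continuous_on smooth_partial_deriv sm)
  then have "classical_grad \<phi> \<in> borel_measurable (lebesgue_on \<Omega>)"
    by (intro borel_measurable_lebesgue_on borel_measurable_continuous_onI)
  moreover have "integrable (lebesgue_on \<Omega>) (\<lambda>x. \<Sum>i\<in>Basis. (partial_deriv i \<phi> x)\<^sup>2)"
    using pd by (intro Bochner_Integration.integrable_sum L2_space_real_integrable)
  then have "integrable (lebesgue_on \<Omega>) (\<lambda>x. (norm (classical_grad \<phi> x))\<^sup>2)"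
    unfolding norm_square_Basis by (simp add: classical_grad_inner)
  ultimately show "classical_grad \<phi> \<in> L2_space \<Omega>" by (simp add: L2_space_def)
  fix \<psi> and i :: 'a assume \<psi>: "\<psi> \<in> test_functions \<Omega>" and i: "i \<in> Basis"
  have sm': "smooth \<psi>" using \<psi> test_functions_iff by blast
  obtain K where K: "compact K" "K \<subseteq> \<Omega>" "\<And>x. x \<notin> K \<Longrightarrow> \<psi> x = 0"
    using \<psi> unfolding test_functions_iff by blast
  have K': "partial_deriv i \<psi> x = 0" if "x \<notin> K" for x
    by (rule partial_deriv_eq_0[OF K(1,3) that])
  have nK: "x \<notin> K" if "x \<notin> \<Omega>" for x using that K(2) by blast
  note cont = smooth_continuous_on[OF sm] smooth_continuous_on[OF sm']
    smooth_continuous_on[OF smooth_partial_deriv[OF sm i]] smooth_continuous_on[OF smooth_partial_deriv[OF sm' i]]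
  have i1: "integrable lborel (\<lambda>x. \<phi> x * partial_deriv i \<psi> x)"
    by (rule integrable_continuous_compact_support[OF _ K(1)]) (auto simp: K' intro!: continuous_intros cont)
  have i2: "integrable lborel (\<lambda>x. partial_deriv i \<phi> x * \<psi> x)"
    by (rule integrable_continuous_compact_support[OF _ K(1)]) (auto simp: K intro!: continuous_intros cont)
  have "(LINT x|lborel. \<phi> x * partial_deriv i \<psi> x + partial_deriv i \<phi> x * \<psi> x) = 0"
    by (rule integral_by_parts_compact_support[OF has_derivative_mult[OF smooth_has_derivative[OF sm] smooth_has_derivative[OF sm']] _ K(1)])
      (auto simp: K intro!: continuous_intros cont)
  then have "(LINT x|lborel. \<phi> x * partial_deriv i \<psi> x) = - (LINT x|lborel. partial_deriv i \<phi> x * \<psi> x)"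
    using i1 i2 by simp
  moreover have "(LINT x|lebesgue_on \<Omega>. \<phi> x * partial_deriv i \<psi> x) = (LINT x|lborel. \<phi> x * partial_deriv i \<psi> x)"
    using i1 by (intro lebesgue_on_eq_lborel(1)) (auto simp: K' nK)
  moreover have "(LINT x|lebesgue_on \<Omega>. partial_deriv i \<phi> x * \<psi> x) = (LINT x|lborel. partial_deriv i \<phi> x * \<psi> x)"
    using i2 by (intro lebesgue_on_eq_lborel(1)) (auto simp: K(3) nK)
  ultimately show "(LINT x|lebesgue_on \<Omega>. \<phi> x * partial_deriv i \<psi> x) =
      - (LINT x|lebesgue_on \<Omega>. classical_grad \<phi> x \<bullet> i * \<psi> x)"
    by (simp add: classical_grad_inner[OF i])
qed

lemma H10_spaceD:
  assumes z: "z \<in> H10_space \<Omega>" "has_H1_gradient \<Omega> z g" and "e > 0"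
  obtains \<phi> where "\<phi> \<in> test_functions \<Omega>"
    "H1_square \<Omega> (\<lambda>x. z x - \<phi> x) (\<lambda>x. g x - classical_grad \<phi> x) < e"
proof -
  have "sqrt e > 0" using \<open>e > 0\<close> by simp
  then obtain \<phi> where \<phi>: "\<phi> \<in> test_functions \<Omega>" "H1_norm \<Omega> (\<lambda>x. z x - \<phi> x) < sqrt e"
    using z(1) unfolding H10_space_def by blast
  from \<phi>(2) have "H1_square \<Omega> (\<lambda>x. z x - \<phi> x) (\<lambda>x. g x - classical_grad \<phi> x) < e"
    unfolding H1_norm_eq[OF has_H1_gradient_diff[OF z(2) test_has_H1_gradient[OF \<phi>(1)]]] by simp
  with \<phi>(1) that show thesis by blast
qed

lemma H10_spaceI:
  assumes z: "has_H1_gradient \<Omega> z g"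
    and *: "\<And>e. e > 0 \<Longrightarrow> \<exists>\<phi>\<in>test_functions \<Omega>. H1_square \<Omega> (\<lambda>x. z x - \<phi> x) (\<lambda>x. g x - classical_grad \<phi> x) < e"
  shows "z \<in> H10_space \<Omega>"
  unfolding H10_space_def
proof (intro CollectI conjI allI impI)
  show "z \<in> H1_space \<Omega>" using z H1_space_iff by blast
  fix e :: real assume "e > 0"
  then have "e\<^sup>2 > 0" by simp
  from *[OF this] obtain \<phi> where \<phi>: "\<phi> \<in> test_functions \<Omega>"
    "H1_square \<Omega> (\<lambda>x. z x - \<phi> x) (\<lambda>x. g x - classical_grad \<phi> x) < e\<^sup>2" by blast
  from \<phi>(2) have "sqrt (H1_square \<Omega> (\<lambda>x. z x - \<phi> x) (\<lambda>x. g x - classical_grad \<phi> x)) < sqrt (e\<^sup>2)"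
    by (rule real_sqrt_less_mono)
  then have "H1_norm \<Omega> (\<lambda>x. z x - \<phi> x) < e"
    unfolding H1_norm_eq[OF has_H1_gradient_diff[OF z test_has_H1_gradient[OF \<phi>(1)]]]
    using \<open>e > 0\<close> by simp
  with \<phi>(1) show "\<exists>\<phi>\<in>test_functions \<Omega>. H1_norm \<Omega> (\<lambda>x. z x - \<phi> x) < e" by blast
qed

lemma H10_space_H1: "z \<in> H10_space \<Omega> \<Longrightarrow> z \<in> H1_space \<Omega>"
  by (simp add: H10_space_def)

lemma H10_space_lincomb:
  assumes z: "z \<in> H10_space \<Omega>" and w: "w \<in> H10_space \<Omega>"
  shows "(\<lambda>x. a * z x + b * w x) \<in> H10_space \<Omega>"
proof -
  obtain g h where g: "has_H1_gradient \<Omega> z g" and h: "has_H1_gradient \<Omega> w h"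
    using H10_space_H1[OF z] H10_space_H1[OF w] H1_space_iff by blast
  show ?thesis
  proof (rule H10_spaceI[OF has_H1_gradient_lincomb[OF g h]])
    fix e :: real assume "e > 0"
    \<comment> \<open>The estimate below costs 2 a^2 d + 2 b^2 d. This \<open>d\<close> keeps the
      cost under \<open>e\<close>; the summand 1 avoids division by 0 and makes the inequality
      strict.\<close>
    define d where "d = e / (4 * (a\<^sup>2 + b\<^sup>2 + 1))"
    have pos: "a\<^sup>2 + b\<^sup>2 + 1 > 0" by (simp add: add_nonneg_pos)
    then have d: "d > 0" "4 * (a\<^sup>2 + b\<^sup>2 + 1) * d = e" using \<open>e > 0\<close> by (auto simp: d_def field_simps)
    obtain \<phi> where \<phi>: "\<phi> \<in> test_functions \<Omega>"
      "H1_square \<Omega> (\<lambda>x. z x - \<phi> x) (\<lambda>x. g x - classical_grad \<phi> x) < d"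
      by (rule H10_spaceD[OF z g d(1)])
    obtain \<psi> where \<psi>: "\<psi> \<in> test_functions \<Omega>"
      "H1_square \<Omega> (\<lambda>x. w x - \<psi> x) (\<lambda>x. h x - classical_grad \<psi> x) < d"
      by (rule H10_spaceD[OF w h d(1)])
    let ?\<theta> = "\<lambda>x. a * \<phi> x + b * \<psi> x"
    have "H1_square \<Omega> (\<lambda>x. a * (z x - \<phi> x) + b * (w x - \<psi> x))
        (\<lambda>x. a *\<^sub>R (g x - classical_grad \<phi> x) + b *\<^sub>R (h x - classical_grad \<psi> x))
      \<le> 2 * a\<^sup>2 * H1_square \<Omega> (\<lambda>x. z x - \<phi> x) (\<lambda>x. g x - classical_grad \<phi> x)
        + 2 * b\<^sup>2 * H1_square \<Omega> (\<lambda>x. w x - \<psi> x) (\<lambda>x. h x - classical_grad \<psi> x)"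
      by (intro H1_square_lincomb_le has_H1_gradient_diff g h test_has_H1_gradient \<phi> \<psi>)
    also have "\<dots> \<le> 2 * a\<^sup>2 * d + 2 * b\<^sup>2 * d"
      using \<phi>(2) \<psi>(2) by (intro add_mono mult_left_mono) auto
    also have "\<dots> < 4 * (a\<^sup>2 + b\<^sup>2 + 1) * d"
    proof -
      have "2 * a\<^sup>2 + 2 * b\<^sup>2 < 4 * (a\<^sup>2 + b\<^sup>2 + 1)"
        using zero_le_power2[of a] zero_le_power2[of b] unfolding distrib_left by linarith
      from mult_strict_right_mono[OF this d(1)] show ?thesis by (simp only: distrib_right)
    qed
    also note d(2)
    finally have "H1_square \<Omega> (\<lambda>x. a * (z x - \<phi> x) + b * (w x - \<psi> x))
        (\<lambda>x. a *\<^sub>R (g x - classical_grad \<phi> x) + b *\<^sub>R (h x - classical_grad \<psi> x)) < e" .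
    moreover have "(\<lambda>x. a * (z x - \<phi> x) + b * (w x - \<psi> x)) = (\<lambda>x. a * z x + b * w x - ?\<theta> x)"
      by (auto simp: algebra_simps)
    moreover have "(\<lambda>x. a *\<^sub>R (g x - classical_grad \<phi> x) + b *\<^sub>R (h x - classical_grad \<psi> x))
        = (\<lambda>x. a *\<^sub>R g x + b *\<^sub>R h x - classical_grad ?\<theta> x)"
      using \<phi>(1) \<psi>(1) by (auto simp: classical_grad_lincomb test_functions_iff algebra_simps)
    ultimately show "\<exists>\<theta>\<in>test_functions \<Omega>. H1_square \<Omega> (\<lambda>x. a * z x + b * w x - \<theta> x)
        (\<lambda>x. a *\<^sub>R g x + b *\<^sub>R h x - classical_grad \<theta> x) < e"
      using test_functions_lincomb[OF \<phi>(1) \<psi>(1)] by (intro bexI[of _ ?\<theta>]) auto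
  qed
qed

lemma H10_space_closed:
  assumes z: "has_H1_gradient \<Omega> z g"
    and *: "\<And>e. e > 0 \<Longrightarrow> \<exists>w h. w \<in> H10_space \<Omega> \<and> has_H1_gradient \<Omega> w h \<and>
      H1_square \<Omega> (\<lambda>x. z x - w x) (\<lambda>x. g x - h x) < e"
  shows "z \<in> H10_space \<Omega>"
proof (rule H10_spaceI[OF z])
  fix e :: real assume "e > 0"
  \<comment> \<open>Two approximations follow each other, each with squared error below e/4; the
    square of a sum costs a factor 2.\<close>
  then have "e / 4 > 0" by simp
  from *[OF this] obtain w h where w: "w \<in> H10_space \<Omega>" "has_H1_gradient \<Omega> w h"
    "H1_square \<Omega> (\<lambda>x. z x - w x) (\<lambda>x. g x - h x) < e / 4" by blast
  obtain \<phi> where \<phi>: "\<phi> \<in> test_functions \<Omega>"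
    "H1_square \<Omega> (\<lambda>x. w x - \<phi> x) (\<lambda>x. h x - classical_grad \<phi> x) < e / 4"
    by (rule H10_spaceD[OF w(1,2) \<open>e / 4 > 0\<close>])
  have "H1_square \<Omega> (\<lambda>x. z x - \<phi> x) (\<lambda>x. g x - classical_grad \<phi> x)
      \<le> 2 * H1_square \<Omega> (\<lambda>x. z x - w x) (\<lambda>x. g x - h x)
        + 2 * H1_square \<Omega> (\<lambda>x. w x - \<phi> x) (\<lambda>x. h x - classical_grad \<phi> x)"
    using H1_square_lincomb_le[OF has_H1_gradient_diff[OF z w(2)]
        has_H1_gradient_diff[OF w(2) test_has_H1_gradient[OF \<phi>(1)]], of 1 1] by simp
  with w(3) \<phi>(2) have "H1_square \<Omega> (\<lambda>x. z x - \<phi> x) (\<lambda>x. g x - classical_grad \<phi> x) < e" by linarith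
  with \<phi>(1) show "\<exists>\<phi>\<in>test_functions \<Omega>. H1_square \<Omega> (\<lambda>x. z x - \<phi> x) (\<lambda>x. g x - classical_grad \<phi> x) < e"
    by blast
qed

text \<open>Mollification enlarges the support only slightly, so for large \<open>n\<close> the
  mollifications of \<open>z\<close> are test functions. Their derivatives are the mollified
  components of \<open>g\<close> at every point: on the enlarged support because balls fit into
  \<open>\<Omega>\<close>, off it because both sides vanish, \<open>g\<close> being 0 almost
  everywhere outside \<open>K\<close>.\<close>

lemma H10_space_compact_support:
  assumes z: "has_H1_gradient \<Omega> z g" and K: "compact K" "K \<subseteq> \<Omega>"
    and z0: "AE x in lebesgue_on \<Omega>. x \<notin> K \<longrightarrow> z x = 0"
  shows "z \<in> H10_space \<Omega>"
proof (rule H10_spaceI[OF z])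
  fix e :: real assume "e > 0"
  note zD = has_H1_gradientD[OF z]
  have gi: "(\<lambda>x. g x \<bullet> i) \<in> L2_space \<Omega>" for i by (rule L2_space_inner_const[OF zD(2)])
  have "AE x in lebesgue_on \<Omega>. x \<in> \<Omega> - K \<longrightarrow> g x = 0"
  proof (rule has_H1_gradient_local_eq_0[OF bounded_open_set_axioms z])
    show "open (\<Omega> - K)" using open_\<Omega> compact_imp_closed[OF K(1)] by (rule open_Diff)
    show "AE x in lebesgue_on \<Omega>. x \<in> \<Omega> - K \<longrightarrow> z x = 0" using z0 by eventually_elim simp
  qed blast
  moreover have "AE x in lebesgue_on \<Omega>. x \<in> \<Omega>" by (simp add: AE_lebesgue_on_iff)
  ultimately have g0: "AE x in lebesgue_on \<Omega>. x \<notin> K \<longrightarrow> g x \<bullet> i = 0" for i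
    by eventually_elim simp
  let ?U = "mollify \<Omega> z" and ?G = "\<lambda>i. mollify \<Omega> (\<lambda>x. g x \<bullet> i)"
  obtain \<epsilon> where \<epsilon>: "\<epsilon> > 0" "(\<Union>x\<in>K. ball x \<epsilon>) \<subseteq> \<Omega>"
    using compact_subset_open_imp_ball_epsilon_subset[OF K(1) open_\<Omega> K(2)] by blast
  \<comment> \<open>Half of \<open>\<epsilon>\<close>, since one radius is spent on enlarging
    \<open>K\<close> to \<open>L\<close> and a second one on the balls around the points of
    \<open>L\<close>, which must still lie in \<open>\<Omega>\<close>.\<close>
  have main: "?U n \<in> test_functions \<Omega> \<and> (\<forall>x i. i \<in> Basis \<longrightarrow> partial_deriv i (?U n) x = ?G i n x)"
    if n: "inverse (real (Suc n)) < \<epsilon> / 2" for n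
  proof -
    define r where "r = inverse (real (Suc n))"
    define L where "L = {x + y |x y. x \<in> K \<and> y \<in> cball 0 r}"
    have L: "compact L" unfolding L_def by (intro compact_sums K compact_cball)
    have L_dist: "x \<in> L" if "y \<in> K" "dist x y \<le> r" for x y
      unfolding L_def using that
      by (simp only: mem_Collect_eq) (rule exI[of _ y], rule exI[of _ "x - y"], simp add: dist_norm norm_minus_commute)
    have L_ball: "cball x r \<subseteq> \<Omega>" if x: "x \<in> L" for x
    proof
      fix w assume "w \<in> cball x r"
      from x obtain y v where y: "x = y + v" "y \<in> K" "norm v \<le> r" unfolding L_def by auto
      have "dist y w \<le> dist y x + dist x w" by (rule dist_triangle)
      also have "\<dots> \<le> r + r" using \<open>w \<in> cball x r\<close> y by (intro add_mono) (auto simp: dist_norm)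
      also have "\<dots> < \<epsilon>" using n by (simp add: r_def)
      finally have "w \<in> ball y \<epsilon>" by simp
      with \<epsilon>(2) y(2) show "w \<in> \<Omega>" by blast
    qed
    have "r \<ge> 0" by (simp add: r_def)
    have L\<Omega>: "L \<subseteq> \<Omega>" using L_ball \<open>r \<ge> 0\<close> centre_in_cball by blast
    have out: "mollify \<Omega> f n x = 0" if f: "f \<in> L2_space \<Omega>" "AE x in lebesgue_on \<Omega>. x \<notin> K \<longrightarrow> f x = 0" and x: "x \<notin> L" for f x
    proof (rule mollify_eq_0[OF f(1)])
      show "AE y in lebesgue_on \<Omega>. dist x y < inverse (real (Suc n)) \<longrightarrow> f y = 0"
        using f(2)
      proof eventually_elim
        case (elim y)
        then show ?case using L_dist[of y x] x unfolding r_def by (meson less_imp_le)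
      qed
    qed
    have "?U n \<in> test_functions \<Omega>"
      unfolding test_functions_iff using smooth_mollify[OF zD(1)] L L\<Omega> out[OF zD(1) z0] by blast
    moreover have "partial_deriv i (?U n) x = ?G i n x" if i: "i \<in> Basis" for i x
    proof (cases "x \<in> L")
      case True
      then show ?thesis using partial_deriv_mollify[OF z i] L_ball unfolding r_def by blast
    next
      case False
      have "partial_deriv i (?U n) x = 0"
        by (rule partial_deriv_eq_0[OF L out[OF zD(1) z0] False])
      with out[OF gi g0 False] show ?thesis by simp
    qed
    ultimately show ?thesis by blast
  qed
  have "(\<lambda>n. (LINT x|lebesgue_on \<Omega>. (?U n x - z x)\<^sup>2) + (\<Sum>i\<in>Basis. LINT x|lebesgue_on \<Omega>. (?G i n x - g x \<bullet> i)\<^sup>2))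
      \<longlonglongrightarrow> 0 + (\<Sum>i\<in>(Basis::'a set). 0)"
    by (intro tendsto_add tendsto_sum mollify_L2(2) zD gi)
  then have "\<forall>\<^sub>F n in sequentially. (LINT x|lebesgue_on \<Omega>. (?U n x - z x)\<^sup>2)
      + (\<Sum>i\<in>Basis. LINT x|lebesgue_on \<Omega>. (?G i n x - g x \<bullet> i)\<^sup>2) < e"
    using \<open>e > 0\<close> by (intro order_tendstoD(2)) auto
  moreover have "\<forall>\<^sub>F n in sequentially. inverse (real (Suc n)) < \<epsilon> / 2"
    using \<epsilon>(1) by (intro order_tendstoD(2)[OF LIMSEQ_inverse_real_of_nat]) simp
  ultimately have "\<forall>\<^sub>F n in sequentially. (LINT x|lebesgue_on \<Omega>. (?U n x - z x)\<^sup>2)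
      + (\<Sum>i\<in>Basis. LINT x|lebesgue_on \<Omega>. (?G i n x - g x \<bullet> i)\<^sup>2) < e \<and> inverse (real (Suc n)) < \<epsilon> / 2"
    by (rule eventually_conj)
  then obtain n where n: "(LINT x|lebesgue_on \<Omega>. (?U n x - z x)\<^sup>2)
      + (\<Sum>i\<in>Basis. LINT x|lebesgue_on \<Omega>. (?G i n x - g x \<bullet> i)\<^sup>2) < e" "inverse (real (Suc n)) < \<epsilon> / 2"
    unfolding eventually_sequentially by blast
  note m = main[OF n(2)]
  have "(LINT x|lebesgue_on \<Omega>. (norm (g x - classical_grad (?U n) x))\<^sup>2)
      = (LINT x|lebesgue_on \<Omega>. (\<Sum>i\<in>Basis. (?G i n x - g x \<bullet> i)\<^sup>2))"
    using m by (simp add: norm_square_Basis inner_diff_left classical_grad_inner power2_commute)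
  also have "\<dots> = (\<Sum>i\<in>Basis. LINT x|lebesgue_on \<Omega>. (?G i n x - g x \<bullet> i)\<^sup>2)"
    by (intro Bochner_Integration.integral_sum L2_space_real_integrable L2_space_diff mollify_L2 gi)
  finally have "H1_square \<Omega> (\<lambda>x. z x - ?U n x) (\<lambda>x. g x - classical_grad (?U n) x) < e"
    using n(1) by (simp add: H1_square_def power2_commute)
  with m show "\<exists>\<phi>\<in>test_functions \<Omega>. H1_square \<Omega> (\<lambda>x. z x - \<phi> x) (\<lambda>x. g x - classical_grad \<phi> x) < e"
    by blast
qed

text \<open>If \<open>w - G\<close> is approximated by test functions \<open>\<phi>\<close>, then \<open>max w 0 - G\<close> is approximated by
  \<open>max (G + \<phi>) 0 - G\<close>, which vanishes outside the support of \<open>\<phi>\<close> because \<open>G \<ge> 0\<close>.\<close>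

lemma H10_space_pos_part:
  assumes G: "has_H1_gradient \<Omega> G \<gamma>" "AE x in lebesgue_on \<Omega>. G x \<ge> 0"
    and w: "has_H1_gradient \<Omega> w \<omega>" and wG: "(\<lambda>x. w x - G x) \<in> H10_space \<Omega>"
  shows "(\<lambda>x. max (w x) 0 - G x) \<in> H10_space \<Omega>"
proof -
  note wG' = has_H1_gradient_diff[OF w G(1)]
  have "\<exists>\<phi>. \<forall>n. \<phi> n \<in> test_functions \<Omega> \<and>
    H1_square \<Omega> (\<lambda>x. w x - G x - \<phi> n x) (\<lambda>x. \<omega> x - \<gamma> x - classical_grad (\<phi> n) x) < inverse (real (Suc n))"
    using H10_spaceD[OF wG wG'] by (intro choice allI) (metis inverse_positive_iff_positive of_nat_0_less_iff zero_less_Suc)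
  then obtain \<phi> where \<phi>: "\<And>n. \<phi> n \<in> test_functions \<Omega>"
    "\<And>n. H1_square \<Omega> (\<lambda>x. w x - G x - \<phi> n x) (\<lambda>x. \<omega> x - \<gamma> x - classical_grad (\<phi> n) x) < inverse (real (Suc n))"
    by blast
  define f where "f n x = G x + \<phi> n x" for n x
  define \<eta> where "\<eta> n x = \<gamma> x + classical_grad (\<phi> n) x" for n x
  have f: "has_H1_gradient \<Omega> (f n) (\<eta> n)" for n
    using has_H1_gradient_lincomb[OF G(1) test_has_H1_gradient[OF \<phi>(1)], of 1 1]
    by (simp add: f_def[abs_def] \<eta>_def[abs_def])
  have wf: "has_H1_gradient \<Omega> (\<lambda>x. w x - f n x) (\<lambda>x. \<omega> x - \<eta> n x)" for n
    by (rule has_H1_gradient_diff[OF w f])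
  have less: "H1_square \<Omega> (\<lambda>x. w x - f n x) (\<lambda>x. \<omega> x - \<eta> n x) < inverse (real (Suc n))" for n
    using \<phi>(2)[of n] by (simp add: f_def \<eta>_def diff_diff_add)
  have H0: "(\<lambda>n. H1_square \<Omega> (\<lambda>x. w x - f n x) (\<lambda>x. \<omega> x - \<eta> n x)) \<longlonglongrightarrow> 0"
    by (rule tendsto_sandwich[OF _ _ tendsto_const LIMSEQ_inverse_real_of_nat])
      (auto intro!: always_eventually H1_square_nonneg less_imp_le[OF less] simp del: of_nat_Suc)
  have wf2: "(\<lambda>x. w x - f n x) \<in> L2_space \<Omega>" for n using has_H1_gradientD(1)[OF wf] .
  have wf0: "(\<lambda>n. LINT x|lebesgue_on \<Omega>. (w x - f n x)\<^sup>2) \<longlonglongrightarrow> 0"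
    by (rule tendsto_sandwich[OF _ _ tendsto_const H0]) (auto simp: H1_square_def)
  obtain r where r: "strict_mono r" "AE x in lebesgue_on \<Omega>. (\<lambda>n. w x - f (r n) x) \<longlonglongrightarrow> 0"
    by (rule L2_AE_subseq[OF wf2 wf0])
  let ?I = "indicator {0<..} :: real \<Rightarrow> real"
  have Im: "(\<lambda>x. ?I (h x)) \<in> borel_measurable (lebesgue_on \<Omega>)" if "h \<in> L2_space \<Omega>" for h
  proof -
    have "?I \<in> borel_measurable borel" by measurable
    then show ?thesis using L2_spaceD(1)[OF that] by (rule measurable_compose[rotated])
  qed
  note wD = has_H1_gradientD[OF w]
  have [measurable]: "\<omega> \<in> borel_measurable (lebesgue_on \<Omega>)" using wD L2_spaceD(1) by blast
  have If: "(\<lambda>x. ?I (f n x)) \<in> borel_measurable (lebesgue_on \<Omega>)" for n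
    by (rule Im[OF has_H1_gradientD(1)[OF f]])
  have Iw: "(\<lambda>x. ?I (w x)) \<in> borel_measurable (lebesgue_on \<Omega>)" by (rule Im[OF wD(1)])
  define p where "p n x = max (f n x) 0 - G x" for n x
  define \<pi> where "\<pi> n x = ?I (f n x) *\<^sub>R \<eta> n x - \<gamma> x" for n x
  have p: "has_H1_gradient \<Omega> (p n) (\<pi> n)" for n
    unfolding p_def[abs_def] \<pi>_def[abs_def]
    by (rule has_H1_gradient_diff[OF has_H1_gradient_pos_part[OF f] G(1)])
  have pH: "p n \<in> H10_space \<Omega>" for n
  proof -
    obtain K where K: "compact K" "K \<subseteq> \<Omega>" "\<And>x. x \<notin> K \<Longrightarrow> \<phi> n x = 0"
      using \<phi>(1)[of n] unfolding test_functions_iff by blast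
    have "AE x in lebesgue_on \<Omega>. x \<notin> K \<longrightarrow> p n x = 0"
      using G(2) by eventually_elim (simp add: p_def f_def K(3))
    from H10_space_compact_support[OF p K(1,2) this] show ?thesis .
  qed
  let ?q = "\<lambda>x. ?I (w x) *\<^sub>R \<omega> x - \<gamma> x"
  have q: "has_H1_gradient \<Omega> (\<lambda>x. max (w x) 0 - G x) ?q"
    by (rule has_H1_gradient_diff[OF has_H1_gradient_pos_part[OF w] G(1)])
  have \<omega>2: "integrable (lebesgue_on \<Omega>) (\<lambda>x. (norm (\<omega> x))\<^sup>2)" by (rule L2_spaceD(2)[OF wD(2)])
  \<comment> \<open>The difference of the cut-off gradients is an indicator times the old error
    \<open>\<omega> x - \<eta> n x\<close>, plus the mismatch of the two indicators times
    \<open>\<omega> x\<close>. \<open>R n\<close> measures the second part.\<close>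
  define R where "R n = (LINT x|lebesgue_on \<Omega>. (?I (w x) - ?I (f n x))\<^sup>2 * (norm (\<omega> x))\<^sup>2)" for n
  have I1: "(?I s - ?I t)\<^sup>2 \<le> 1" for s t by (auto simp: indicator_def)
  have Ri: "integrable (lebesgue_on \<Omega>) (\<lambda>x. (?I (w x) - ?I (f n x))\<^sup>2 * (norm (\<omega> x))\<^sup>2)" for n
  proof -
    have "integrable (lebesgue_on \<Omega>) (\<lambda>x. (norm (\<omega> x))\<^sup>2 * (?I (w x) - ?I (f n x))\<^sup>2)"
      by (rule integrable_mult_bounded[OF \<omega>2, of _ 1]) (use If Iw I1 in auto)
    then show ?thesis by (simp add: mult.commute)
  qed
  have "(\<lambda>n. R (r n)) \<longlonglongrightarrow> (LINT x|lebesgue_on \<Omega>. 0)"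
    unfolding R_def
  proof (rule integral_dominated_convergence[OF _ _ \<omega>2])
    \<comment> \<open>The indicator is continuous away from 0, so the mismatch disappears in the
      limit wherever \<open>w x\<close> is nonzero. Where \<open>w x\<close> is 0 the indicators are
      out of control, but there \<open>\<omega> x\<close> is 0.\<close>
    show "AE x in lebesgue_on \<Omega>. (\<lambda>n. (?I (w x) - ?I (f (r n) x))\<^sup>2 * (norm (\<omega> x))\<^sup>2) \<longlonglongrightarrow> 0"
      using r(2) has_H1_gradient_zero_set[OF w]
    proof eventually_elim
      case (elim x)
      have lim: "(\<lambda>n. f (r n) x) \<longlonglongrightarrow> w x"
        using tendsto_diff[OF tendsto_const elim(1), of "w x"] by simp
      show ?case
      proof (cases "w x = 0")
        case True
        with elim(2) show ?thesis by simp
      next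
        case False
        then consider "w x > 0" | "w x < 0" by linarith
        then have "\<forall>\<^sub>F n in sequentially. ?I (f (r n) x) = ?I (w x)"
        proof cases
          case 1
          show ?thesis using order_tendstoD(1)[OF lim 1] by eventually_elim (use 1 in simp)
        next
          case 2
          show ?thesis using order_tendstoD(2)[OF lim 2] by eventually_elim (use 2 in simp)
        qed
        then have "\<forall>\<^sub>F n in sequentially. (?I (w x) - ?I (f (r n) x))\<^sup>2 * (norm (\<omega> x))\<^sup>2 = 0"
          by eventually_elim simp
        then show ?thesis by (rule tendsto_eventually)
      qed
    qed
    show "AE x in lebesgue_on \<Omega>. norm ((?I (w x) - ?I (f (r n) x))\<^sup>2 * (norm (\<omega> x))\<^sup>2) \<le> (norm (\<omega> x))\<^sup>2" for n
      using mult_right_mono[OF I1, of "(norm (\<omega> _))\<^sup>2"] by (intro AE_I2) simp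
    show "(\<lambda>x. (?I (w x) - ?I (f (r n) x))\<^sup>2 * (norm (\<omega> x))\<^sup>2) \<in> borel_measurable (lebesgue_on \<Omega>)" for n
      using Ri by blast
  qed simp
  then have R0: "(\<lambda>n. R (r n)) \<longlonglongrightarrow> 0" by simp
  have est: "H1_square \<Omega> (\<lambda>x. max (w x) 0 - G x - p n x) (\<lambda>x. ?q x - \<pi> n x)
      \<le> 2 * H1_square \<Omega> (\<lambda>x. w x - f n x) (\<lambda>x. \<omega> x - \<eta> n x) + 2 * R n" for n
  proof -
    note D = has_H1_gradientD[OF has_H1_gradient_diff[OF q p[of n]]]
    note wfD = has_H1_gradientD[OF wf[of n]]
    have "(LINT x|lebesgue_on \<Omega>. (max (w x) 0 - G x - p n x)\<^sup>2) \<le> (LINT x|lebesgue_on \<Omega>. (w x - f n x)\<^sup>2)"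
    proof (rule integral_mono)
      show "integrable (lebesgue_on \<Omega>) (\<lambda>x. (max (w x) 0 - G x - p n x)\<^sup>2)"
        by (rule L2_space_real_integrable[OF D(1)])
      show "integrable (lebesgue_on \<Omega>) (\<lambda>x. (w x - f n x)\<^sup>2)"
        by (rule L2_space_real_integrable[OF wf2])
      have "\<bar>max (w x) 0 - max (f n x) 0\<bar> \<le> \<bar>w x - f n x\<bar>" for x by (auto simp: max_def)
      then show "(max (w x) 0 - G x - p n x)\<^sup>2 \<le> (w x - f n x)\<^sup>2" for x
        by (simp add: p_def abs_le_square_iff)
    qed
    moreover have "(LINT x|lebesgue_on \<Omega>. (norm (?q x - \<pi> n x))\<^sup>2)
        \<le> (LINT x|lebesgue_on \<Omega>. 2 * (norm (\<omega> x - \<eta> n x))\<^sup>2 + 2 * ((?I (w x) - ?I (f n x))\<^sup>2 * (norm (\<omega> x))\<^sup>2))"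
    proof (rule integral_mono)
      show "integrable (lebesgue_on \<Omega>) (\<lambda>x. (norm (?q x - \<pi> n x))\<^sup>2)"
        by (rule L2_spaceD(2)[OF D(2)])
      show "integrable (lebesgue_on \<Omega>) (\<lambda>x. 2 * (norm (\<omega> x - \<eta> n x))\<^sup>2 + 2 * ((?I (w x) - ?I (f n x))\<^sup>2 * (norm (\<omega> x))\<^sup>2))"
        using L2_spaceD(2)[OF wfD(2)] Ri[of n] by simp
      fix x
      have "?q x - \<pi> n x = ?I (f n x) *\<^sub>R (\<omega> x - \<eta> n x) + (?I (w x) - ?I (f n x)) *\<^sub>R \<omega> x"
        by (simp add: \<pi>_def algebra_simps)
      then have "(norm (?q x - \<pi> n x))\<^sup>2 \<le> 2 * (norm (?I (f n x) *\<^sub>R (\<omega> x - \<eta> n x)))\<^sup>2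
          + 2 * (norm ((?I (w x) - ?I (f n x)) *\<^sub>R \<omega> x))\<^sup>2"
        using norm_add_square_le by metis
      also have "\<dots> \<le> 2 * (norm (\<omega> x - \<eta> n x))\<^sup>2 + 2 * ((?I (w x) - ?I (f n x))\<^sup>2 * (norm (\<omega> x))\<^sup>2)"
        by (auto simp: power_mult_distrib indicator_def)
      finally show "(norm (?q x - \<pi> n x))\<^sup>2
          \<le> 2 * (norm (\<omega> x - \<eta> n x))\<^sup>2 + 2 * ((?I (w x) - ?I (f n x))\<^sup>2 * (norm (\<omega> x))\<^sup>2)" .
    qed
    moreover have "(LINT x|lebesgue_on \<Omega>. 2 * (norm (\<omega> x - \<eta> n x))\<^sup>2 + 2 * ((?I (w x) - ?I (f n x))\<^sup>2 * (norm (\<omega> x))\<^sup>2))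
        = 2 * (LINT x|lebesgue_on \<Omega>. (norm (\<omega> x - \<eta> n x))\<^sup>2) + 2 * R n"
      using L2_spaceD(2)[OF wfD(2)] Ri[of n] by (simp add: R_def)
    moreover have "0 \<le> (LINT x|lebesgue_on \<Omega>. (w x - f n x)\<^sup>2)" by simp
    moreover have "A + C \<le> 2 * (B + E) + 2 * S"
      if "A \<le> B" "C \<le> D" "D = 2 * E + 2 * S" "0 \<le> B" for A B C D E S :: real
      using that unfolding distrib_left by linarith
    ultimately show ?thesis unfolding H1_square_def by blast
  qed
  show ?thesis
  proof (rule H10_space_closed[OF q])
    fix e :: real assume "e > 0"
    have "(\<lambda>n. 2 * H1_square \<Omega> (\<lambda>x. w x - f (r n) x) (\<lambda>x. \<omega> x - \<eta> (r n) x) + 2 * R (r n)) \<longlonglongrightarrow> 2 * 0 + 2 * 0"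
      using LIMSEQ_subseq_LIMSEQ[OF H0 r(1)] by (intro tendsto_intros R0) (simp add: o_def)
    then have "\<forall>\<^sub>F n in sequentially. 2 * H1_square \<Omega> (\<lambda>x. w x - f (r n) x) (\<lambda>x. \<omega> x - \<eta> (r n) x) + 2 * R (r n) < e"
      using \<open>e > 0\<close> by (intro order_tendstoD(2)) auto
    then obtain n where "2 * H1_square \<Omega> (\<lambda>x. w x - f (r n) x) (\<lambda>x. \<omega> x - \<eta> (r n) x) + 2 * R (r n) < e"
      unfolding eventually_sequentially by blast
    with est[of "r n"] have "H1_square \<Omega> (\<lambda>x. max (w x) 0 - G x - p (r n) x) (\<lambda>x. ?q x - \<pi> (r n) x) < e"
      by linarith
    with pH p show "\<exists>v h. v \<in> H10_space \<Omega> \<and> has_H1_gradient \<Omega> v h \<and>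
        H1_square \<Omega> (\<lambda>x. max (w x) 0 - G x - v x) (\<lambda>x. ?q x - h x) < e"
      by blast
  qed
qed

end

section \<open>The energy estimate\<close>

context bounded_open_set
begin

text \<open>The iterates are specified only up to null sets, and \<open>v\<close> is not assumed
  measurable: its measurability comes from completeness of the Lebesgue measure.\<close>

lemma has_H1_gradient_cong_AE:
  assumes ug: "has_H1_gradient \<Omega> u g" and eq: "AE x in lebesgue_on \<Omega>. v x = u x"
  shows "has_H1_gradient \<Omega> v g"
  unfolding has_H1_gradient_def has_weak_gradient_def
proof (intro conjI ballI)
  note u = has_H1_gradientD[OF ug]
  have um: "u \<in> borel_measurable (lebesgue_on \<Omega>)" by (rule L2_spaceD(1)[OF u(1)])
  have "(\<lambda>x. indicator \<Omega> x *\<^sub>R v x) \<in> borel_measurable lebesgue"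
  proof (rule borel_measurable_AE)
    show "(\<lambda>x. indicator \<Omega> x *\<^sub>R u x) \<in> borel_measurable lebesgue"
      using um by (simp add: borel_measurable_restrict_space_iff \<Omega>_sets)
    have "AE x in lebesgue. x \<in> \<Omega> \<longrightarrow> v x = u x"
      using eq by (simp add: AE_restrict_space_iff \<Omega>_sets)
    then show "AE x in lebesgue. indicator \<Omega> x *\<^sub>R u x = indicator \<Omega> x *\<^sub>R v x"
      by eventually_elim (auto simp: indicator_def)
  qed
  then have vm: "v \<in> borel_measurable (lebesgue_on \<Omega>)"
    by (simp add: borel_measurable_restrict_space_iff \<Omega>_sets)
  have "integrable (lebesgue_on \<Omega>) (\<lambda>x. (v x)\<^sup>2)"
  proof (rule integrable_cong_AE_imp[OF L2_space_real_integrable[OF u(1)]])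
    show "AE x in lebesgue_on \<Omega>. (u x)\<^sup>2 = (v x)\<^sup>2" using eq by eventually_elim simp
  qed (use vm in measurable)
  with vm show "v \<in> L2_space \<Omega>" by (simp add: L2_space_def)
  show "g \<in> L2_space \<Omega>" by (rule u(2))
  fix \<phi> and i :: 'a assume \<phi>: "\<phi> \<in> test_functions \<Omega>" and i: "i \<in> Basis"
  have m: "partial_deriv i \<phi> \<in> borel_measurable (lebesgue_on \<Omega>)"
    by (rule L2_spaceD test_functions_L2 test_functions_partial_deriv \<phi> i)+
  have "(LINT x|lebesgue_on \<Omega>. v x * partial_deriv i \<phi> x) = (LINT x|lebesgue_on \<Omega>. u x * partial_deriv i \<phi> x)"
  proof (rule integral_cong_AE)
    show "AE x in lebesgue_on \<Omega>. v x * partial_deriv i \<phi> x = u x * partial_deriv i \<phi> x"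
      using eq by eventually_elim simp
  qed (use vm um m in measurable)
  with u(3)[OF \<phi> i] show "(LINT x|lebesgue_on \<Omega>. v x * partial_deriv i \<phi> x)
      = - (LINT x|lebesgue_on \<Omega>. g x \<bullet> i * \<phi> x)" by simp
qed

text \<open>The two functions share a gradient and are at distance 0, so this is an instance of
  closedness.\<close>

lemma H10_space_cong_AE:
  assumes z: "z \<in> H10_space \<Omega>" and eq: "AE x in lebesgue_on \<Omega>. w x = z x"
  shows "w \<in> H10_space \<Omega>"
proof -
  obtain g where g: "has_H1_gradient \<Omega> z g" using H10_space_H1[OF z] H1_space_iff by blast
  have w: "has_H1_gradient \<Omega> w g" by (rule has_H1_gradient_cong_AE[OF g eq])
  show ?thesis
  proof (rule H10_space_closed[OF w])
    fix e :: real assume "e > 0"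
    have "AE x in lebesgue_on \<Omega>. (w x - z x)\<^sup>2 = 0"
      using eq by eventually_elim simp
    then have "(LINT x|lebesgue_on \<Omega>. (w x - z x)\<^sup>2) = 0"
      by (rule integral_eq_zero_AE)
    then have "H1_square \<Omega> (\<lambda>x. w x - z x) (\<lambda>x. g x - g x) < e"
      using \<open>e > 0\<close> by (simp add: H1_square_def)
    with z g show "\<exists>z h. z \<in> H10_space \<Omega> \<and> has_H1_gradient \<Omega> z h \<and> H1_square \<Omega> (\<lambda>x. w x - z x) (\<lambda>x. g x - h x) < e"
      by blast
  qed
qed

section \<open>The functional along segments of admissible functions\<close>

lemma admissible_convex:
  assumes v: "v \<in> admissible \<Omega> u0" and w: "w \<in> admissible \<Omega> u0"
  shows "(\<lambda>x. (1 - t) * v x + t * w x) \<in> admissible \<Omega> u0"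
proof -
  obtain g h where "has_H1_gradient \<Omega> v g" "has_H1_gradient \<Omega> w h"
    using v w unfolding admissible_def H1_space_iff by blast
  from has_H1_gradient_lincomb[OF this] have "(\<lambda>x. (1 - t) * v x + t * w x) \<in> H1_space \<Omega>"
    unfolding H1_space_iff by blast
  moreover have "(\<lambda>x. (1 - t) * (v x - u0 x) + t * (w x - u0 x)) \<in> H10_space \<Omega>"
    using v w by (intro H10_space_lincomb) (auto simp: admissible_def)
  moreover have "(\<lambda>x. (1 - t) * (v x - u0 x) + t * (w x - u0 x)) = (\<lambda>x. (1 - t) * v x + t * w x - u0 x)"
    by (auto simp: algebra_simps)
  ultimately show ?thesis by (simp add: admissible_def)
qed

lemma positivity_set_measurable:
  assumes [measurable]: "u \<in> borel_measurable (lebesgue_on \<Omega>)" "v \<in> borel_measurable (lebesgue_on \<Omega>)"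
    "w \<in> borel_measurable (lebesgue_on \<Omega>)"
  shows "positivity_set \<Omega> v w u \<in> sets (lebesgue_on \<Omega>)"
proof -
  have "{x \<in> space (lebesgue_on \<Omega>). u x > 0} \<union> {x \<in> space (lebesgue_on \<Omega>). v x > 0}
      \<union> {x \<in> space (lebesgue_on \<Omega>). w x > 0} \<in> sets (lebesgue_on \<Omega>)" by measurable
  then show ?thesis by (simp add: positivity_set_def)
qed

text \<open>The integral over the positivity set becomes one over the fixed set
  \<open>\<Omega>\<close> with an indicator, and \<open>weak_grad\<close> gives way to arbitrary
  representatives. Values of the functional with different positivity sets can then be compared
  pointwise.\<close>

lemma functional_J_eq:
  assumes u: "has_H1_gradient \<Omega> u g" and w: "has_H1_gradient \<Omega> w k" and v: "v \<in> L2_space \<Omega>"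
  shows "functional_J \<Omega> h v w u =
    (LINT x|lebesgue_on \<Omega>. indicator (positivity_set \<Omega> v w u) x * ((u x - 2 * v x + w x)\<^sup>2 / (2 * h\<^sup>2)))
    + 1 / 4 * (LINT x|lebesgue_on \<Omega>. (norm (g x + k x))\<^sup>2)"
proof -
  let ?P = "positivity_set \<Omega> v w u"
  have P: "?P \<in> sets (lebesgue_on \<Omega>)"
    using positivity_set_measurable L2_spaceD(1) has_H1_gradientD(1)[OF u] has_H1_gradientD(1)[OF w] v by blast
  have P\<Omega>: "?P \<subseteq> \<Omega>" by (auto simp: positivity_set_def)
  have "?P \<in> sets lebesgue" using P by (simp add: sets_restrict_space_iff \<Omega>_sets)
  then have rr: "lebesgue_on (\<Omega> \<inter> ?P) = restrict_space (lebesgue_on \<Omega>) ?P"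
    by (simp add: restrict_restrict_space \<Omega>_sets)
  have P': "?P \<inter> space (lebesgue_on \<Omega>) \<in> sets (lebesgue_on \<Omega>)"
    using P P\<Omega> by (simp add: Int_absorb2)
  have "(LINT x|lebesgue_on (\<Omega> \<inter> ?P). \<bar>u x - 2 * v x + w x\<bar>\<^sup>2 / (2 * h\<^sup>2))
      = (LINT x|lebesgue_on \<Omega>. indicator ?P x * ((u x - 2 * v x + w x)\<^sup>2 / (2 * h\<^sup>2)))"
    unfolding rr integral_restrict_space[OF P'] by simp
  moreover have "(LINT x|lebesgue_on \<Omega>. (norm (weak_grad \<Omega> u x + weak_grad \<Omega> w x))\<^sup>2)
      = (LINT x|lebesgue_on \<Omega>. (norm (g x + k x))\<^sup>2)"
  proof (rule integral_cong_AE)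
    show "AE x in lebesgue_on \<Omega>. (norm (weak_grad \<Omega> u x + weak_grad \<Omega> w x))\<^sup>2 = (norm (g x + k x))\<^sup>2"
      using weak_grad_AE_eq[OF u] weak_grad_AE_eq[OF w] by eventually_elim simp
    have L: "weak_grad \<Omega> u \<in> L2_space \<Omega>" "weak_grad \<Omega> w \<in> L2_space \<Omega>"
      using u w weak_grad_works H1_space_iff has_H1_gradientD(2) by blast+
    show "(\<lambda>x. (norm (weak_grad \<Omega> u x + weak_grad \<Omega> w x))\<^sup>2) \<in> borel_measurable (lebesgue_on \<Omega>)"
      using L2_spaceD(2)[OF L2_space_add[OF L]] by blast
    show "(\<lambda>x. (norm (g x + k x))\<^sup>2) \<in> borel_measurable (lebesgue_on \<Omega>)"
      using L2_spaceD(2)[OF L2_space_add[OF has_H1_gradientD(2)[OF u] has_H1_gradientD(2)[OF w]]] by blast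
  qed
  ultimately show ?thesis by (simp add: functional_J_def)
qed

text \<open>The positivity set only shrinks along the segment from \<open>u'\<close> towards \<open>w\<close>, so replacing it by
  that of \<open>u'\<close> bounds the functional from above by a quadratic polynomial in the parameter.\<close>

lemma minimizer_variation:
  assumes h: "h > 0" and v: "v \<in> L2_space \<Omega>" and w: "w \<in> admissible \<Omega> u0"
    and min: "is_arg_min (functional_J \<Omega> h v w) (\<lambda>w. w \<in> admissible \<Omega> u0) u'"
    and g: "has_H1_gradient \<Omega> u' g" and k: "has_H1_gradient \<Omega> w k"
  shows "0 \<le> (LINT x|lebesgue_on \<Omega>. indicator (positivity_set \<Omega> v w u') x * ((u' x - 2 * v x + w x) * (w x - u' x)))
      / h\<^sup>2 + 1 / 2 * (LINT x|lebesgue_on \<Omega>. (g x + k x) \<bullet> (k x - g x))" (is "0 \<le> ?X")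
proof -
  let ?I = "indicator (positivity_set \<Omega> v w u') :: 'a \<Rightarrow> real"
  define a where "a x = u' x - 2 * v x + w x" for x
  define d where "d x = w x - u' x" for x
  define G where "G x = g x + k x" for x
  define D where "D x = k x - g x" for x
  note gD = has_H1_gradientD[OF g] and kD = has_H1_gradientD[OF k]
  have aL: "a \<in> L2_space \<Omega>"
    using L2_space_add[OF L2_space_lincomb[OF gD(1) v, of 1 "-2"] kD(1)] by (simp add: a_def[abs_def])
  have dL: "d \<in> L2_space \<Omega>" unfolding d_def[abs_def] by (rule L2_space_diff[OF kD(1) gD(1)])
  have GL: "G \<in> L2_space \<Omega>" unfolding G_def[abs_def] by (rule L2_space_add[OF gD(2) kD(2)])
  have DL: "D \<in> L2_space \<Omega>" unfolding D_def[abs_def] by (rule L2_space_diff[OF kD(2) gD(2)])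
  have "positivity_set \<Omega> v w u' \<in> sets (lebesgue_on \<Omega>)"
    using positivity_set_measurable L2_spaceD(1) gD(1) kD(1) v by blast
  then have Im: "?I \<in> borel_measurable (lebesgue_on \<Omega>)" by measurable
  have IL: "(\<lambda>x. ?I x * f x) \<in> L2_space \<Omega>" if "f \<in> L2_space \<Omega>" for f
    using L2_space_scale_bounded[OF that Im, of 1] by (simp add: indicator_def)
  have int: "integrable (lebesgue_on \<Omega>) (\<lambda>x. ?I x * (f x * f' x))" if "f \<in> L2_space \<Omega>" "f' \<in> L2_space \<Omega>" for f f'
    using L2_mult_integrable[OF IL[OF that(1)] that(2)] by (simp add: mult.assoc)
  \<comment> \<open>The coefficient of t^2. After division by \<open>t\<close> its contribution is
    \<open>t * Y\<close>, which tends to 0.\<close>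
  define Y where "Y = (LINT x|lebesgue_on \<Omega>. ?I x * (d x * d x)) / (2 * h\<^sup>2) + 1 / 4 * (LINT x|lebesgue_on \<Omega>. D x \<bullet> D x)"
  \<comment> \<open>Together with the gradient part this equals the functional at
    \<open>t = 0\<close> and dominates it for 0 < t < 1, which turns minimality of \<open>u'\<close>
    into a sign for the linear coefficient.\<close>
  define A where "A t = (LINT x|lebesgue_on \<Omega>. ?I x * ((a x + t * d x)\<^sup>2 / (2 * h\<^sup>2)))" for t
  define B where "B t = (LINT x|lebesgue_on \<Omega>. (norm (G x + t *\<^sub>R D x))\<^sup>2)" for t
  have A: "A t = A 0 + t * ((LINT x|lebesgue_on \<Omega>. ?I x * (a x * d x)) / h\<^sup>2)
      + t\<^sup>2 * ((LINT x|lebesgue_on \<Omega>. ?I x * (d x * d x)) / (2 * h\<^sup>2))" for t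
  proof -
    have "?I x * ((a x + t * d x)\<^sup>2 / (2 * h\<^sup>2)) = ?I x * (a x * a x) / (2 * h\<^sup>2)
        + (t / h\<^sup>2) * (?I x * (a x * d x)) + (t\<^sup>2 / (2 * h\<^sup>2)) * (?I x * (d x * d x))" for x t
      using h by (simp add: field_simps power2_eq_square)
    then have "A t = (LINT x|lebesgue_on \<Omega>. ?I x * (a x * a x)) / (2 * h\<^sup>2)
        + (t / h\<^sup>2) * (LINT x|lebesgue_on \<Omega>. ?I x * (a x * d x))
        + (t\<^sup>2 / (2 * h\<^sup>2)) * (LINT x|lebesgue_on \<Omega>. ?I x * (d x * d x))" for t
      unfolding A_def using int[OF aL aL] int[OF aL dL] int[OF dL dL] by simp
    from this[of t] this[of 0] show ?thesis by simp
  qed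
  have B: "B t = B 0 + 2 * t * (LINT x|lebesgue_on \<Omega>. G x \<bullet> D x) + t\<^sup>2 * (LINT x|lebesgue_on \<Omega>. D x \<bullet> D x)" for t
  proof -
    have "(norm (G x + t *\<^sub>R D x))\<^sup>2 = G x \<bullet> G x + (2 * t) * (G x \<bullet> D x) + t\<^sup>2 * (D x \<bullet> D x)" for x t
      unfolding power2_norm_eq_inner
      by (simp add: inner_add_left inner_add_right inner_commute algebra_simps power2_eq_square)
    then have "B t = (LINT x|lebesgue_on \<Omega>. G x \<bullet> G x) + (2 * t) * (LINT x|lebesgue_on \<Omega>. G x \<bullet> D x)
        + t\<^sup>2 * (LINT x|lebesgue_on \<Omega>. D x \<bullet> D x)" for t
      unfolding B_def using L2_inner_integrable[OF GL GL] L2_inner_integrable[OF GL DL] L2_inner_integrable[OF DL DL]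
      by simp
    from this[of t] this[of 0] show ?thesis by simp
  qed
  have u': "u' \<in> admissible \<Omega> u0" and minJ: "\<And>y. y \<in> admissible \<Omega> u0 \<Longrightarrow> functional_J \<Omega> h v w u' \<le> functional_J \<Omega> h v w y"
    using min by (auto simp: is_arg_min_linorder)
  have X: "?X = (LINT x|lebesgue_on \<Omega>. ?I x * (a x * d x)) / h\<^sup>2 + 1 / 2 * (LINT x|lebesgue_on \<Omega>. G x \<bullet> D x)"
    by (simp add: a_def d_def G_def D_def)
  have main: "0 \<le> ?X + t * Y" if t: "0 < t" "t < 1" for t
  proof -
    let ?y = "\<lambda>x. (1 - t) * u' x + t * w x"
    let ?Q = "positivity_set \<Omega> v w ?y"
    have y: "has_H1_gradient \<Omega> ?y (\<lambda>x. (1 - t) *\<^sub>R g x + t *\<^sub>R k x)"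
      by (rule has_H1_gradient_lincomb[OF g k])
    have eq: "(1 - t) * u' x + t * w x - 2 * v x + w x = a x + t * d x"
      "(1 - t) *\<^sub>R g x + t *\<^sub>R k x + k x = G x + t *\<^sub>R D x" for x
      by (simp_all add: a_def d_def G_def D_def algebra_simps)
    have QP: "?Q \<subseteq> positivity_set \<Omega> v w u'"
    proof
      fix x assume "x \<in> ?Q"
      moreover have "(1 - t) * u' x + t * w x \<le> 0" if "u' x \<le> 0" "w x \<le> 0"
        using t that by (intro add_nonpos_nonpos mult_nonneg_nonpos) auto
      ultimately show "x \<in> positivity_set \<Omega> v w u'"
        unfolding positivity_set_def by (auto simp: not_le[symmetric])
    qed
    have adL: "(\<lambda>x. a x + t * d x) \<in> L2_space \<Omega>"
      using L2_space_lincomb[OF aL dL, of 1 t] by simp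
    have "(LINT x|lebesgue_on \<Omega>. indicator ?Q x * ((a x + t * d x)\<^sup>2 / (2 * h\<^sup>2))) \<le> A t"
      unfolding A_def
    proof (rule integral_mono')
      show "integrable (lebesgue_on \<Omega>) (\<lambda>x. ?I x * ((a x + t * d x)\<^sup>2 / (2 * h\<^sup>2)))"
        using int[OF adL adL] by (simp add: power2_eq_square)
      show "indicator ?Q x * ((a x + t * d x)\<^sup>2 / (2 * h\<^sup>2)) \<le> ?I x * ((a x + t * d x)\<^sup>2 / (2 * h\<^sup>2))" for x
        using QP by (intro mult_right_mono) (auto simp: indicator_def)
      show "0 \<le> ?I x * ((a x + t * d x)\<^sup>2 / (2 * h\<^sup>2))" for x by simp
    qed
    then have "functional_J \<Omega> h v w ?y \<le> A t + 1 / 4 * B t"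
      unfolding functional_J_eq[OF y k v] eq B_def by simp
    moreover have "functional_J \<Omega> h v w u' = A 0 + 1 / 4 * B 0"
      unfolding functional_J_eq[OF g k v] A_def B_def by (simp add: a_def G_def)
    moreover have "functional_J \<Omega> h v w u' \<le> functional_J \<Omega> h v w ?y"
      by (intro minJ admissible_convex u' w)
    ultimately have "A 0 + 1 / 4 * B 0 \<le> A t + 1 / 4 * B t" by linarith
    moreover have "A t + 1 / 4 * B t = A 0 + 1 / 4 * B 0 + t * (?X + t * Y)"
      unfolding X Y_def A[of t] B[of t] by (simp add: algebra_simps power2_eq_square)
    ultimately have "0 \<le> t * (?X + t * Y)" by linarith
    with t(1) show ?thesis by (simp add: zero_le_mult_iff)
  qed
  have "((\<lambda>t. ?X + t * Y) \<longlongrightarrow> ?X + 0 * Y) (at_right 0)" by (intro tendsto_intros)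
  moreover have "\<forall>\<^sub>F t in at_right (0::real). 0 \<le> ?X + t * Y"
    unfolding eventually_at_right_field using main by (intro exI[of _ 1]) auto
  ultimately have "0 \<le> ?X + 0 * Y" by (rule tendsto_lowerbound) simp
  then show ?thesis by simp
qed

text \<open>\<open>w\<close> is the iterate two steps back, so the gradients on the two sides skip
  one index. The sign of \<open>v\<close> makes it 0 off the positivity set and makes the cut-off
  come no farther from \<open>v\<close>. No sign is asked of \<open>w\<close>, which at the first
  step is \<open>u 0\<close>.\<close>

lemma energy_step:
  assumes h: "h > 0" and v: "v \<in> L2_space \<Omega>" "AE x in lebesgue_on \<Omega>. v x \<ge> 0"
    and w: "w \<in> admissible \<Omega> u0"
    and min: "is_arg_min (functional_J \<Omega> h v w) (\<lambda>w. w \<in> admissible \<Omega> u0) u'"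
    and z: "AE x in lebesgue_on \<Omega>. z x = max (u' x) 0"
  shows "(L2_norm \<Omega> (\<lambda>x. (z x - v x) / h))\<^sup>2 + 1 / 2 * (L2_norm \<Omega> (weak_grad \<Omega> z))\<^sup>2
    \<le> (L2_norm \<Omega> (\<lambda>x. (v x - w x) / h))\<^sup>2 + 1 / 2 * (L2_norm \<Omega> (weak_grad \<Omega> w))\<^sup>2"
proof -
  let ?P = "positivity_set \<Omega> v w u'"
  let ?I = "indicator ?P :: 'a \<Rightarrow> real"
  have "u' \<in> admissible \<Omega> u0" using min by (simp add: is_arg_min_def)
  then obtain g k where g: "has_H1_gradient \<Omega> u' g" and k: "has_H1_gradient \<Omega> w k"
    using w unfolding admissible_def H1_space_iff by blast
  note gD = has_H1_gradientD[OF g] and kD = has_H1_gradientD[OF k]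
  note pos = has_H1_gradient_pos_part[OF g]
  have zg: "has_H1_gradient \<Omega> z (\<lambda>x. indicator {0<..} (u' x) *\<^sub>R g x)"
    by (rule has_H1_gradient_cong_AE[OF pos z])
  note zD = has_H1_gradientD[OF zg]
  have "?P \<in> sets (lebesgue_on \<Omega>)"
    using positivity_set_measurable L2_spaceD(1) gD(1) kD(1) v by blast
  then have Im: "?I \<in> borel_measurable (lebesgue_on \<Omega>)" by measurable
  have Isq: "integrable (lebesgue_on \<Omega>) (\<lambda>x. ?I x * (f x)\<^sup>2)" if "f \<in> L2_space \<Omega>" for f
  proof -
    have "integrable (lebesgue_on \<Omega>) (\<lambda>x. (f x)\<^sup>2 * ?I x)"
      by (rule integrable_mult_bounded[OF L2_space_real_integrable[OF that] Im, of 1]) (simp add: indicator_def)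
    then show ?thesis by (simp add: mult.commute)
  qed
  have uv: "(\<lambda>x. u' x - v x) \<in> L2_space \<Omega>" and vw: "(\<lambda>x. v x - w x) \<in> L2_space \<Omega>"
    and zv: "(\<lambda>x. z x - v x) \<in> L2_space \<Omega>"
    by (intro L2_space_diff gD kD zD v)+
  define U where "U = (LINT x|lebesgue_on \<Omega>. ?I x * (u' x - v x)\<^sup>2)"
  define W where "W = (LINT x|lebesgue_on \<Omega>. ?I x * (v x - w x)\<^sup>2)"
  have X1: "(LINT x|lebesgue_on \<Omega>. ?I x * ((u' x - 2 * v x + w x) * (w x - u' x))) = W - U"
  proof -
    \<comment> \<open>With p = \<open>w x - v x\<close> and q = \<open>u' x - v x\<close> the two
      factors are p + q and p - q.\<close>
    have "?I x * ((u' x - 2 * v x + w x) * (w x - u' x)) = ?I x * (v x - w x)\<^sup>2 - ?I x * (u' x - v x)\<^sup>2" for x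
      by (simp add: power2_eq_square algebra_simps)
    then show ?thesis unfolding U_def W_def using Isq[OF uv] Isq[OF vw] by simp
  qed
  have X2: "(LINT x|lebesgue_on \<Omega>. (g x + k x) \<bullet> (k x - g x)) = (L2_norm \<Omega> k)\<^sup>2 - (L2_norm \<Omega> g)\<^sup>2"
  proof -
    have "(g x + k x) \<bullet> (k x - g x) = (norm (k x))\<^sup>2 - (norm (g x))\<^sup>2" for x
      unfolding power2_norm_eq_inner by (simp add: inner_add_left inner_add_right inner_diff_left inner_diff_right inner_commute)
    then show ?thesis
      unfolding L2_norm_square using L2_spaceD(2)[OF gD(2)] L2_spaceD(2)[OF kD(2)] by simp
  qed
  have key: "U / h\<^sup>2 + 1 / 2 * (L2_norm \<Omega> g)\<^sup>2 \<le> W / h\<^sup>2 + 1 / 2 * (L2_norm \<Omega> k)\<^sup>2"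
    using minimizer_variation[OF h v(1) w min g k] unfolding X1 X2 by (simp add: diff_divide_distrib)
  have div: "(L2_norm \<Omega> (\<lambda>x. f x / h))\<^sup>2 = (LINT x|lebesgue_on \<Omega>. (f x)\<^sup>2) / h\<^sup>2" for f :: "'a \<Rightarrow> real"
    unfolding L2_norm_square by (simp add: power_divide)
  have "(LINT x|lebesgue_on \<Omega>. (z x - v x)\<^sup>2) \<le> U"
    unfolding U_def
  proof (rule integral_mono_AE)
    show "integrable (lebesgue_on \<Omega>) (\<lambda>x. (z x - v x)\<^sup>2)" by (rule L2_space_real_integrable[OF zv])
    show "integrable (lebesgue_on \<Omega>) (\<lambda>x. ?I x * (u' x - v x)\<^sup>2)" by (rule Isq[OF uv])
    have "AE x in lebesgue_on \<Omega>. x \<in> \<Omega>" by (simp add: AE_lebesgue_on_iff)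
    with z v(2) show "AE x in lebesgue_on \<Omega>. (z x - v x)\<^sup>2 \<le> ?I x * (u' x - v x)\<^sup>2"
    proof eventually_elim
      case (elim x)
      show ?case
      proof (cases "x \<in> ?P")
        case True
        \<comment> \<open>Projecting \<open>u' x\<close> onto the nonnegative half-line does not
          increase its distance to a nonnegative number such as \<open>v x\<close>.\<close>
        have "\<bar>z x - v x\<bar> \<le> \<bar>u' x - v x\<bar>" using elim by (auto simp: max_def)
        with True show ?thesis by (simp add: abs_le_square_iff)
      next
        case False
        with elim have "u' x \<le> 0" "v x = 0" by (auto simp: positivity_set_def)
        with elim(1) show ?thesis by simp
      qed
    qed
  qed
  then have 1: "(L2_norm \<Omega> (\<lambda>x. (z x - v x) / h))\<^sup>2 \<le> U / h\<^sup>2"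
    unfolding div by (rule divide_right_mono) simp
  have "W \<le> (LINT x|lebesgue_on \<Omega>. (v x - w x)\<^sup>2)"
    unfolding W_def using Isq[OF vw] L2_space_real_integrable[OF vw]
    by (rule integral_mono) (simp add: indicator_def)
  then have 2: "W / h\<^sup>2 \<le> (L2_norm \<Omega> (\<lambda>x. (v x - w x) / h))\<^sup>2"
    unfolding div by (rule divide_right_mono) simp
  have 3: "(L2_norm \<Omega> (weak_grad \<Omega> z))\<^sup>2 \<le> (L2_norm \<Omega> g)\<^sup>2"
    unfolding L2_norm_weak_grad[OF zg] L2_norm_square
    using L2_spaceD(2)[OF zD(2)] L2_spaceD(2)[OF gD(2)]
    by (rule integral_mono) (simp add: indicator_def)
  show ?thesis
    using 1 2 3 key unfolding L2_norm_weak_grad[OF k] by linarith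
qed

text \<open>\<open>H10_space_pos_part\<close> wants a nonnegative reference function with the right
  boundary values. \<open>u0\<close> may be negative inside \<open>\<Omega>\<close>, so
  \<open>u1\<close> serves as reference and the difference \<open>u1 - u0\<close> is added back
  afterwards.\<close>

lemma cutoff_admissible:
  assumes u1: "u1 \<in> admissible \<Omega> u0" "AE x in lebesgue_on \<Omega>. u1 x \<ge> 0"
    and u': "u' \<in> admissible \<Omega> u0" and z: "AE x in lebesgue_on \<Omega>. z x = max (u' x) 0"
  shows "z \<in> admissible \<Omega> u0"
proof -
  obtain g1 g where g1: "has_H1_gradient \<Omega> u1 g1" and g: "has_H1_gradient \<Omega> u' g"
    using u1 u' unfolding admissible_def H1_space_iff by blast
  have d: "(\<lambda>x. u1 x - u0 x) \<in> H10_space \<Omega>" "(\<lambda>x. u' x - u0 x) \<in> H10_space \<Omega>"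
    using u1 u' by (auto simp: admissible_def)
  have "(\<lambda>x. u' x - u1 x) \<in> H10_space \<Omega>"
    using H10_space_lincomb[OF d(2,1), of 1 "-1"] by simp
  from H10_space_pos_part[OF g1 u1(2) g this] have "(\<lambda>x. max (u' x) 0 - u1 x) \<in> H10_space \<Omega>" .
  from H10_space_lincomb[OF this d(1), of 1 1] have "(\<lambda>x. max (u' x) 0 - u0 x) \<in> H10_space \<Omega>" by simp
  moreover have "AE x in lebesgue_on \<Omega>. z x - u0 x = max (u' x) 0 - u0 x"
    using z by eventually_elim simp
  ultimately have "(\<lambda>x. z x - u0 x) \<in> H10_space \<Omega>" by (rule H10_space_cong_AE)
  moreover have "z \<in> H1_space \<Omega>"
    using has_H1_gradient_cong_AE[OF has_H1_gradient_pos_part[OF g] z] H1_space_iff by blast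
  ultimately show ?thesis by (simp add: admissible_def)
qed

lemma admissible_refl: "u0 \<in> H1_space \<Omega> \<Longrightarrow> u0 \<in> admissible \<Omega> u0"
proof -
  assume u0: "u0 \<in> H1_space \<Omega>"
  \<comment> \<open>The zero function inherits its smoothness as 0 times a bump.\<close>
  have "(\<lambda>x::'a. 0) \<in> test_functions \<Omega>"
    using smooth_scale(1)[OF smooth_bump[of 0], of 0] by (auto simp: test_functions_iff)
  then have "(\<lambda>x. 0) \<in> H10_space \<Omega>"
    by (intro H10_spaceI[OF test_has_H1_gradient] bexI[of _ "\<lambda>x. 0"]) (auto simp: H1_square_def)
  with u0 show ?thesis by (simp add: admissible_def)
qed

lemma admissible_add_H10:
  assumes u0: "u0 \<in> H1_space \<Omega>" and v0: "v0 \<in> H10_space \<Omega>"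
    and u1: "AE x in lebesgue_on \<Omega>. u1 x = u0 x + h * v0 x"
  shows "u1 \<in> admissible \<Omega> u0"
proof -
  obtain g k where "has_H1_gradient \<Omega> u0 g" "has_H1_gradient \<Omega> v0 k"
    using u0 H10_space_H1[OF v0] unfolding H1_space_iff by blast
  from has_H1_gradient_lincomb[OF this, of 1 h] u1 have "u1 \<in> H1_space \<Omega>"
    unfolding H1_space_iff using has_H1_gradient_cong_AE by auto
  moreover have "AE x in lebesgue_on \<Omega>. u1 x - u0 x = h * v0 x + 0 * v0 x"
    using u1 by eventually_elim simp
  then have "(\<lambda>x. u1 x - u0 x) \<in> H10_space \<Omega>"
    by (rule H10_space_cong_AE[OF H10_space_lincomb[OF v0 v0]])
  ultimately show ?thesis by (simp add: admissible_def)
qed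

end

section \<open>Telescoping over the time steps\<close>

theorem theorem3p3:
  fixes \<Omega> :: "'a::euclidean_space set"
    and h :: real
    and v0 :: "'a \<Rightarrow> real"
    and u :: "nat \<Rightarrow> 'a \<Rightarrow> real"
    and k :: nat
  assumes "bounded_lipschitz_domain \<Omega>"
    and "h > 0"
    and "u 0 \<in> H1_space \<Omega>"
    and "v0 \<in> H10_space \<Omega>"
    and "cutoff_minimizers \<Omega> h v0 u"
    and "AE x in lebesgue_on \<Omega>. u 1 x \<ge> 0"
    and "k \<ge> 1"
  shows "(L2_norm \<Omega> (\<lambda>x. (u k x - u (k - 1) x) / h))\<^sup>2
           + 1 / 2 * (L2_norm \<Omega> (weak_grad \<Omega> (u k)))\<^sup>2
         \<le> (L2_norm \<Omega> v0)\<^sup>2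
           + 1 / 2 * (L2_norm \<Omega> (weak_grad \<Omega> (u 0)))\<^sup>2
           + 1 / 2 * (L2_norm \<Omega> (weak_grad \<Omega> (u 1)))\<^sup>2"
proof -
  interpret bounded_open_set \<Omega>
    using assms(1) by unfold_locales (auto simp: bounded_lipschitz_domain_def)
  have u1: "AE x in lebesgue_on \<Omega>. u 1 x = u 0 x + h * v0 x"
    using assms(5) by (simp add: cutoff_minimizers_def)
  have min: "\<exists>u'. is_arg_min (functional_J \<Omega> h (u (m - 1)) (u (m - 2))) (\<lambda>w. w \<in> admissible \<Omega> (u 0)) u' \<and>
      (AE x in lebesgue_on \<Omega>. u m x = max (u' x) 0)" if "m \<ge> 2" for m
    using assms(5) that by (simp add: cutoff_minimizers_def)
  have adm1: "u 1 \<in> admissible \<Omega> (u 0)"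
    by (rule admissible_add_H10[OF assms(3,4) u1])
  have adm: "u m \<in> admissible \<Omega> (u 0)" for m
  proof -
    consider "m = 0" | "m = 1" | "m \<ge> 2" by linarith
    then show ?thesis
    proof cases
      case 3
      from min[OF this] obtain u' where u':
        "is_arg_min (functional_J \<Omega> h (u (m - 1)) (u (m - 2))) (\<lambda>w. w \<in> admissible \<Omega> (u 0)) u'"
        "AE x in lebesgue_on \<Omega>. u m x = max (u' x) 0" by blast
      from u'(1) have "u' \<in> admissible \<Omega> (u 0)" by (simp only: is_arg_min_def)
      from cutoff_admissible[OF adm1 assms(6) this u'(2)] show ?thesis .
    qed (use adm1 admissible_refl[OF assms(3)] in auto)
  qed
  have nonneg: "AE x in lebesgue_on \<Omega>. u m x \<ge> 0" if "m \<ge> 1" for m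
  proof (cases "m = 1")
    case False
    with that have "m \<ge> 2" by simp
    from min[OF this] obtain u' where "AE x in lebesgue_on \<Omega>. u m x = max (u' x) 0" by blast
    then show ?thesis by eventually_elim simp
  qed (use assms(6) in simp)
  have L2: "u m \<in> L2_space \<Omega>" for m
    using adm[of m] by (simp add: admissible_def H1_space_def)
  \<comment> \<open>Each step links the indices m and m - 2, so the energy carries two consecutive
    gradients; its value at 1 accounts for both initial gradients in the bound.\<close>
  define E where "E m = (L2_norm \<Omega> (\<lambda>x. (u m x - u (m - 1) x) / h))\<^sup>2
    + 1 / 2 * (L2_norm \<Omega> (weak_grad \<Omega> (u m)))\<^sup>2 + 1 / 2 * (L2_norm \<Omega> (weak_grad \<Omega> (u (m - 1))))\<^sup>2" for m
  have v0L: "v0 \<in> L2_space \<Omega>"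
    using H10_space_H1[OF assms(4)] by (simp add: H1_space_def)
  have "E k \<le> E 1"
    using assms(7)
  proof (induction k rule: dec_induct)
    case (step m)
    have "Suc m \<ge> 2" using step(1) by simp
    from min[OF this] obtain u' where u':
      "is_arg_min (functional_J \<Omega> h (u m) (u (m - 1))) (\<lambda>w. w \<in> admissible \<Omega> (u 0)) u'"
      "AE x in lebesgue_on \<Omega>. u (Suc m) x = max (u' x) 0" by auto
    from energy_step[OF assms(2) L2 nonneg[OF step(1)] adm u'] have "E (Suc m) \<le> E m"
      by (simp add: E_def)
    with step(3) show ?case by simp
  qed simp
  moreover have v0: "L2_norm \<Omega> (\<lambda>x. (u 1 x - u (1 - 1) x) / h) = L2_norm \<Omega> v0"
  proof (rule L2_norm_cong_AE[OF _ v0L])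
    show "(\<lambda>x. (u 1 x - u (1 - 1) x) / h) \<in> L2_space \<Omega>"
      using L2_space_lincomb[OF L2[of 1] L2[of 0], of "1 / h" "- 1 / h"] by (simp add: diff_divide_distrib)
    show "AE x in lebesgue_on \<Omega>. (u 1 x - u (1 - 1) x) / h = v0 x"
      using u1 by eventually_elim (use assms(2) in simp)
  qed
  moreover have "E 1 = (L2_norm \<Omega> v0)\<^sup>2 + 1 / 2 * (L2_norm \<Omega> (weak_grad \<Omega> (u 0)))\<^sup>2
      + 1 / 2 * (L2_norm \<Omega> (weak_grad \<Omega> (u 1)))\<^sup>2"
    unfolding E_def v0 by simp
  \<comment> \<open>\<open>E k\<close> still contains the gradient of \<open>u (k - 1)\<close>,
    which is discarded here.\<close>
  moreover have "0 \<le> (L2_norm \<Omega> (weak_grad \<Omega> (u (k - 1))))\<^sup>2" by simp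
  ultimately show ?thesis unfolding E_def[of k] by linarith
qed

end
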